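(* Let $M$ be a three-dimensional contact sub-Riemannian manifold, equipped with a smooth measure $\mu$, and let $\Sigma\subset M$ be a $C^2$ embedded surface. Assume that all characteristic points of $\Sigma$ are isolated and non-degenerate. Then the horizontal mean curvature $\mathcal{H}$ of $\Sigma$ satisfies $$\mathcal{H}\in L^1_{\mathrm{loc}}(\Sigma,\sigma_{\mathrm{R}}),$$ where $\sigma_{\mathrm{R}}$ denotes the Riemannian measure induced by $\mu$ on $\Sigma$.
   Context: A three-dimensional contact sub-Riemannian manifold is a smooth connected 3-manifold $M$ with a contact one-form $\omega$ (i.e. $\omega\wedge d\omega\neq 0$ everywhere), the rank-2 distribution $\mathcal{D}=\ker\omega\subset TM$, and a smooth metric $g$ on $\mathcal{D}$. A smooth measure $\mu$ is one given by a smooth positive density. Horizontal gradient and divergence: for a $C^1$ function $f$, $\nabla f$ is the section of $\mathcal{D}$ with $g(\nabla f,V)=Vf$ for all sections $V$ of $\mathcal{D}$; if $X_1,X_2$ is a local orthonormal frame of $\mathcal{D}$ then $\nabla f=\sum_i (X_if)X_i$. The norm is $\|\nabla f\|=g(\nabla f,\nabla f)^{1/2}$. The divergence $\mathrm{div}_\mu(X)$ is defined by $\mathcal{L}_X\mu=\mathrm{div}_\mu(X)\mu$. A local defining function for $\Sigma$ near $p\in\Sigma$ is a $C^2$ function $u$ on a neighborhood $U\subset M$ of $p$ with $\Sigma\cap U=\{u=0\}$ and $du\neq0$ on $\Sigma\cap U$. Characteristic points: $p\in\Sigma$ is characteristic if $\mathcal{D}_p\subseteq T_p\Sigma$, equivalently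 $X_1u(p)=X_2u(p)=0$. The set of characteristic points is $C(\Sigma)$; it is closed and has zero measure in $\Sigma$. A characteristic point is isolated if it is an isolated point of $C(\Sigma)$. Horizontal Hessian: given an affine connection $\tilde\nabla$ on $\mathcal{D}$, $\mathrm{Hess}_{\mathrm{H}}(u)(V,W)=g(\tilde\nabla_V\nabla u,W)$ for sections $V,W$ of $\mathcal{D}$. At a characteristic point $p$ it is independent of $\tilde\nabla$ and, in the frame $X_1,X_2$, is given by the matrix $(X_iX_ju(p))_{i,j}$. The characteristic point $p$ is non-degenerate if $\det(\mathrm{Hess}_{\mathrm{H}}(u)|_p)\neq0$; this is independent of the choice of $u$. Horizontal mean curvature: for $p\in\Sigma\setminus C(\Sigma)$, $\mathcal{H}(p)=-\mathrm{div}_\mu\left(\frac{\nabla u}{\|\nabla u\|}\right)\big|_p$ with $u$ a local defining function for $\Sigma$ near $p$; up to sign it does not depend on $u$. Riemannian induced measure: choose any Riemannian metric on $M$ extending $g$, and let $n$ be the corresponding unit normal to $\Sigma$; $\sigma_{\mathrm{R}}$ is the measure on $\Sigma$ with density $|i_n\mu|$. The choice of extension plays no role in the integrability statement. $f\in L^1_{\mathrm{loc}}(\Sigma,\sigma_{\mathrm{R}})$ means that every point of $\Sigma$ has a neighborhood in $\Sigma$ on which $|f|$ is $\sigma_{\mathrm{R}}$-integrable. *)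

theory Defs
  imports "HOL-Analysis.Analysis"
begin

section \<open>Functions of class \<open>C\<^sup>k\<close> on open sets\<close>

primrec Ck_on :: "nat \<Rightarrow> 'a::euclidean_space set \<Rightarrow> ('a \<Rightarrow> 'b::real_normed_vector) \<Rightarrow> bool" where
  "Ck_on 0 T f \<longleftrightarrow> continuous_on T f"
| "Ck_on (Suc k) T f \<longleftrightarrow> (\<forall>x\<in>T. f differentiable (at x)) \<and>
     (\<forall>v. Ck_on k T (\<lambda>x. frechet_derivative f (at x) v))"

definition smooth_on :: "'a::euclidean_space set \<Rightarrow> ('a \<Rightarrow> 'b::real_normed_vector) \<Rightarrow> bool" where
  "smooth_on T f \<longleftrightarrow> (\<forall>k. Ck_on k T f)"


section \<open>Smooth 3-manifolds\<close>

text \<open>The manifold is a whole type \<open>'m\<close>. A chart is a pair of its domain and its coordinate map.\<close>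

type_synonym 'm chart = "'m set \<times> ('m \<Rightarrow> real^3)"

abbreviation chart_dom :: "'m chart \<Rightarrow> 'm set" where "chart_dom \<equiv> fst"
abbreviation chart_map :: "'m chart \<Rightarrow> 'm \<Rightarrow> real^3" where "chart_map \<equiv> snd"

definition chart_img :: "'m chart \<Rightarrow> (real^3) set" where
  "chart_img c = chart_map c ` chart_dom c"

definition chart_inv :: "'m chart \<Rightarrow> real^3 \<Rightarrow> 'm" where
  "chart_inv c = inv_into (chart_dom c) (chart_map c)"

definition is_chart :: "'m::topological_space chart \<Rightarrow> bool" where
  "is_chart c \<longleftrightarrow> open (chart_dom c) \<and> open (chart_img c) \<and>
     homeomorphism (chart_dom c) (chart_img c) (chart_map c) (chart_inv c)"

definition transition :: "'m chart \<Rightarrow> 'm chart \<Rightarrow> real^3 \<Rightarrow> real^3" where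
  "transition c c' = chart_map c' \<circ> chart_inv c"

definition Ck_compatible :: "nat \<Rightarrow> 'm chart \<Rightarrow> 'm chart \<Rightarrow> bool" where
  "Ck_compatible k c c' \<longleftrightarrow>
     Ck_on k (chart_map c ` (chart_dom c \<inter> chart_dom c')) (transition c c') \<and>
     Ck_on k (chart_map c' ` (chart_dom c \<inter> chart_dom c')) (transition c' c)"

definition smooth_atlas :: "'m::{t2_space,second_countable_topology} chart set \<Rightarrow> bool" where
  "smooth_atlas A \<longleftrightarrow> (\<forall>c\<in>A. is_chart c) \<and> (\<Union>c\<in>A. chart_dom c) = UNIV \<and>
     (\<forall>c\<in>A. \<forall>c'\<in>A. \<forall>k. Ck_compatible k c c')"

text \<open>
  Tangent vectors and tensors are given by their components in charts: a field takes a chart \<open>c\<close>, the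
  coordinates \<open>x \<in> chart_img c\<close> of the base point and, for tensors, the components of its vector
  arguments. Its values at \<open>x \<notin> chart_img c\<close> or for charts outside the atlas carry no information.
  The change of components is the differential of the transition map.\<close>

definition dtransition :: "'m chart \<Rightarrow> 'm chart \<Rightarrow> 'm \<Rightarrow> real^3 \<Rightarrow> real^3" where
  "dtransition c c' p = frechet_derivative (transition c c') (at (chart_map c p))"


section \<open>Contact sub-Riemannian structures\<close>

record 'm contact_sr =
  sr_atlas :: "'m chart set"
  sr_form :: "'m chart \<Rightarrow> real^3 \<Rightarrow> real^3 \<Rightarrow> real"
  sr_metric :: "'m chart \<Rightarrow> real^3 \<Rightarrow> real^3 \<Rightarrow> real^3 \<Rightarrow> real"

definition smooth_one_form :: "'m chart set \<Rightarrow> ('m chart \<Rightarrow> real^3 \<Rightarrow> real^3 \<Rightarrow> real) \<Rightarrow> bool" where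
  "smooth_one_form A \<alpha> \<longleftrightarrow>
     (\<forall>c\<in>A. \<forall>x\<in>chart_img c. linear (\<alpha> c x)) \<and>
     (\<forall>c\<in>A. \<forall>v. smooth_on (chart_img c) (\<lambda>x. \<alpha> c x v)) \<and>
     (\<forall>c\<in>A. \<forall>c'\<in>A. \<forall>p\<in>chart_dom c \<inter> chart_dom c'. \<forall>v.
        \<alpha> c (chart_map c p) v = \<alpha> c' (chart_map c' p) (dtransition c c' p v))"

definition ext_deriv :: "(real^3 \<Rightarrow> real^3 \<Rightarrow> real) \<Rightarrow> real^3 \<Rightarrow> real^3 \<Rightarrow> real^3 \<Rightarrow> real" where
  "ext_deriv \<alpha> x v w = frechet_derivative (\<lambda>y. \<alpha> y w) (at x) v - frechet_derivative (\<lambda>y. \<alpha> y v) (at x) w"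

definition wedge12 :: "(real^3 \<Rightarrow> real) \<Rightarrow> (real^3 \<Rightarrow> real^3 \<Rightarrow> real) \<Rightarrow> real^3 \<Rightarrow> real^3 \<Rightarrow> real^3 \<Rightarrow> real" where
  "wedge12 \<alpha> \<beta> u v w = \<alpha> u * \<beta> v w + \<alpha> v * \<beta> w u + \<alpha> w * \<beta> u v"

definition contact_form :: "'m chart set \<Rightarrow> ('m chart \<Rightarrow> real^3 \<Rightarrow> real^3 \<Rightarrow> real) \<Rightarrow> bool" where
  "contact_form A \<omega> \<longleftrightarrow> smooth_one_form A \<omega> \<and>
     (\<forall>c\<in>A. \<forall>x\<in>chart_img c. wedge12 (\<omega> c x) (ext_deriv (\<omega> c) x) \<noteq> (\<lambda>u v w. 0))"

text \<open>The distribution \<open>ker \<omega>\<close> at the point with coordinates \<open>x\<close>, and its \<open>C\<^sup>k\<close> sections over an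
  open set \<open>T\<close> of coordinates.\<close>

definition distr_at :: "'m contact_sr \<Rightarrow> 'm chart \<Rightarrow> real^3 \<Rightarrow> (real^3) set" where
  "distr_at M c x = {v. sr_form M c x v = 0}"

definition Ck_section :: "'m contact_sr \<Rightarrow> 'm chart \<Rightarrow> nat \<Rightarrow> (real^3) set \<Rightarrow> (real^3 \<Rightarrow> real^3) \<Rightarrow> bool" where
  "Ck_section M c k T V \<longleftrightarrow> Ck_on k T V \<and> (\<forall>x\<in>T. V x \<in> distr_at M c x)"

definition smooth_section :: "'m contact_sr \<Rightarrow> 'm chart \<Rightarrow> (real^3) set \<Rightarrow> (real^3 \<Rightarrow> real^3) \<Rightarrow> bool" where
  "smooth_section M c T V \<longleftrightarrow> (\<forall>k. Ck_section M c k T V)"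

definition inner_product_on :: "(real^3) set \<Rightarrow> (real^3 \<Rightarrow> real^3 \<Rightarrow> real) \<Rightarrow> bool" where
  "inner_product_on D B \<longleftrightarrow>
     (\<forall>v\<in>D. \<forall>w\<in>D. B v w = B w v) \<and>
     (\<forall>u\<in>D. \<forall>v\<in>D. \<forall>w\<in>D. \<forall>a b. B (a *\<^sub>R u + b *\<^sub>R v) w = a * B u w + b * B v w) \<and>
     (\<forall>v\<in>D. v \<noteq> 0 \<longrightarrow> B v v > 0)"

text \<open>The metric is only meaningful on vectors of the distribution, so its smoothness is tested on
  smooth local sections.\<close>

definition smooth_horizontal_metric :: "'m contact_sr \<Rightarrow> bool" where
  "smooth_horizontal_metric M \<longleftrightarrow>
     (\<forall>c\<in>sr_atlas M. \<forall>x\<in>chart_img c. inner_product_on (distr_at M c x) (sr_metric M c x)) \<and>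
     (\<forall>c\<in>sr_atlas M. \<forall>T V W. open T \<and> T \<subseteq> chart_img c \<and> smooth_section M c T V \<and> smooth_section M c T W
        \<longrightarrow> smooth_on T (\<lambda>x. sr_metric M c x (V x) (W x))) \<and>
     (\<forall>c\<in>sr_atlas M. \<forall>c'\<in>sr_atlas M. \<forall>p\<in>chart_dom c \<inter> chart_dom c'.
        \<forall>v\<in>distr_at M c (chart_map c p). \<forall>w\<in>distr_at M c (chart_map c p).
          sr_metric M c (chart_map c p) v w =
          sr_metric M c' (chart_map c' p) (dtransition c c' p v) (dtransition c c' p w))"

definition contact_sub_riemannian :: "'m::{t2_space,second_countable_topology} contact_sr \<Rightarrow> bool" where
  "contact_sub_riemannian M \<longleftrightarrow> connected (UNIV :: 'm set) \<and> smooth_atlas (sr_atlas M) \<and>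
     contact_form (sr_atlas M) (sr_form M) \<and> smooth_horizontal_metric M"


section \<open>Horizontal gradient, smooth measures, divergence\<close>

text \<open>Here \<open>f\<close> is a function of the coordinates of the chart \<open>c\<close>.\<close>

definition hgrad :: "'m contact_sr \<Rightarrow> 'm chart \<Rightarrow> (real^3 \<Rightarrow> real) \<Rightarrow> real^3 \<Rightarrow> real^3" where
  "hgrad M c f x = (THE v. v \<in> distr_at M c x \<and>
     (\<forall>w\<in>distr_at M c x. sr_metric M c x v w = frechet_derivative f (at x) w))"

definition hnorm :: "'m contact_sr \<Rightarrow> 'm chart \<Rightarrow> real^3 \<Rightarrow> real^3 \<Rightarrow> real" where
  "hnorm M c x v = sqrt (sr_metric M c x v v)"

text \<open>A smooth measure is represented by its density \<open>\<mu> c\<close> with respect to Lebesgue measure in the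
  coordinates of each chart \<open>c\<close>.\<close>

definition smooth_measure :: "'m chart set \<Rightarrow> ('m chart \<Rightarrow> real^3 \<Rightarrow> real) \<Rightarrow> bool" where
  "smooth_measure A \<mu> \<longleftrightarrow>
     (\<forall>c\<in>A. smooth_on (chart_img c) (\<mu> c) \<and> (\<forall>x\<in>chart_img c. \<mu> c x > 0)) \<and>
     (\<forall>c\<in>A. \<forall>c'\<in>A. \<forall>p\<in>chart_dom c \<inter> chart_dom c'.
        \<mu> c (chart_map c p) = \<mu> c' (chart_map c' p) * \<bar>det (matrix (dtransition c c' p))\<bar>)"

text \<open>The 3-form that represents \<open>\<mu>\<close> in the chart \<open>c\<close> with the orientation given by the coordinates;
  the other orientation changes its sign, which affects neither the divergence nor \<open>\<bar>i\<^sub>n \<mu>\<bar>\<close>.\<close>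

definition vol_form :: "(real^3 \<Rightarrow> real) \<Rightarrow> real^3 \<Rightarrow> real^3 \<Rightarrow> real^3 \<Rightarrow> real^3 \<Rightarrow> real" where
  "vol_form \<rho> x a b d = \<rho> x * det (vector [a, b, d] :: real^3^3)"

text \<open>Lie derivative of a 3-form \<open>\<tau>\<close>:
  \<open>(L\<^sub>X \<tau>)(a,b,d) = X(\<tau>(a,b,d)) - \<tau>([X,a],b,d) - \<tau>(a,[X,b],d) - \<tau>(a,b,[X,d])\<close>, evaluated on constant
  vector fields, for which \<open>[X,a] = - DX(a)\<close>.\<close>

definition lie_deriv3 ::
  "(real^3 \<Rightarrow> real^3) \<Rightarrow> (real^3 \<Rightarrow> real^3 \<Rightarrow> real^3 \<Rightarrow> real^3 \<Rightarrow> real) \<Rightarrow>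
     real^3 \<Rightarrow> real^3 \<Rightarrow> real^3 \<Rightarrow> real^3 \<Rightarrow> real" where
  "lie_deriv3 X \<tau> x a b d = (let DX = frechet_derivative X (at x) in
     frechet_derivative (\<lambda>y. \<tau> y a b d) (at x) (X x)
     + \<tau> x (DX a) b d + \<tau> x a (DX b) d + \<tau> x a b (DX d))"

definition divergence :: "(real^3 \<Rightarrow> real) \<Rightarrow> (real^3 \<Rightarrow> real^3) \<Rightarrow> real^3 \<Rightarrow> real" where
  "divergence \<rho> X x =
     (THE r. \<forall>a b d. lie_deriv3 X (vol_form \<rho>) x a b d = r * vol_form \<rho> x a b d)"


section \<open>Surfaces and characteristic points\<close>

text \<open>Embedded surfaces without boundary, by \<open>C\<^sup>2\<close> slice charts; a surface need not be a closed subset.\<close>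

definition C2_embedded_surface :: "'m::topological_space chart set \<Rightarrow> 'm set \<Rightarrow> bool" where
  "C2_embedded_surface A S \<longleftrightarrow> (\<forall>p\<in>S. \<exists>s. is_chart s \<and> p \<in> chart_dom s \<and>
     (\<forall>c\<in>A. Ck_compatible 2 c s) \<and>
     chart_map s ` (S \<inter> chart_dom s) = {y \<in> chart_img s. y $ 3 = 0})"

text \<open>Velocities, in the chart \<open>c\<close>, of curves in the surface through \<open>p\<close>.\<close>

definition tangent_space :: "'m set \<Rightarrow> 'm chart \<Rightarrow> 'm \<Rightarrow> (real^3) set" where
  "tangent_space S c p = {v. \<exists>\<gamma>::real \<Rightarrow> 'm. \<exists>\<epsilon>>0. \<gamma> 0 = p \<and>
     (\<forall>t. \<bar>t\<bar> < \<epsilon> \<longrightarrow> \<gamma> t \<in> S \<inter> chart_dom c) \<and>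
     ((\<lambda>t. chart_map c (\<gamma> t)) has_vector_derivative v) (at 0)}"

definition local_defining_function ::
  "'m::topological_space chart set \<Rightarrow> 'm set \<Rightarrow> 'm \<Rightarrow> 'm set \<Rightarrow> ('m \<Rightarrow> real) \<Rightarrow> bool" where
  "local_defining_function A S p U u \<longleftrightarrow> open U \<and> p \<in> S \<inter> U \<and>
     (\<forall>c\<in>A. Ck_on 2 (chart_map c ` (U \<inter> chart_dom c)) (u \<circ> chart_inv c)) \<and>
     S \<inter> U = {q \<in> U. u q = 0} \<and>
     (\<forall>c\<in>A. \<forall>q \<in> S \<inter> U \<inter> chart_dom c.
        frechet_derivative (u \<circ> chart_inv c) (at (chart_map c q)) \<noteq> (\<lambda>v. 0))"

definition char_set :: "'m contact_sr \<Rightarrow> 'm set \<Rightarrow> 'm set" where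
  "char_set M S = {p\<in>S. \<forall>c\<in>sr_atlas M. p \<in> chart_dom c \<longrightarrow>
     distr_at M c (chart_map c p) \<subseteq> tangent_space S c p}"

text \<open>Affine connections on the distribution over the domain of a chart \<open>c\<close>: \<open>N V x v\<close> is the covariant
  derivative at \<open>x\<close> of the local section \<open>V\<close> in the direction \<open>v\<close>. The operator is taken on \<open>C\<^sup>1\<close>
  sections because the gradient of a \<open>C\<^sup>2\<close> function is only \<open>C\<^sup>1\<close>.\<close>

definition horizontal_connection ::
  "'m contact_sr \<Rightarrow> 'm chart \<Rightarrow> ((real^3 \<Rightarrow> real^3) \<Rightarrow> real^3 \<Rightarrow> real^3 \<Rightarrow> real^3) \<Rightarrow> bool" where
  "horizontal_connection M c N \<longleftrightarrow> (\<forall>T. open T \<and> T \<subseteq> chart_img c \<longrightarrow>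
     (\<forall>V. Ck_section M c 1 T V \<longrightarrow>
        (\<forall>x\<in>T. linear (N V x) \<and> range (N V x) \<subseteq> distr_at M c x) \<and>
        (\<forall>W. Ck_section M c 1 T W \<longrightarrow>
           (\<forall>x\<in>T. \<forall>v. N (\<lambda>y. V y + W y) x v = N V x v + N W x v)) \<and>
        (\<forall>f. Ck_on 1 T f \<longrightarrow>
           (\<forall>x\<in>T. \<forall>v. N (\<lambda>y. f y *\<^sub>R V y) x v =
              frechet_derivative f (at x) v *\<^sub>R V x + f x *\<^sub>R N V x v)) \<and>
        (\<forall>W. (\<forall>y\<in>T. W y = V y) \<longrightarrow> (\<forall>x\<in>T. N W x = N V x))) \<and>
     (\<forall>V Y. smooth_section M c T V \<and> smooth_on T Y \<longrightarrow> smooth_on T (\<lambda>x. N V x (Y x))))"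

definition horizontal_hessian ::
  "'m contact_sr \<Rightarrow> 'm chart \<Rightarrow> ((real^3 \<Rightarrow> real^3) \<Rightarrow> real^3 \<Rightarrow> real^3 \<Rightarrow> real^3) \<Rightarrow>
     (real^3 \<Rightarrow> real) \<Rightarrow> real^3 \<Rightarrow> real^3 \<Rightarrow> real^3 \<Rightarrow> real" where
  "horizontal_hessian M c N f x v w = sr_metric M c x (N (hgrad M c f) x v) w"

definition orthonormal_frame_at :: "'m contact_sr \<Rightarrow> 'm chart \<Rightarrow> real^3 \<Rightarrow> (2 \<Rightarrow> real^3) \<Rightarrow> bool" where
  "orthonormal_frame_at M c x e \<longleftrightarrow> (\<forall>i. e i \<in> distr_at M c x) \<and>
     (\<forall>i j. sr_metric M c x (e i) (e j) = of_bool (i = j))"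

text \<open>At a characteristic point, whether the determinant vanishes depends neither on the chart, nor on
  the defining function, the connection and the frame.\<close>

definition nondegenerate :: "'m::topological_space contact_sr \<Rightarrow> 'm set \<Rightarrow> 'm \<Rightarrow> bool" where
  "nondegenerate M S p \<longleftrightarrow> (\<exists>c\<in>sr_atlas M. \<exists>U u N e. p \<in> chart_dom c \<and>
     local_defining_function (sr_atlas M) S p U u \<and> horizontal_connection M c N \<and>
     orthonormal_frame_at M c (chart_map c p) e \<and>
     det (\<chi> i j. horizontal_hessian M c N (u \<circ> chart_inv c) (chart_map c p) (e i) (e j)) \<noteq> 0)"

text \<open>The curvature is determined up to a sign at each point outside the characteristic set, and the
  defining function, hence the sign, may vary from point to point. Values elsewhere are unconstrained.\<close>

definition horizontal_mean_curvature ::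
  "'m::topological_space contact_sr \<Rightarrow> ('m chart \<Rightarrow> real^3 \<Rightarrow> real) \<Rightarrow> 'm set \<Rightarrow> ('m \<Rightarrow> real) \<Rightarrow> bool" where
  "horizontal_mean_curvature M \<mu> S H \<longleftrightarrow> (\<forall>p \<in> S - char_set M S. \<exists>U u.
     local_defining_function (sr_atlas M) S p U u \<and>
     (\<forall>c\<in>sr_atlas M. p \<in> chart_dom c \<longrightarrow>
        H p = - divergence (\<mu> c)
                 (\<lambda>x. hgrad M c (u \<circ> chart_inv c) x /\<^sub>R hnorm M c x (hgrad M c (u \<circ> chart_inv c) x))
                 (chart_map c p)))"


section \<open>The induced Riemannian measure\<close>

definition riemannian_metric :: "'m chart set \<Rightarrow> ('m chart \<Rightarrow> real^3 \<Rightarrow> real^3 \<Rightarrow> real^3 \<Rightarrow> real) \<Rightarrow> bool" where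
  "riemannian_metric A G \<longleftrightarrow>
     (\<forall>c\<in>A. \<forall>x\<in>chart_img c. inner_product_on UNIV (G c x)) \<and>
     (\<forall>c\<in>A. \<forall>v w. smooth_on (chart_img c) (\<lambda>x. G c x v w)) \<and>
     (\<forall>c\<in>A. \<forall>c'\<in>A. \<forall>p\<in>chart_dom c \<inter> chart_dom c'. \<forall>v w.
        G c (chart_map c p) v w =
        G c' (chart_map c' p) (dtransition c c' p v) (dtransition c c' p w))"

definition riemannian_extension ::
  "'m contact_sr \<Rightarrow> ('m chart \<Rightarrow> real^3 \<Rightarrow> real^3 \<Rightarrow> real^3 \<Rightarrow> real) \<Rightarrow> bool" where
  "riemannian_extension M G \<longleftrightarrow> riemannian_metric (sr_atlas M) G \<and>
     (\<forall>c\<in>sr_atlas M. \<forall>x\<in>chart_img c. \<forall>v\<in>distr_at M c x. \<forall>w\<in>distr_at M c x.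
        G c x v w = sr_metric M c x v w)"

text \<open>One of the two unit normals; the choice does not affect \<open>\<bar>i\<^sub>n \<mu>\<bar>\<close>.\<close>

definition unit_normal ::
  "('m chart \<Rightarrow> real^3 \<Rightarrow> real^3 \<Rightarrow> real^3 \<Rightarrow> real) \<Rightarrow> 'm set \<Rightarrow> 'm chart \<Rightarrow> 'm \<Rightarrow> real^3" where
  "unit_normal G S c p = (SOME n. G c (chart_map c p) n n = 1 \<and>
     (\<forall>v\<in>tangent_space S c p. G c (chart_map c p) n v = 0))"

definition induced_density ::
  "('m chart \<Rightarrow> real^3 \<Rightarrow> real) \<Rightarrow> ('m chart \<Rightarrow> real^3 \<Rightarrow> real^3 \<Rightarrow> real^3 \<Rightarrow> real) \<Rightarrow> 'm set \<Rightarrow>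
     'm chart \<Rightarrow> 'm \<Rightarrow> real^3 \<Rightarrow> real^3 \<Rightarrow> real" where
  "induced_density \<mu> G S c p a b = \<bar>vol_form (\<mu> c) (chart_map c p) (unit_normal G S c p) a b\<bar>"

definition local_parametrization ::
  "'m::topological_space chart set \<Rightarrow> 'm set \<Rightarrow> (real^2) set \<Rightarrow> (real^2 \<Rightarrow> 'm) \<Rightarrow> bool" where
  "local_parametrization A S W \<psi> \<longleftrightarrow> open W \<and> openin (top_of_set S) (\<psi> ` W) \<and>
     homeomorphism W (\<psi> ` W) \<psi> (inv_into W \<psi>) \<and>
     (\<forall>c\<in>A. Ck_on 2 {y\<in>W. \<psi> y \<in> chart_dom c} (chart_map c \<circ> \<psi>) \<and>
        (\<forall>y\<in>W. \<psi> y \<in> chart_dom c \<longrightarrow> inj (frechet_derivative (chart_map c \<circ> \<psi>) (at y))))"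

text \<open>The Borel measure on \<open>S\<close> with density \<open>\<bar>i\<^sub>n \<mu>\<bar>\<close>. It is determined by this property since
  countably many local parametrizations, each within a single chart, cover \<open>S\<close>.\<close>

definition riemannian_induced_measure ::
  "'m::topological_space chart set \<Rightarrow> ('m chart \<Rightarrow> real^3 \<Rightarrow> real) \<Rightarrow>
     ('m chart \<Rightarrow> real^3 \<Rightarrow> real^3 \<Rightarrow> real^3 \<Rightarrow> real) \<Rightarrow> 'm set \<Rightarrow> 'm measure \<Rightarrow> bool" where
  "riemannian_induced_measure A \<mu> G S \<sigma> \<longleftrightarrow>
     space \<sigma> = S \<and> sets \<sigma> = sets (restrict_space borel S) \<and>
     (\<forall>c\<in>A. \<forall>W \<psi>. local_parametrization A S W \<psi> \<and> \<psi> ` W \<subseteq> chart_dom c \<longrightarrow>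
        (\<forall>E\<in>sets \<sigma>. E \<subseteq> \<psi> ` W \<longrightarrow>
           emeasure \<sigma> E =
             (\<integral>\<^sup>+ y. indicator {y\<in>W. \<psi> y \<in> E} y *
                ennreal (induced_density \<mu> G S c (\<psi> y)
                  (frechet_derivative (chart_map c \<circ> \<psi>) (at y) (axis 1 1))
                  (frechet_derivative (chart_map c \<circ> \<psi>) (at y) (axis 2 1))) \<partial>lborel)))"

definition locally_integrable_on_surface :: "'m::topological_space set \<Rightarrow> 'm measure \<Rightarrow> ('m \<Rightarrow> real) \<Rightarrow> bool" where
  "locally_integrable_on_surface S \<sigma> f \<longleftrightarrow>
     (\<forall>p\<in>S. \<exists>V. openin (top_of_set S) V \<and> p \<in> V \<and> set_integrable \<sigma> V (\<lambda>q. \<bar>f q\<bar>))"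

end

(*
  Near a point p of S choose a C^1 orthonormal frame X1, X2 of the distribution in a chart, and a
  C^2 parametrization Phi of S with normal covector n = Phi_1 x Phi_2. If u is a defining function,
  then du = l n along S, and differentiating u o Phi = 0 twice gives D^2 u (Phi_i, Phi_j) = - du (Phi_ij).
  As the only second derivatives of u in div (grad u / |grad u|) are those along the horizontal tangent
  (X2 u) X1 - (X1 u) X2 of S, the absolute value of the curvature is a function of the parametrization
  alone: with a_i = n (X_i) and r^2 = a_1^2 + a_2^2 it is |Q (a) / r^3 + L (a) / r| for a quadratic form Q
  and a linear form L with continuous coefficients, hence at most C / r. At a characteristic point the
  derivative of (X1 u, X2 u) along S is the horizontal Hessian, so non-degeneracy yields r >= k |y - y0|.
  Finally 1 / |y - y0| is integrable in two dimensions, by summing over dyadic balls, and the density of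
  the induced measure is bounded.
*)
theory Submission
  imports Defs
begin

section \<open>Calculus of \<open>C\<^sup>k\<close> maps\<close>

text \<open>The predicate \<open>horizontal_mean_curvature\<close> lets the defining function, and
  with it the sign of \<open>H\<close>, change from point to point, and leaves \<open>H\<close>
  arbitrary on the characteristic set. So \<open>H\<close> may fail to be measurable and only its
  absolute value can be handled: the formula in terms of the parametrization serves for
  measurability as much as for the estimate. No derivative of the factor l enters that formula,
  because du is differentiated only along a direction tangent to the surface. The frame is
  differentiated once, so class C^1 is enough for it; yet the metric is known to be regular only
  along smooth sections, hence Gram-Schmidt has to start from smooth ones. Non-degeneracy comes with
  one particular chart, and the local argument is carried out in that chart. Characteristic and
  other points receive the same lower bound r >= k |y - y0|, crude at the latter, so that one dyadic
  estimate covers both; the centre, where \<open>H\<close> may be arbitrary, is a null set.\<close>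

lemma frechet_derivative_eqI:
  "(f has_derivative f') (at x) \<Longrightarrow> frechet_derivative f (at x) = f'"
  by (rule frechet_derivative_at[symmetric])

text \<open>Openness of \<open>T\<close> is essential: \<open>Ck_on\<close> uses the unrestricted
  derivative at each point, which sees the function on a whole neighbourhood.\<close>

lemma Ck_on_cong:
  assumes "open T" "\<And>x. x \<in> T \<Longrightarrow> f x = g x" "Ck_on k T f"
  shows "Ck_on k T g"
  using assms(2,3)
proof (induction k arbitrary: f g)
  case 0
  then show ?case by (simp cong: continuous_on_cong)
next
  case (Suc k)
  have D: "(g has_derivative frechet_derivative f (at x)) (at x)" if "x \<in> T" for x
  proof (rule has_derivative_transform_within_open[where s = T and f = f])
    show "(f has_derivative frechet_derivative f (at x)) (at x)"
      using Suc.prems(2) that by (simp add: frechet_derivative_works[symmetric])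
  qed (use assms(1) that Suc.prems in auto)
  have "Ck_on k T (\<lambda>x. frechet_derivative g (at x) v)" for v
  proof (rule Suc.IH)
    show "frechet_derivative f (at x) v = frechet_derivative g (at x) v" if "x \<in> T" for x
      using frechet_derivative_eqI[OF D[OF that]] by simp
    show "Ck_on k T (\<lambda>x. frechet_derivative f (at x) v)"
      using Suc.prems(2) by simp
  qed
  with D show ?case by (auto simp: differentiable_def)
qed

lemma Ck_on_SucI:
  assumes "open T" "\<And>x. x \<in> T \<Longrightarrow> (f has_derivative f' x) (at x)" "\<And>v. Ck_on k T (\<lambda>x. f' x v)"
  shows "Ck_on (Suc k) T f"
proof -
  have "Ck_on k T (\<lambda>x. frechet_derivative f (at x) v)" for v
    using assms(2)
    by (intro Ck_on_cong[OF assms(1) _ assms(3)[of v]]) (metis frechet_derivative_eqI)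
  with assms(2) show ?thesis by (auto simp: differentiable_def)
qed

lemma Ck_on_SucD:
  assumes "Ck_on (Suc k) T f" "x \<in> T"
  shows "(f has_derivative frechet_derivative f (at x)) (at x)"
  using assms by (simp add: frechet_derivative_works[symmetric])

lemma Ck_on_subset: "Ck_on k T f \<Longrightarrow> T' \<subseteq> T \<Longrightarrow> Ck_on k T' f"
  by (induction k arbitrary: f) (auto intro: continuous_on_subset)

lemma Ck_on_imp_continuous_on: "Ck_on k T f \<Longrightarrow> continuous_on T f"
  by (cases k) (auto intro!: continuous_at_imp_continuous_on dest: differentiable_imp_continuous_within)

lemma Ck_on_const: "open T \<Longrightarrow> Ck_on k T (\<lambda>x. c)"
proof (induction k arbitrary: c)
  case (Suc k)
  then show ?case
    by (intro Ck_on_SucI[where f' = "\<lambda>x v. 0"]) auto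
qed simp

lemma Ck_on_linear_image:
  assumes "open T" "bounded_linear L" "Ck_on k T f"
  shows "Ck_on k T (\<lambda>x. L (f x))"
  using assms(3)
proof (induction k arbitrary: f)
  case 0
  then show ?case
    using assms(2) by (auto intro: bounded_linear.continuous_on)
next
  case (Suc k)
  show ?case
  proof (rule Ck_on_SucI[where f' = "\<lambda>x v. L (frechet_derivative f (at x) v)"])
    fix x assume "x \<in> T"
    from Ck_on_SucD[OF Suc.prems this]
    show "((\<lambda>x. L (f x)) has_derivative (\<lambda>v. L (frechet_derivative f (at x) v))) (at x)"
      using assms(2) by (rule bounded_linear.has_derivative[rotated])
  next
    fix v show "Ck_on k T (\<lambda>x. L (frechet_derivative f (at x) v))"
      using Suc.prems by (intro Suc.IH) simp
  qed (rule assms(1))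
qed

lemma Ck_on_diff:
  assumes "open T" "Ck_on k T f" "Ck_on k T g"
  shows "Ck_on k T (\<lambda>x. f x - g x)"
  using assms(2,3)
proof (induction k arbitrary: f g)
  case (Suc k)
  show ?case
  proof (rule Ck_on_SucI[where f' = "\<lambda>x v. frechet_derivative f (at x) v - frechet_derivative g (at x) v"])
    fix v show "Ck_on k T (\<lambda>x. frechet_derivative f (at x) v - frechet_derivative g (at x) v)"
      using Suc.prems by (intro Suc.IH) simp_all
  qed (use assms(1) Suc.prems in \<open>auto intro!: has_derivative_diff Ck_on_SucD[where k = k] simp del: Ck_on.simps\<close>)
qed (auto intro: continuous_on_diff)

lemma Ck_on_linear_compose:
  fixes L :: "'a::euclidean_space \<Rightarrow> 'b::euclidean_space"
  assumes "open T" "bounded_linear L" "open W" "L ` W \<subseteq> T" "Ck_on k T f"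
  shows "Ck_on k W (\<lambda>x. f (L x))"
  using assms(5)
proof (induction k arbitrary: f)
  case 0
  then show ?case
    using assms(2,4)
    by (auto intro: continuous_on_compose2[of T f W L] linear_continuous_on)
next
  case (Suc k)
  show ?case
  proof (rule Ck_on_SucI[where f' = "\<lambda>x v. frechet_derivative f (at (L x)) (L v)"])
    fix x assume "x \<in> W"
    then have "(f has_derivative frechet_derivative f (at (L x))) (at (L x))"
      using Ck_on_SucD[OF Suc.prems] assms(4) by blast
    from has_derivative_compose[OF bounded_linear_imp_has_derivative[OF assms(2)] this]
    show "((\<lambda>x. f (L x)) has_derivative (\<lambda>v. frechet_derivative f (at (L x)) (L v))) (at x)" .
  next
    fix v show "Ck_on k W (\<lambda>x. frechet_derivative f (at (L x)) (L v))"
      using Suc.prems by (intro Suc.IH) simp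
  qed (rule assms(3))
qed

text \<open>One product rule for scaling, multiplication and inner product. First order is the right
  level: the gradient of a C^2 function and the horizontal frame are used only as C^1 maps.\<close>

lemma C1_bilinear:
  assumes "bounded_bilinear p" "open T" "Ck_on 1 T f" "Ck_on 1 T g"
  shows "Ck_on 1 T (\<lambda>x. p (f x) (g x))"
proof -
  interpret bounded_bilinear p by fact
  have f: "(f has_derivative frechet_derivative f (at x)) (at x)"
    and g: "(g has_derivative frechet_derivative g (at x)) (at x)" if "x \<in> T" for x
    using that Ck_on_SucD[OF assms(3)[unfolded One_nat_def]] Ck_on_SucD[OF assms(4)[unfolded One_nat_def]] by auto
  have "continuous_on T f" "continuous_on T g"
    using assms(3,4) by (blast intro: Ck_on_imp_continuous_on)+
  moreover have "continuous_on T (\<lambda>x. frechet_derivative f (at x) v)"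
     "continuous_on T (\<lambda>x. frechet_derivative g (at x) v)" for v
    using assms(3,4) by auto
  ultimately have "continuous_on T (\<lambda>x. p (f x) (frechet_derivative g (at x) v) + p (frechet_derivative f (at x) v) (g x))" for v
    by (intro continuous_on_add continuous_on)
  then show ?thesis
    unfolding One_nat_def by (intro Ck_on_SucI[OF assms(2) FDERIV[OF f g]]) simp_all
qed

lemmas C1_scaleR = C1_bilinear[OF bounded_bilinear_scaleR]
lemmas C1_mult = C1_bilinear[OF bounded_bilinear_mult]
lemmas C1_inner = C1_bilinear[OF bounded_bilinear_inner]

lemma C1_add:
  assumes "open T" "Ck_on 1 T f" "Ck_on 1 T g"
  shows "Ck_on 1 T (\<lambda>x. f x + g x)"
  using Ck_on_diff[OF assms(1,2) Ck_on_linear_image[OF assms(1) _ assms(3), of uminus]]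
  by (simp add: bounded_linear_minus[OF bounded_linear_ident])

lemma C1_sum:
  assumes "open T" "\<And>i. i \<in> I \<Longrightarrow> Ck_on 1 T (f i)"
  shows "Ck_on 1 T (\<lambda>x. \<Sum>i\<in>I. f i x)"
  using assms(2)
proof (induction I rule: infinite_finite_induct)
  case (insert i I)
  then show ?case using C1_add[OF assms(1), of "f i" "\<lambda>x. \<Sum>i\<in>I. f i x"] by (simp del: One_nat_def Ck_on.simps)
qed (use Ck_on_const[OF assms(1)] in auto)

lemma C1_compose_real:
  fixes f :: "'a::euclidean_space \<Rightarrow> real"
  assumes "open T" "Ck_on 1 T f"
    and \<phi>: "\<And>x. x \<in> T \<Longrightarrow> (\<phi> has_real_derivative \<phi>' (f x)) (at (f x))"
    and c: "continuous_on (f ` T) \<phi>'"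
  shows "Ck_on 1 T (\<lambda>x. \<phi> (f x))"
  unfolding One_nat_def
proof (rule Ck_on_SucI[where f' = "\<lambda>x v. \<phi>' (f x) * frechet_derivative f (at x) v"])
  fix x assume x: "x \<in> T"
  then have "(f has_derivative frechet_derivative f (at x)) (at x)"
    using Ck_on_SucD[OF assms(2)[unfolded One_nat_def]] by blast
  from has_derivative_compose[OF this \<phi>[OF x, unfolded has_field_derivative_def]]
  show "((\<lambda>x. \<phi> (f x)) has_derivative (\<lambda>v. \<phi>' (f x) * frechet_derivative f (at x) v)) (at x)" .
next
  fix v
  have "continuous_on T f" "continuous_on T (\<lambda>x. frechet_derivative f (at x) v)"
    using assms(2) Ck_on_imp_continuous_on[OF assms(2)] by auto
  then show "Ck_on 0 T (\<lambda>x. \<phi>' (f x) * frechet_derivative f (at x) v)"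
    using c by (auto intro!: continuous_on_mult continuous_on_compose2[of "f ` T" \<phi>'])
qed fact

lemma C1_inverse_sqrt:
  fixes f :: "'a::euclidean_space \<Rightarrow> real"
  assumes "open T" "Ck_on 1 T f" "\<And>x. x \<in> T \<Longrightarrow> f x > 0"
  shows "Ck_on 1 T (\<lambda>x. inverse (sqrt (f x)))"
proof (rule C1_compose_real[OF assms(1,2), where \<phi>' = "\<lambda>t. - (inverse (sqrt t) / (2 * t))"])
  fix x assume "x \<in> T"
  with assms(3) have "f x > 0" by auto
  then show "((\<lambda>t. inverse (sqrt t)) has_real_derivative - (inverse (sqrt (f x)) / (2 * f x))) (at (f x))"
    by (auto intro!: derivative_eq_intros simp: divide_simps)
next
  show "continuous_on (f ` T) (\<lambda>t. - (inverse (sqrt t) / (2 * t)))"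
  proof -
    have "t \<noteq> 0" if "t \<in> f ` T" for t using assms(3) that by force
    then show ?thesis by (intro continuous_intros) auto
  qed
qed

lemma C1_inverse:
  fixes f :: "'a::euclidean_space \<Rightarrow> real"
  assumes "open T" "Ck_on 1 T f" "\<And>x. x \<in> T \<Longrightarrow> f x \<noteq> 0"
  shows "Ck_on 1 T (\<lambda>x. inverse (f x))"
proof (rule C1_compose_real[OF assms(1,2), where \<phi>' = "\<lambda>t. - (inverse t * inverse t)"])
  fix x assume "x \<in> T"
  then show "(inverse has_real_derivative - (inverse (f x) * inverse (f x))) (at (f x))"
    using assms(3) DERIV_inverse[of "f x" UNIV] by (simp add: numeral_2_eq_2)
next
  show "continuous_on (f ` T) (\<lambda>t. - (inverse t * inverse t))"
  proof -
    have "t \<noteq> 0" if "t \<in> f ` T" for t using assms(3) that by force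
    then show ?thesis by (intro continuous_intros) auto
  qed
qed

lemma has_derivative_sum_Basis:
  assumes "(f has_derivative f') F"
  shows "f' v = (\<Sum>b\<in>Basis. (v \<bullet> b) *\<^sub>R f' b)"
proof -
  have "linear f'" using assms by (rule has_derivative_linear)
  then have "(\<Sum>b\<in>Basis. (v \<bullet> b) *\<^sub>R f' b) = f' (\<Sum>b\<in>Basis. (v \<bullet> b) *\<^sub>R b)"
    by (simp add: linear_sum linear_scale)
  then show ?thesis by (simp add: euclidean_representation)
qed

text \<open>\<open>Ck_on\<close> gives continuity of the derivative in each fixed direction;
  expanding in the basis extends this to directions that vary continuously with the point.\<close>

lemma C1_continuous_derivative:
  assumes "Ck_on 1 T f" "continuous_on T v"
  shows "continuous_on T (\<lambda>x. frechet_derivative f (at x) (v x))"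
proof -
  have "continuous_on T (\<lambda>x. \<Sum>b\<in>Basis. (v x \<bullet> b) *\<^sub>R frechet_derivative f (at x) b)"
    using assms by (auto intro!: continuous_intros)
  moreover have "frechet_derivative f (at x) (v x) = (\<Sum>b\<in>Basis. (v x \<bullet> b) *\<^sub>R frechet_derivative f (at x) b)"
    if "x \<in> T" for x
    using assms(1) that by (intro has_derivative_sum_Basis[OF Ck_on_SucD[of 0]]) auto
  ultimately show ?thesis by (simp cong: continuous_on_cong)
qed

text \<open>The differential in coordinates, turned into a vector by the Euclidean inner product. It
  is a covector in disguise, to be kept apart from the horizontal gradient
  \<open>hgrad\<close>.\<close>

definition gradient :: "('a::euclidean_space \<Rightarrow> real) \<Rightarrow> 'a \<Rightarrow> 'a" where
  "gradient f x = (\<Sum>b\<in>Basis. frechet_derivative f (at x) b *\<^sub>R b)"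

lemma inner_gradient:
  assumes "f differentiable (at x)"
  shows "gradient f x \<bullet> v = frechet_derivative f (at x) v"
  using has_derivative_sum_Basis[OF frechet_derivative_works[THEN iffD1, OF assms], of v]
  by (simp add: gradient_def inner_sum_left inner_commute[of v] mult.commute)

lemma C1_gradient:
  assumes "open T" "Ck_on 2 T f"
  shows "Ck_on 1 T (gradient f)"
proof -
  have "Ck_on 1 T (\<lambda>x. \<Sum>b\<in>Basis. frechet_derivative f (at x) b *\<^sub>R b)"
    using assms by (intro C1_sum C1_scaleR Ck_on_const) (auto simp: numeral_2_eq_2)
  then show ?thesis by (simp add: gradient_def[abs_def])
qed

text \<open>An injective linear map satisfies |B v| >= k |v| for some k > 0; close to
  \<open>y0\<close> the remainder consumes at most half of this, which leaves the constant
  k/2.\<close>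

lemma bounded_below_if_inj_derivative:
  fixes b :: "'a::euclidean_space \<Rightarrow> 'b::euclidean_space"
  assumes "(b has_derivative B) (at y0)" "inj B" "b y0 = 0"
  shows "\<exists>k>0. \<forall>\<^sub>F y in nhds y0. k * norm (y - y0) \<le> norm (b y)"
proof -
  have "linear B" using assms(1) by (rule has_derivative_linear)
  then obtain k where k: "k > 0" "\<And>v. norm v * k \<le> norm (B v)"
    using linear_inj_bounded_below_pos[OF _ assms(2)] by (metis mult.commute)
  obtain d where d: "d > 0" "\<And>y. norm (y - y0) < d \<Longrightarrow>
      norm (b y - b y0 - B (y - y0)) \<le> (k/2) * norm (y - y0)"
    using assms(1) k(1) unfolding has_derivative_at_alt by (meson half_gt_zero)
  have "(k/2) * norm (y - y0) \<le> norm (b y)" if "dist y y0 < d" for y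
  proof -
    have "norm (y - y0) * k \<le> norm (B (y - y0))" by (rule k)
    also have "\<dots> \<le> norm (b y) + norm (b y - B (y - y0))"
      using norm_triangle_sub[of "B (y - y0)" "b y"] by (simp add: norm_minus_commute)
    also have "norm (b y - B (y - y0)) \<le> (k/2) * norm (y - y0)"
      using d(2)[of y] that assms(3) by (simp add: dist_norm)
    finally show ?thesis by (simp add: algebra_simps)
  qed
  with d(1) k(1) show ?thesis
    unfolding eventually_nhds_metric by (intro exI[of _ "k/2"]) auto
qed

section \<open>Divergence of a normalized field\<close>

lemma linear_vec3_sum:
  fixes L :: "real^3 \<Rightarrow> 'b::real_vector"
  assumes "linear L"
  shows "L v = v$1 *\<^sub>R L (axis 1 1) + v$2 *\<^sub>R L (axis 2 1) + v$3 *\<^sub>R L (axis 3 1)"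
proof -
  have "v = v$1 *\<^sub>R axis 1 1 + v$2 *\<^sub>R axis 2 1 + v$3 *\<^sub>R axis 3 1"
    by (simp add: vec_eq_iff forall_3 axis_def)
  then have "L v = L (v$1 *\<^sub>R axis 1 1 + v$2 *\<^sub>R axis 2 1 + v$3 *\<^sub>R axis 3 1)"
    by (rule arg_cong)
  then show ?thesis
    by (simp only: linear_add[OF assms] linear_scale[OF assms])
qed

text \<open>The coordinate formula div X = X(log \<rho>) + trace DX. Replacing one row of the
  determinant at a time by its image under \<open>L\<close> and adding up gives the trace times the
  determinant. The value is unique because the volume form does not vanish on the standard
  basis.\<close>

lemma divergence_eq:
  assumes X: "(X has_derivative L) (at x)" and \<rho>: "(\<rho> has_derivative \<rho>') (at x)" and nz: "\<rho> x \<noteq> 0"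
  shows "divergence \<rho> X x = \<rho>' (X x) / \<rho> x + trace (matrix L)"
proof -
  let ?t = "\<rho>' (X x) / \<rho> x + trace (matrix L)"
  let ?\<tau> = "vol_form \<rho>"
  have lin: "linear L" using X by (rule has_derivative_linear)
  have "lie_deriv3 X ?\<tau> x a b d = ?t * ?\<tau> x a b d" for a b d
  proof -
    have "((\<lambda>y. ?\<tau> y a b d) has_derivative (\<lambda>v. \<rho>' v * det (vector [a, b, d] :: real^3^3))) (at x)"
      unfolding vol_form_def using \<rho> by (rule has_derivative_mult_left)
    then have 1: "frechet_derivative (\<lambda>y. ?\<tau> y a b d) (at x) = (\<lambda>v. \<rho>' v * det (vector [a, b, d] :: real^3^3))"
      by (rule frechet_derivative_eqI)
    have 2: "det (vector [L a, b, d] :: real^3^3) + det (vector [a, L b, d] :: real^3^3)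
        + det (vector [a, b, L d] :: real^3^3) = trace (matrix L) * det (vector [a, b, d] :: real^3^3)"
      unfolding linear_vec3_sum[OF lin, of a] linear_vec3_sum[OF lin, of b] linear_vec3_sum[OF lin, of d]
      by (simp add: det_3 trace_def matrix_def sum_3) algebra
    have "lie_deriv3 X ?\<tau> x a b d = \<rho>' (X x) * det (vector [a, b, d] :: real^3^3) +
      \<rho> x * (det (vector [L a, b, d] :: real^3^3) + det (vector [a, L b, d] :: real^3^3)
        + det (vector [a, b, L d] :: real^3^3))"
      by (simp add: lie_deriv3_def Let_def 1 frechet_derivative_eqI[OF X]) (simp add: vol_form_def algebra_simps)
    then show ?thesis
      unfolding 2 using nz by (simp add: vol_form_def field_simps)
  qed
  moreover have "r = ?t" if "\<forall>a b d. lie_deriv3 X ?\<tau> x a b d = r * ?\<tau> x a b d" for r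
  proof -
    have "?\<tau> x (axis 1 1) (axis 2 1) (axis 3 1) \<noteq> 0"
      using nz by (simp add: vol_form_def det_3 axis_def)
    with that calculation show ?thesis by (metis mult_right_cancel)
  qed
  ultimately show ?thesis
    unfolding divergence_def by (intro the_equality) auto
qed

lemma trace_rank_one:
  fixes \<phi> :: "real^3 \<Rightarrow> real"
  assumes "linear \<phi>"
  shows "trace (matrix (\<lambda>v. \<phi> v *\<^sub>R X)) = \<phi> X"
  using linear_vec3_sum[OF assms, of X] by (simp add: trace_def matrix_def sum_3 mult.commute)

lemma trace_matrix_add: "trace (matrix (\<lambda>v. F v + G v)) = trace (matrix F) + trace (matrix G)"
  by (simp add: trace_def matrix_def sum.distrib)

lemma trace_matrix_scale: "trace (matrix (\<lambda>v. c *\<^sub>R F v)) = c * trace (matrix F)"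
  by (simp add: trace_def matrix_def sum_distrib_left)

text \<open>For N = a1 X1 + a2 X2, differentiating 1/r contributes - (a1 A1 N + a2 A2 N) / r^3. What
  survives together with A1 X1 + A2 X2 is a quadratic form in the direction a2 X1 - a1 X2, which is
  tangent to the level sets of u when a_i = X_i u. The last summand collects the divergences of the
  two frame fields.\<close>

lemma unit_field_divergence:
  fixes X1 X2 :: "real^3 \<Rightarrow> real^3" and a1 a2 :: "real^3 \<Rightarrow> real"
  assumes X1: "(X1 has_derivative L1) (at x)" and X2: "(X2 has_derivative L2) (at x)"
    and a1: "(a1 has_derivative A1) (at x)" and a2: "(a2 has_derivative A2) (at x)"
    and \<rho>: "(\<rho> has_derivative \<rho>') (at x)" "\<rho> x \<noteq> 0"
    and r: "r = sqrt ((a1 x)\<^sup>2 + (a2 x)\<^sup>2)" "r \<noteq> 0"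
  shows "divergence \<rho> (\<lambda>x. (a1 x *\<^sub>R X1 x + a2 x *\<^sub>R X2 x) /\<^sub>R sqrt ((a1 x)\<^sup>2 + (a2 x)\<^sup>2)) x =
    ((a2 x)\<^sup>2 * A1 (X1 x) - a1 x * a2 x * (A2 (X1 x) + A1 (X2 x)) + (a1 x)\<^sup>2 * A2 (X2 x)) / r ^ 3
    + (a1 x * (trace (matrix L1) + \<rho>' (X1 x) / \<rho> x) + a2 x * (trace (matrix L2) + \<rho>' (X2 x) / \<rho> x)) / r"
proof -
  let ?N = "\<lambda>x. a1 x *\<^sub>R X1 x + a2 x *\<^sub>R X2 x"
  let ?q = "\<lambda>v. - (a1 x * A1 v + a2 x * A2 v) / r ^ 3"
  have lin: "linear A1" "linear A2" "linear L1" "linear L2" "linear \<rho>'"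
    using X1 X2 a1 a2 \<rho> has_derivative_linear by blast+
  have r2: "r\<^sup>2 = (a1 x)\<^sup>2 + (a2 x)\<^sup>2" and rpos: "r > 0" "(a1 x)\<^sup>2 + (a2 x)\<^sup>2 > 0"
    using r by (auto simp: sum_power2_gt_zero_iff)
  have "((\<lambda>x. inverse (sqrt ((a1 x)\<^sup>2 + (a2 x)\<^sup>2))) has_derivative ?q) (at x)"
  proof -
    have s: "((\<lambda>x. (a1 x)\<^sup>2 + (a2 x)\<^sup>2) has_derivative (\<lambda>v. 2 * (a1 x * A1 v + a2 x * A2 v))) (at x)"
      by (rule derivative_eq_intros a1 a2 refl)+ (simp add: algebra_simps)
    have "((\<lambda>t. inverse (sqrt t)) has_real_derivative - (inverse r / (2 * r\<^sup>2))) (at ((a1 x)\<^sup>2 + (a2 x)\<^sup>2))"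
      using rpos by (auto intro!: derivative_eq_intros simp: r divide_simps)
    from has_derivative_compose[OF s this[unfolded has_field_derivative_def]]
    show ?thesis
      by (rule has_derivative_eq_rhs) (use rpos in \<open>auto simp: divide_simps power2_eq_square power3_eq_cube\<close>)
  qed
  moreover have "(?N has_derivative (\<lambda>v. a1 x *\<^sub>R L1 v + A1 v *\<^sub>R X1 x + (a2 x *\<^sub>R L2 v + A2 v *\<^sub>R X2 x))) (at x)"
    by (intro has_derivative_add has_derivative_scaleR X1 X2 a1 a2)
  ultimately have D: "((\<lambda>x. ?N x /\<^sub>R sqrt ((a1 x)\<^sup>2 + (a2 x)\<^sup>2)) has_derivative
     (\<lambda>v. inverse r *\<^sub>R (a1 x *\<^sub>R L1 v + A1 v *\<^sub>R X1 x + (a2 x *\<^sub>R L2 v + A2 v *\<^sub>R X2 x)) + ?q v *\<^sub>R ?N x)) (at x)"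
    unfolding r(1) by (rule has_derivative_scaleR)
  have linq: "linear ?q"
    using lin
    by (auto intro!: linearI simp: linear_add linear_scale add_divide_distrib diff_divide_distrib algebra_simps)
  have q: "?q (?N x) = - (a1 x * (a1 x * A1 (X1 x) + a2 x * A1 (X2 x)) + a2 x * (a1 x * A2 (X1 x) + a2 x * A2 (X2 x))) / r ^ 3"
    using lin by (simp add: linear_add linear_scale)
  have "divergence \<rho> (\<lambda>x. ?N x /\<^sub>R sqrt ((a1 x)\<^sup>2 + (a2 x)\<^sup>2)) x =
     \<rho>' (?N x /\<^sub>R r) / \<rho> x + (inverse r * (a1 x * trace (matrix L1) + A1 (X1 x) + (a2 x * trace (matrix L2) + A2 (X2 x))) + ?q (?N x))"
    unfolding divergence_eq[OF D \<rho>] trace_matrix_add trace_matrix_scale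
      trace_rank_one[OF linq] trace_rank_one[OF lin(1)] trace_rank_one[OF lin(2)] r(1)[symmetric] ..
  also have "\<rho>' (?N x /\<^sub>R r) = (a1 x * \<rho>' (X1 x) + a2 x * \<rho>' (X2 x)) / r"
    using lin(5) by (simp add: linear_add linear_scale add_divide_distrib divide_inverse algebra_simps)
  also note q
  finally have e: "divergence \<rho> (\<lambda>x. ?N x /\<^sub>R sqrt ((a1 x)\<^sup>2 + (a2 x)\<^sup>2)) x =
     (a1 x * \<rho>' (X1 x) + a2 x * \<rho>' (X2 x)) / r / \<rho> x + (inverse r * (a1 x * trace (matrix L1) + A1 (X1 x) + (a2 x * trace (matrix L2) + A2 (X2 x)))
     + - (a1 x * (a1 x * A1 (X1 x) + a2 x * A1 (X2 x)) + a2 x * (a1 x * A2 (X1 x) + a2 x * A2 (X2 x))) / r ^ 3)" .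
  \<comment> \<open>As r^2 = a1^2 + a2^2, this part can be put over r^3, where the terms with a1^2
    A1 X1 and a2^2 A2 X2 cancel.\<close>
  have "inverse r * (A1 (X1 x) + A2 (X2 x)) = (((a1 x)\<^sup>2 + (a2 x)\<^sup>2) * (A1 (X1 x) + A2 (X2 x))) / r ^ 3"
    using rpos(1) unfolding r2[symmetric] by (simp add: field_simps power2_eq_square power3_eq_cube)
  then have "inverse r * (a1 x * trace (matrix L1) + A1 (X1 x) + (a2 x * trace (matrix L2) + A2 (X2 x)))
    = inverse r * (a1 x * trace (matrix L1) + a2 x * trace (matrix L2)) + (((a1 x)\<^sup>2 + (a2 x)\<^sup>2) * (A1 (X1 x) + A2 (X2 x))) / r ^ 3"
    by (simp add: algebra_simps)
  then show ?thesis
    unfolding e using rpos(1) \<rho>(2)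
    by (simp add: add_divide_distrib diff_divide_distrib power2_eq_square algebra_simps divide_inverse)
qed

section \<open>Cross products, the curvature expression and the tangential Hessian\<close>

unbundle cross3_syntax

text \<open>Cramer's rule for the frame a, b, a x b, cleared of its denominator det (a, b, a x b) =
  |a x b|^2 and hence an identity for all vectors.\<close>

lemma cross_frame_expansion:
  fixes v a b :: "real^3"
  shows "((a \<times> b) \<bullet> (a \<times> b)) *\<^sub>R v = ((v \<times> b) \<bullet> (a \<times> b)) *\<^sub>R a + ((a \<times> v) \<bullet> (a \<times> b)) *\<^sub>R b + (v \<bullet> (a \<times> b)) *\<^sub>R (a \<times> b)"
  by (simp add: cross3_simps forall_3)

lemma orthogonal_eq_cross_multiple:
  fixes v a b :: "real^3"
  assumes "v \<bullet> a = 0" "v \<bullet> b = 0" "a \<times> b \<noteq> 0"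
  shows "v = ((v \<bullet> (a \<times> b)) / ((a \<times> b) \<bullet> (a \<times> b))) *\<^sub>R (a \<times> b)"
proof -
  \<comment> \<open>By the Lagrange identity both tangential coefficients are combinations of the
    vanishing products of v with a and b.\<close>
  have "(v \<times> b) \<bullet> (a \<times> b) = (v \<bullet> a) * (b \<bullet> b) - (v \<bullet> b) * (a \<bullet> b)"
    "(a \<times> v) \<bullet> (a \<times> b) = (a \<bullet> a) * (v \<bullet> b) - (a \<bullet> b) * (v \<bullet> a)"
    by (simp_all add: cross3_simps)
  then have "((a \<times> b) \<bullet> (a \<times> b)) *\<^sub>R v = (v \<bullet> (a \<times> b)) *\<^sub>R (a \<times> b)"
    using cross_frame_expansion[of a b v] assms(1,2) by simp
  then have "(1 / ((a \<times> b) \<bullet> (a \<times> b))) *\<^sub>R (((a \<times> b) \<bullet> (a \<times> b)) *\<^sub>R v)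
      = (1 / ((a \<times> b) \<bullet> (a \<times> b))) *\<^sub>R ((v \<bullet> (a \<times> b)) *\<^sub>R (a \<times> b))"
    by (rule arg_cong)
  then show ?thesis using assms(3) by simp
qed

text \<open>The expression Q(a) / r^3 + L(a) / r of the overview. At a1 = a2 = 0 division by zero
  gives it the value 0.\<close>

definition curvature_expr :: "real \<Rightarrow> real \<Rightarrow> real \<Rightarrow> real \<Rightarrow> real \<Rightarrow> real \<Rightarrow> real \<Rightarrow> real" where
  "curvature_expr a1 a2 P11 P12 P22 R1 R2 =
     (a1\<^sup>2 * P11 + a1 * a2 * P12 + a2\<^sup>2 * P22) / sqrt (a1\<^sup>2 + a2\<^sup>2) ^ 3
     + (a1 * R1 + a2 * R2) / sqrt (a1\<^sup>2 + a2\<^sup>2)"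

text \<open>Replacing the covector by \<open>l\<close> times it scales the \<open>a\<close> and the
  \<open>P\<close>, which are pairings with it, but not the \<open>R\<close>, which stem from frame
  and density alone. Both fractions then change by the factor sgn l, so the absolute value forgets
  which defining function was used.\<close>

lemma curvature_expr_scale:
  assumes "l \<noteq> 0"
  shows "\<bar>curvature_expr (l * a1) (l * a2) (l * P11) (l * P12) (l * P22) R1 R2\<bar>
    = \<bar>curvature_expr a1 a2 P11 P12 P22 R1 R2\<bar>"
proof -
  let ?r = "sqrt (a1\<^sup>2 + a2\<^sup>2)"
  have r: "sqrt ((l * a1)\<^sup>2 + (l * a2)\<^sup>2) = \<bar>l\<bar> * ?r"
    by (simp add: power_mult_distrib real_sqrt_mult flip: distrib_left)
  have l: "l ^ 3 / \<bar>l\<bar> ^ 3 = sgn l" "l / \<bar>l\<bar> = sgn l"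
    using assms by (auto simp: sgn_if abs_if)
  have "curvature_expr (l * a1) (l * a2) (l * P11) (l * P12) (l * P22) R1 R2 =
     (l ^ 3 * (a1\<^sup>2 * P11 + a1 * a2 * P12 + a2\<^sup>2 * P22)) / (\<bar>l\<bar> ^ 3 * ?r ^ 3) + (l * (a1 * R1 + a2 * R2)) / (\<bar>l\<bar> * ?r)"
    unfolding curvature_expr_def r
    by (simp add: power_mult_distrib power2_eq_square power3_eq_cube algebra_simps)
  also have "\<dots> = sgn l * curvature_expr a1 a2 P11 P12 P22 R1 R2"
    unfolding curvature_expr_def times_divide_times_eq[symmetric] l by (simp add: algebra_simps)
  finally show ?thesis using assms by (simp add: abs_mult)
qed

text \<open>As |a1| and |a2| are at most r, the quadratic form cancels two of the three powers of r
  and the linear form cancels its only one.\<close>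

lemma abs_curvature_expr_le:
  assumes "a1\<^sup>2 + a2\<^sup>2 \<noteq> 0"
  shows "\<bar>curvature_expr a1 a2 P11 P12 P22 R1 R2\<bar> \<le>
    (\<bar>P11\<bar> + \<bar>P12\<bar> + \<bar>P22\<bar>) / sqrt (a1\<^sup>2 + a2\<^sup>2) + (\<bar>R1\<bar> + \<bar>R2\<bar>)"
proof -
  define r where "r = sqrt (a1\<^sup>2 + a2\<^sup>2)"
  have r: "r > 0" and r2: "r\<^sup>2 = a1\<^sup>2 + a2\<^sup>2"
    using assms by (auto simp: r_def sum_power2_gt_zero_iff)
  have a: "\<bar>a1\<bar> \<le> r" "\<bar>a2\<bar> \<le> r"
    by (simp_all add: r_def real_le_rsqrt)
  have "\<bar>a1\<^sup>2 * P11 + a1 * a2 * P12 + a2\<^sup>2 * P22\<bar> \<le> \<bar>a1\<bar> * \<bar>a1\<bar> * \<bar>P11\<bar> + \<bar>a1\<bar> * \<bar>a2\<bar> * \<bar>P12\<bar> + \<bar>a2\<bar> * \<bar>a2\<bar> * \<bar>P22\<bar>"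
    unfolding power2_eq_square abs_mult[symmetric] by linarith
  also have "\<dots> \<le> r * r * \<bar>P11\<bar> + r * r * \<bar>P12\<bar> + r * r * \<bar>P22\<bar>"
    using a by (intro add_mono mult_mono) auto
  finally have "\<bar>a1\<^sup>2 * P11 + a1 * a2 * P12 + a2\<^sup>2 * P22\<bar> \<le> (r * r) * (\<bar>P11\<bar> + \<bar>P12\<bar> + \<bar>P22\<bar>)"
    by (simp add: algebra_simps)
  then have "\<bar>(a1\<^sup>2 * P11 + a1 * a2 * P12 + a2\<^sup>2 * P22) / r ^ 3\<bar> \<le> (\<bar>P11\<bar> + \<bar>P12\<bar> + \<bar>P22\<bar>) / r"
    using r by (simp add: abs_divide divide_simps power3_eq_cube) (simp add: algebra_simps)
  moreover have "\<bar>a1 * R1 + a2 * R2\<bar> \<le> r * (\<bar>R1\<bar> + \<bar>R2\<bar>)"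
  proof -
    have "\<bar>a1 * R1 + a2 * R2\<bar> \<le> \<bar>a1\<bar> * \<bar>R1\<bar> + \<bar>a2\<bar> * \<bar>R2\<bar>"
      unfolding abs_mult[symmetric] by linarith
    also have "\<dots> \<le> r * \<bar>R1\<bar> + r * \<bar>R2\<bar>"
      using a by (intro add_mono mult_mono) auto
    finally show ?thesis by (simp add: algebra_simps)
  qed
  then have "\<bar>(a1 * R1 + a2 * R2) / r\<bar> \<le> \<bar>R1\<bar> + \<bar>R2\<bar>"
    using r by (simp add: abs_divide divide_simps) (simp add: algebra_simps)
  ultimately show ?thesis
    unfolding curvature_expr_def r_def[symmetric] by linarith
qed

text \<open>The vector t = (g . x2) x1 - (g . x1) x2 is orthogonal to n, hence a combination of a
  and b, and D t . t is determined by the four values in \<open>D\<close>. The left-hand side is D t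
  . t plus terms with derivatives of the frame. Since \<open>p\<close> and \<open>q\<close> are
  defined on all vectors, \<open>B t t\<close> expands bilinearly in x1 and x2 although these need
  not be tangent themselves.\<close>

lemma hessian_quadratic_form:
  fixes a b x1 x2 g caa cab cba cbb :: "real^3" and D :: "real^3 \<Rightarrow> real^3"
  defines "n \<equiv> a \<times> b"
  defines "p \<equiv> \<lambda>v. ((v \<times> b) \<bullet> n) / (n \<bullet> n)"
  defines "q \<equiv> \<lambda>v. ((a \<times> v) \<bullet> n) / (n \<bullet> n)"
  defines "B \<equiv> \<lambda>v w. (p v * p w) *\<^sub>R caa + (p v * q w) *\<^sub>R cab + (q v * p w) *\<^sub>R cba + (q v * q w) *\<^sub>R cbb"
  assumes n: "n \<noteq> 0" and g: "g = l *\<^sub>R n" and lin: "linear D" "linear L1" "linear L2"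
    and D: "D a \<bullet> a = - (g \<bullet> caa)" "D a \<bullet> b = - (g \<bullet> cab)" "D b \<bullet> a = - (g \<bullet> cba)" "D b \<bullet> b = - (g \<bullet> cbb)"
    and A: "\<And>v. A1 v = D v \<bullet> x1 + g \<bullet> L1 v" "\<And>v. A2 v = D v \<bullet> x2 + g \<bullet> L2 v"
  shows "(g \<bullet> x2)\<^sup>2 * A1 x1 - (g \<bullet> x1) * (g \<bullet> x2) * (A2 x1 + A1 x2) + (g \<bullet> x1)\<^sup>2 * A2 x2 =
    (g \<bullet> x1)\<^sup>2 * (g \<bullet> (L2 x2 - B x2 x2)) + (g \<bullet> x1) * (g \<bullet> x2) * (g \<bullet> (B x1 x2 + B x2 x1 - L2 x1 - L1 x2))
      + (g \<bullet> x2)\<^sup>2 * (g \<bullet> (L1 x1 - B x1 x1))"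
proof -
  define t where "t = (g \<bullet> x2) *\<^sub>R x1 - (g \<bullet> x1) *\<^sub>R x2"
  have "t \<bullet> n = 0"
    by (simp add: t_def g inner_simps inner_commute[of _ n])
  then have "(n \<bullet> n) *\<^sub>R t = ((t \<times> b) \<bullet> n) *\<^sub>R a + ((a \<times> t) \<bullet> n) *\<^sub>R b"
    using cross_frame_expansion[of a b t] by (simp add: n_def)
  then have "(1 / (n \<bullet> n)) *\<^sub>R ((n \<bullet> n) *\<^sub>R t) = (1 / (n \<bullet> n)) *\<^sub>R (((t \<times> b) \<bullet> n) *\<^sub>R a + ((a \<times> t) \<bullet> n) *\<^sub>R b)"
    by (rule arg_cong)
  then have t: "t = p t *\<^sub>R a + q t *\<^sub>R b"
    using n by (simp add: p_def q_def scaleR_add_right)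
  have pq: "p t = (g \<bullet> x2) * p x1 - (g \<bullet> x1) * p x2" "q t = (g \<bullet> x2) * q x1 - (g \<bullet> x1) * q x2"
    by (simp_all add: t_def p_def q_def Cross3.left_diff_distrib Cross3.right_diff_distrib cross_mult_left cross_mult_right
      inner_simps diff_divide_distrib)
  have Dt: "D t \<bullet> t = - (g \<bullet> B t t)"
  proof -
    have "D t \<bullet> t = D (p t *\<^sub>R a + q t *\<^sub>R b) \<bullet> (p t *\<^sub>R a + q t *\<^sub>R b)"
      using t by simp
    also have "\<dots> = - (g \<bullet> B t t)"
      using lin(1) by (simp add: linear_add linear_scale inner_simps D B_def algebra_simps)
    finally show ?thesis .
  qed
  have 1: "D t \<bullet> t = (g \<bullet> x2)\<^sup>2 * (D x1 \<bullet> x1) - (g \<bullet> x1) * (g \<bullet> x2) * (D x1 \<bullet> x2 + D x2 \<bullet> x1) + (g \<bullet> x1)\<^sup>2 * (D x2 \<bullet> x2)"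
    using lin(1) by (simp add: t_def linear_diff linear_scale inner_simps power2_eq_square algebra_simps)
  have 2: "g \<bullet> B t t = (g \<bullet> x1)\<^sup>2 * (g \<bullet> B x2 x2) - (g \<bullet> x1) * (g \<bullet> x2) * (g \<bullet> B x1 x2 + g \<bullet> B x2 x1)
      + (g \<bullet> x2)\<^sup>2 * (g \<bullet> B x1 x1)"
    unfolding B_def pq by (simp add: inner_simps) algebra
  show ?thesis
    using 1 2 Dt unfolding A by (simp add: inner_simps algebra_simps)
qed

section \<open>Curvature along a parametrized patch\<close>

lemma has_derivative_cong_open:
  assumes "open T" "x \<in> T" "\<And>x. x \<in> T \<Longrightarrow> f x = g x"
  shows "(f has_derivative D) (at x) \<longleftrightarrow> (g has_derivative D) (at x)"
  using has_derivative_transform_within_open[OF _ assms(1,2), of f D UNIV g]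
    has_derivative_transform_within_open[OF _ assms(1,2), of g D UNIV f] assms(3) by auto

lemma divergence_cong:
  assumes "open T" "x \<in> T" "\<And>x. x \<in> T \<Longrightarrow> F x = G x"
  shows "divergence \<rho> F x = divergence \<rho> G x"
proof -
  have "(F has_derivative D) (at x) \<longleftrightarrow> (G has_derivative D) (at x)" for D
    by (rule has_derivative_cong_open[OF assms(1,2)]) (rule assms(3))
  then have "frechet_derivative F (at x) = frechet_derivative G (at x)"
    by (simp add: frechet_derivative_def)
  with assms(3)[OF assms(2)] show ?thesis
    by (simp add: divergence_def lie_deriv3_def)
qed

lemma C2_derivative_C1: "Ck_on 2 T f \<Longrightarrow> Ck_on 1 T (\<lambda>x. frechet_derivative f (at x) v)"
  by (simp add: numeral_2_eq_2)

lemma C1_has_derivative: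
  "Ck_on 1 T f \<Longrightarrow> x \<in> T \<Longrightarrow> (f has_derivative frechet_derivative f (at x)) (at x)"
  using Ck_on_SucD[of 0] by simp

lemma C2_has_derivative:
  "Ck_on 2 T f \<Longrightarrow> x \<in> T \<Longrightarrow> (f has_derivative frechet_derivative f (at x)) (at x)"
  using Ck_on_SucD[of 1] by (simp add: numeral_2_eq_2)

lemma C2_gradient_has_derivative:
  assumes "Ck_on 2 T f" "x \<in> T"
  shows "(f has_derivative (\<lambda>v. gradient f x \<bullet> v)) (at x)"
  using C2_has_derivative[OF assms] inner_gradient[of f x]
  by (metis (no_types, lifting) differentiableI ext)

lemma zero_along_surface:
  assumes W: "open W" "y \<in> W" "Ck_on 2 W \<Phi>" and T: "open T" "\<Phi> ` W \<subseteq> T" "Ck_on 2 T f"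
    and zero: "\<And>y. y \<in> W \<Longrightarrow> f (\<Phi> y) = 0"
  shows "gradient f (\<Phi> y) \<bullet> frechet_derivative \<Phi> (at y) k = 0"
    and "frechet_derivative (gradient f) (at (\<Phi> y)) (frechet_derivative \<Phi> (at y) h) \<bullet> frechet_derivative \<Phi> (at y) k
      = - (gradient f (\<Phi> y) \<bullet> frechet_derivative (\<lambda>y. frechet_derivative \<Phi> (at y) k) (at y) h)"
proof -
  \<comment> \<open>Stated at every point of \<open>W\<close>, because the second identity is its
    derivative with respect to \<open>y\<close>, with \<open>k\<close> fixed.\<close>
  have orth: "gradient f (\<Phi> y) \<bullet> frechet_derivative \<Phi> (at y) k = 0" if y: "y \<in> W" for y k
  proof -
    have "\<Phi> y \<in> T" using T(2) y by auto
    from has_derivative_compose[OF C2_has_derivative[OF W(3) y] C2_gradient_has_derivative[OF T(3) this]]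
    have "((\<lambda>y. f (\<Phi> y)) has_derivative (\<lambda>h. gradient f (\<Phi> y) \<bullet> frechet_derivative \<Phi> (at y) h)) (at y)" .
    then have "((\<lambda>y. 0) has_derivative (\<lambda>h. gradient f (\<Phi> y) \<bullet> frechet_derivative \<Phi> (at y) h)) (at y)"
      using has_derivative_cong_open[OF W(1) y, of "\<lambda>y. f (\<Phi> y)" "\<lambda>y. 0"] zero by simp
    from has_derivative_unique[OF this has_derivative_const] show ?thesis
      by (rule fun_cong)
  qed
  show "gradient f (\<Phi> y) \<bullet> frechet_derivative \<Phi> (at y) k = 0"
    by (rule orth) fact
  have y: "\<Phi> y \<in> T" using T(2) W(2) by auto
  have "((\<lambda>y. gradient f (\<Phi> y) \<bullet> frechet_derivative \<Phi> (at y) k) has_derivative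
      (\<lambda>h. gradient f (\<Phi> y) \<bullet> frechet_derivative (\<lambda>y. frechet_derivative \<Phi> (at y) k) (at y) h
        + frechet_derivative (gradient f) (at (\<Phi> y)) (frechet_derivative \<Phi> (at y) h) \<bullet> frechet_derivative \<Phi> (at y) k)) (at y)"
    by (intro has_derivative_inner has_derivative_compose[OF C2_has_derivative[OF W(3,2)]]
      C1_has_derivative[OF C1_gradient[OF T(1,3)] y] C1_has_derivative[OF C2_derivative_C1[OF W(3)] W(2)])
  then have "((\<lambda>y. 0) has_derivative
      (\<lambda>h. gradient f (\<Phi> y) \<bullet> frechet_derivative (\<lambda>y. frechet_derivative \<Phi> (at y) k) (at y) h
        + frechet_derivative (gradient f) (at (\<Phi> y)) (frechet_derivative \<Phi> (at y) h) \<bullet> frechet_derivative \<Phi> (at y) k)) (at y)"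
    using has_derivative_cong_open[OF W(1,2), of "\<lambda>y. gradient f (\<Phi> y) \<bullet> frechet_derivative \<Phi> (at y) k" "\<lambda>y. 0"] orth
    by simp
  from fun_cong[OF has_derivative_unique[OF this has_derivative_const], of h]
  show "frechet_derivative (gradient f) (at (\<Phi> y)) (frechet_derivative \<Phi> (at y) h) \<bullet> frechet_derivative \<Phi> (at y) k
      = - (gradient f (\<Phi> y) \<bullet> frechet_derivative (\<lambda>y. frechet_derivative \<Phi> (at y) k) (at y) h)"
    by simp
qed

lemma cross_nonzero_if_inj:
  fixes D :: "real^2 \<Rightarrow> real^3"
  assumes "linear D" "inj D"
  shows "D (axis 1 1) \<times> D (axis 2 1) \<noteq> 0"
proof
  assume "D (axis 1 1) \<times> D (axis 2 1) = 0"
  then have "D (axis 1 1) = 0 \<or> D (axis 2 1) = 0 \<or> (\<exists>c. D (axis 2 1) = D (c *\<^sub>R axis 1 1))"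
    by (simp add: cross_eq_0 collinear_lemma linear_scale[OF assms(1)])
  then have "axis 1 (1::real) = (0::real^2) \<or> axis 2 (1::real) = (0::real^2) \<or> (\<exists>c. axis 2 (1::real) = c *\<^sub>R (axis 1 1 :: real^2))"
    using assms by (metis injD linear_0)
  then show False
    by (auto simp: vec_eq_iff axis_def forall_2)
qed

text \<open>The part of the computation that takes place in coordinates, with two fields and a
  density. That the fields form an orthonormal frame enters only through the shape of the field
  \<open>F\<close> in \<open>abs_divergence_eq_curvature\<close>.\<close>

locale surface_patch =
  fixes T :: "(real^3) set" and X1 X2 :: "real^3 \<Rightarrow> real^3" and \<rho> :: "real^3 \<Rightarrow> real"
    and W :: "(real^2) set" and \<Phi> :: "real^2 \<Rightarrow> real^3"
  assumes open_T: "open T" and X1: "Ck_on 1 T X1" and X2: "Ck_on 1 T X2"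
    and \<rho>: "Ck_on 1 T \<rho>" and \<rho>_pos: "\<And>x. x \<in> T \<Longrightarrow> \<rho> x > 0"
    and open_W: "open W" and \<Phi>: "Ck_on 2 W \<Phi>" and \<Phi>_into: "\<Phi> ` W \<subseteq> T"
    and inj_D\<Phi>: "\<And>y. y \<in> W \<Longrightarrow> inj (frechet_derivative \<Phi> (at y))"
begin

definition \<Phi>1 where "\<Phi>1 y = frechet_derivative \<Phi> (at y) (axis 1 1)"
definition \<Phi>2 where "\<Phi>2 y = frechet_derivative \<Phi> (at y) (axis 2 1)"

text \<open>The conormal of the patch, a covector in Euclidean disguise and in general not of unit
  length; the Riemannian unit normal is another vector.\<close>

definition normal where "normal y = \<Phi>1 y \<times> \<Phi>2 y"

definition \<alpha>1 where "\<alpha>1 y = normal y \<bullet> X1 (\<Phi> y)"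
definition \<alpha>2 where "\<alpha>2 y = normal y \<bullet> X2 (\<Phi> y)"

definition tangent_coord1 where "tangent_coord1 y v = ((v \<times> \<Phi>2 y) \<bullet> normal y) / (normal y \<bullet> normal y)"
definition tangent_coord2 where "tangent_coord2 y v = ((\<Phi>1 y \<times> v) \<bullet> normal y) / (normal y \<bullet> normal y)"

text \<open>The second derivative of \<Phi>, extended to all vectors of the ambient space through
  their Euclidean projection to the tangent plane: the \<open>tangent_coord\<close> are the
  coordinates of that projection in the basis \<Phi>1, \<Phi>2.\<close>

definition second_deriv where
  "second_deriv y v w =
     (tangent_coord1 y v * tangent_coord1 y w) *\<^sub>R frechet_derivative \<Phi>1 (at y) (axis 1 1)
     + (tangent_coord1 y v * tangent_coord2 y w) *\<^sub>R frechet_derivative \<Phi>2 (at y) (axis 1 1)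
     + (tangent_coord2 y v * tangent_coord1 y w) *\<^sub>R frechet_derivative \<Phi>1 (at y) (axis 2 1)
     + (tangent_coord2 y v * tangent_coord2 y w) *\<^sub>R frechet_derivative \<Phi>2 (at y) (axis 2 1)"

definition DX1 where "DX1 y = frechet_derivative X1 (at (\<Phi> y))"
definition DX2 where "DX2 y = frechet_derivative X2 (at (\<Phi> y))"

text \<open>The indices are those of the coefficients in \<open>curvature_expr\<close>. They look
  exchanged because the tangent direction is a2 X1 - a1 X2, so that a1^2 comes with
  \<open>X2\<close> and a2^2 with \<open>X1\<close>.\<close>

definition P11 where
  "P11 y = DX2 y (X2 (\<Phi> y)) - second_deriv y (X2 (\<Phi> y)) (X2 (\<Phi> y))"
definition P12 where
  "P12 y = second_deriv y (X1 (\<Phi> y)) (X2 (\<Phi> y)) + second_deriv y (X2 (\<Phi> y)) (X1 (\<Phi> y))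
     - DX2 y (X1 (\<Phi> y)) - DX1 y (X2 (\<Phi> y))"
definition P22 where
  "P22 y = DX1 y (X1 (\<Phi> y)) - second_deriv y (X1 (\<Phi> y)) (X1 (\<Phi> y))"
text \<open>The divergence of \<open>X1\<close> with respect to the density, by the formula of
  \<open>divergence_eq\<close>; likewise \<open>R2\<close> for \<open>X2\<close>.\<close>

definition R1 where
  "R1 y = trace (matrix (DX1 y)) + frechet_derivative \<rho> (at (\<Phi> y)) (X1 (\<Phi> y)) / \<rho> (\<Phi> y)"
definition R2 where
  "R2 y = trace (matrix (DX2 y)) + frechet_derivative \<rho> (at (\<Phi> y)) (X2 (\<Phi> y)) / \<rho> (\<Phi> y)"

definition curvature where
  "curvature y = curvature_expr (\<alpha>1 y) (\<alpha>2 y) (normal y \<bullet> P11 y) (normal y \<bullet> P12 y) (normal y \<bullet> P22 y) (R1 y) (R2 y)"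

lemma normal_nonzero: "y \<in> W \<Longrightarrow> normal y \<noteq> 0"
  unfolding normal_def \<Phi>1_def \<Phi>2_def
  by (intro cross_nonzero_if_inj inj_D\<Phi> has_derivative_linear[OF C2_has_derivative[OF \<Phi>]])

lemma continuous_on_pullback: "continuous_on T F \<Longrightarrow> continuous_on W (\<lambda>y. F (\<Phi> y))"
  using Ck_on_imp_continuous_on[OF \<Phi>] \<Phi>_into by (blast intro: continuous_on_compose2)

lemma C1_partials: "Ck_on 1 W \<Phi>1" "Ck_on 1 W \<Phi>2"
  using C2_derivative_C1[OF \<Phi>] by (simp_all add: \<Phi>1_def[abs_def] \<Phi>2_def[abs_def] del: One_nat_def)

lemma continuous_on_basic:
  "continuous_on W \<Phi>1" "continuous_on W \<Phi>2" "continuous_on W normal"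
  "continuous_on W (\<lambda>y. X1 (\<Phi> y))" "continuous_on W (\<lambda>y. X2 (\<Phi> y))" "continuous_on W (\<lambda>y. \<rho> (\<Phi> y))"
  using Ck_on_imp_continuous_on[OF X1] Ck_on_imp_continuous_on[OF X2] Ck_on_imp_continuous_on[OF \<rho>]
    Ck_on_imp_continuous_on[OF C1_partials(1)] Ck_on_imp_continuous_on[OF C1_partials(2)]
  by (auto simp: normal_def[abs_def] intro: continuous_on_pullback continuous_on_cross)

lemma continuous_on_\<alpha>: "continuous_on W \<alpha>1" "continuous_on W \<alpha>2"
  unfolding \<alpha>1_def[abs_def] \<alpha>2_def[abs_def]
  by (intro continuous_intros continuous_on_basic)+

lemma continuous_on_tangent_coord:
  assumes "continuous_on W v"
  shows "continuous_on W (\<lambda>y. tangent_coord1 y (v y))" "continuous_on W (\<lambda>y. tangent_coord2 y (v y))"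
  unfolding tangent_coord1_def tangent_coord2_def using normal_nonzero
  by (intro continuous_intros continuous_on_cross continuous_on_basic assms; force)+

lemma continuous_on_second_deriv:
  assumes "continuous_on W v" "continuous_on W w"
  shows "continuous_on W (\<lambda>y. second_deriv y (v y) (w y))"
proof -
  have "continuous_on W (\<lambda>y. frechet_derivative \<Phi>1 (at y) h)" "continuous_on W (\<lambda>y. frechet_derivative \<Phi>2 (at y) h)" for h
    using C1_continuous_derivative[OF C1_partials(1) continuous_on_const] C1_continuous_derivative[OF C1_partials(2) continuous_on_const]
    by auto
  then show ?thesis
    unfolding second_deriv_def
    by (intro continuous_on_add continuous_on_scaleR continuous_on_mult continuous_on_tangent_coord assms)
qed

lemma continuous_on_derivative_pullback:
  assumes "Ck_on 1 T F" "continuous_on T v"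
  shows "continuous_on W (\<lambda>y. frechet_derivative F (at (\<Phi> y)) (v (\<Phi> y)))"
  by (rule continuous_on_pullback[OF C1_continuous_derivative[OF assms]])

lemma continuous_on_P:
  "continuous_on W P11" "continuous_on W P12" "continuous_on W P22"
  unfolding P11_def[abs_def] P12_def[abs_def] P22_def[abs_def] DX1_def DX2_def
  by (intro continuous_on_add continuous_on_diff continuous_on_second_deriv continuous_on_basic
      continuous_on_derivative_pullback X1 X2 Ck_on_imp_continuous_on[OF X1] Ck_on_imp_continuous_on[OF X2])+

lemma continuous_on_R: "continuous_on W R1" "continuous_on W R2"
proof -
  have "\<rho> (\<Phi> y) \<noteq> 0" if "y \<in> W" for y using \<rho>_pos \<Phi>_into that by force
  then show "continuous_on W R1" "continuous_on W R2"
    unfolding R1_def[abs_def] R2_def[abs_def] DX1_def DX2_def trace_def matrix_def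
    by (auto intro!: continuous_on_add continuous_on_sum continuous_on_divide continuous_on_basic continuous_on_component
      continuous_on_derivative_pullback X1 X2 \<rho> Ck_on_imp_continuous_on[OF X1] Ck_on_imp_continuous_on[OF X2] continuous_on_const
      simp del: One_nat_def)
qed

lemma continuous_on_curvature:
  "continuous_on {y \<in> W. (\<alpha>1 y)\<^sup>2 + (\<alpha>2 y)\<^sup>2 \<noteq> 0} curvature"
proof -
  let ?A = "{y \<in> W. (\<alpha>1 y)\<^sup>2 + (\<alpha>2 y)\<^sup>2 \<noteq> 0}"
  have sub: "?A \<subseteq> W" by auto
  note c = continuous_on_subset[OF _ sub]
  show ?thesis
    unfolding curvature_def[abs_def] curvature_expr_def
    by (intro continuous_intros c[OF continuous_on_\<alpha>(1)] c[OF continuous_on_\<alpha>(2)] c[OF continuous_on_basic(3)]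
      c[OF continuous_on_P(1)] c[OF continuous_on_P(2)] c[OF continuous_on_P(3)] c[OF continuous_on_R(1)] c[OF continuous_on_R(2)])
      auto
qed


lemma linear_D\<Phi>: "y \<in> W \<Longrightarrow> linear (frechet_derivative \<Phi> (at y))"
  by (rule has_derivative_linear[OF C2_has_derivative[OF \<Phi>]])

text \<open>A defining function lives on its own open set \<open>T'\<close> and vanishes only near
  \<open>y\<close>, so the patch is first shrunk until both conditions hold on all of it.\<close>

lemma zero_on_patch:
  assumes y: "y \<in> W" and T': "open T'" "\<Phi> y \<in> T'" and f: "Ck_on 2 T' f"
    and zero: "\<forall>\<^sub>F y in nhds y. f (\<Phi> y) = 0"
  shows "gradient f (\<Phi> y) \<bullet> frechet_derivative \<Phi> (at y) k = 0"
    and "frechet_derivative (gradient f) (at (\<Phi> y)) (frechet_derivative \<Phi> (at y) h) \<bullet> frechet_derivative \<Phi> (at y) k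
      = - (gradient f (\<Phi> y) \<bullet> frechet_derivative (\<lambda>y. frechet_derivative \<Phi> (at y) k) (at y) h)"
proof -
  obtain N where N: "open N" "y \<in> N" "\<And>y. y \<in> N \<Longrightarrow> f (\<Phi> y) = 0"
    using zero unfolding eventually_nhds by auto
  obtain N' where N': "open N'" "N' \<inter> W = \<Phi> -` T' \<inter> W"
    using Ck_on_imp_continuous_on[OF \<Phi>] T'(1) unfolding continuous_on_open_invariant by metis
  let ?W = "N \<inter> (N' \<inter> W)"
  have W': "open ?W" "y \<in> ?W" "Ck_on 2 ?W \<Phi>" "\<Phi> ` ?W \<subseteq> T'"
  proof -
    show "open ?W" using N(1) N'(1) open_W by (intro open_Int)
  qed (use N N' y T' in \<open>auto intro: Ck_on_subset[OF \<Phi>]\<close>)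
  show "gradient f (\<Phi> y) \<bullet> frechet_derivative \<Phi> (at y) k = 0"
    and "frechet_derivative (gradient f) (at (\<Phi> y)) (frechet_derivative \<Phi> (at y) h) \<bullet> frechet_derivative \<Phi> (at y) k
      = - (gradient f (\<Phi> y) \<bullet> frechet_derivative (\<lambda>y. frechet_derivative \<Phi> (at y) k) (at y) h)"
    by (rule zero_along_surface[OF W'(1-3) T'(1) W'(4) f]; use N(3) in blast)+
qed

lemma gradient_eq_normal_multiple:
  assumes "y \<in> W" "open T'" "\<Phi> y \<in> T'" "Ck_on 2 T' f" "\<forall>\<^sub>F y in nhds y. f (\<Phi> y) = 0"
  shows "gradient f (\<Phi> y) = ((gradient f (\<Phi> y) \<bullet> normal y) / (normal y \<bullet> normal y)) *\<^sub>R normal y"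
  using orthogonal_eq_cross_multiple[OF zero_on_patch(1)[OF assms] zero_on_patch(1)[OF assms]] normal_nonzero[OF assms(1)]
  unfolding normal_def \<Phi>1_def \<Phi>2_def by blast

text \<open>The differential of \<open>f\<close> at the point is a nonzero multiple of the conormal,
  and its tangential derivative is known from the parametrization. Thus \<open>f\<close> enters only
  through that multiple, which \<open>curvature_expr_scale\<close> removes.\<close>

lemma abs_divergence_eq_curvature:
  assumes y: "y \<in> W" and T': "open T'" "\<Phi> y \<in> T'" and f: "Ck_on 2 T' f"
    and zero: "\<forall>\<^sub>F y in nhds y. f (\<Phi> y) = 0"
    and grad: "gradient f (\<Phi> y) \<noteq> 0" and nonchar: "(\<alpha>1 y)\<^sup>2 + (\<alpha>2 y)\<^sup>2 \<noteq> 0"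
    and F: "\<And>x. x \<in> T' \<Longrightarrow> F x = ((gradient f x \<bullet> X1 x) *\<^sub>R X1 x + (gradient f x \<bullet> X2 x) *\<^sub>R X2 x)
      /\<^sub>R sqrt ((gradient f x \<bullet> X1 x)\<^sup>2 + (gradient f x \<bullet> X2 x)\<^sup>2)"
  shows "\<bar>divergence \<rho> F (\<Phi> y)\<bar> = \<bar>curvature y\<bar>"
proof -
  define x where "x = \<Phi> y"
  define g where "g = gradient f x"
  define D where "D = frechet_derivative (gradient f) (at x)"
  define l where "l = (g \<bullet> normal y) / (normal y \<bullet> normal y)"
  note defs = x_def[symmetric]
  note a = y T' f zero
  have xT: "x \<in> T" and xT': "x \<in> T'" using y \<Phi>_into T' by (auto simp: x_def)
  have g: "g = l *\<^sub>R normal y"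
    using gradient_eq_normal_multiple[OF a] by (simp add: g_def l_def x_def)
  have l0: "l \<noteq> 0" using grad g by (auto simp: g_def x_def)
  have D: "(gradient f has_derivative D) (at x)"
    unfolding D_def by (rule C1_has_derivative[OF C1_gradient[OF T'(1) f] xT'])
  have L: "(X1 has_derivative DX1 y) (at x)" "(X2 has_derivative DX2 y) (at x)"
    using C1_has_derivative[OF X1 xT] C1_has_derivative[OF X2 xT] by (simp_all add: DX1_def DX2_def x_def)
  define A1 where "A1 = (\<lambda>v. g \<bullet> DX1 y v + D v \<bullet> X1 x)"
  define A2 where "A2 = (\<lambda>v. g \<bullet> DX2 y v + D v \<bullet> X2 x)"
  have A: "((\<lambda>x. gradient f x \<bullet> X1 x) has_derivative A1) (at x)" "((\<lambda>x. gradient f x \<bullet> X2 x) has_derivative A2) (at x)"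
    unfolding A1_def A2_def g_def by (intro has_derivative_inner D L)+
  have gX: "g \<bullet> X1 x = l * \<alpha>1 y" "g \<bullet> X2 x = l * \<alpha>2 y"
    by (simp_all add: g \<alpha>1_def \<alpha>2_def x_def)
  have r: "sqrt ((g \<bullet> X1 x)\<^sup>2 + (g \<bullet> X2 x)\<^sup>2) \<noteq> 0"
    using l0 nonchar by (auto simp: gX power_mult_distrib simp flip: distrib_left)
  have \<rho>x: "(\<rho> has_derivative frechet_derivative \<rho> (at x)) (at x)" "\<rho> x \<noteq> 0"
    using C1_has_derivative[OF \<rho> xT] \<rho>_pos[OF xT] by auto
  have H: "D (\<Phi>1 y) \<bullet> \<Phi>1 y = - (g \<bullet> frechet_derivative \<Phi>1 (at y) (axis 1 1))"
    "D (\<Phi>1 y) \<bullet> \<Phi>2 y = - (g \<bullet> frechet_derivative \<Phi>2 (at y) (axis 1 1))"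
    "D (\<Phi>2 y) \<bullet> \<Phi>1 y = - (g \<bullet> frechet_derivative \<Phi>1 (at y) (axis 2 1))"
    "D (\<Phi>2 y) \<bullet> \<Phi>2 y = - (g \<bullet> frechet_derivative \<Phi>2 (at y) (axis 2 1))"
    using zero_on_patch(2)[OF a] by (simp_all add: D_def g_def \<Phi>1_def[abs_def] \<Phi>2_def[abs_def] x_def)
  have num: "(g \<bullet> X2 x)\<^sup>2 * A1 (X1 x) - (g \<bullet> X1 x) * (g \<bullet> X2 x) * (A2 (X1 x) + A1 (X2 x)) + (g \<bullet> X1 x)\<^sup>2 * A2 (X2 x)
     = (g \<bullet> X1 x)\<^sup>2 * (g \<bullet> P11 y) + (g \<bullet> X1 x) * (g \<bullet> X2 x) * (g \<bullet> P12 y) + (g \<bullet> X2 x)\<^sup>2 * (g \<bullet> P22 y)"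
    unfolding P11_def P12_def P22_def second_deriv_def tangent_coord1_def tangent_coord2_def normal_def defs
    by (rule hessian_quadratic_form[OF _ _ has_derivative_linear[OF D] has_derivative_linear[OF L(1)] has_derivative_linear[OF L(2)] H])
      (use normal_nonzero[OF y] g in \<open>auto simp: normal_def A1_def A2_def\<close>)
  have "divergence \<rho> F x = divergence \<rho> (\<lambda>x. ((gradient f x \<bullet> X1 x) *\<^sub>R X1 x + (gradient f x \<bullet> X2 x) *\<^sub>R X2 x)
      /\<^sub>R sqrt ((gradient f x \<bullet> X1 x)\<^sup>2 + (gradient f x \<bullet> X2 x)\<^sup>2)) x"
    by (rule divergence_cong[OF T'(1) xT' F])
  also have "\<dots> =
      curvature_expr (g \<bullet> X1 x) (g \<bullet> X2 x) (g \<bullet> P11 y) (g \<bullet> P12 y) (g \<bullet> P22 y) (R1 y) (R2 y)"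
    unfolding unit_field_divergence[OF L A \<rho>x refl r[unfolded g_def]] g_def[symmetric] num
    by (simp add: curvature_expr_def R1_def R2_def x_def)
  finally have div: "divergence \<rho> F x = curvature_expr (g \<bullet> X1 x) (g \<bullet> X2 x) (g \<bullet> P11 y) (g \<bullet> P12 y) (g \<bullet> P22 y) (R1 y) (R2 y)" .
  show ?thesis
    unfolding x_def[symmetric] div gX curvature_def
    using curvature_expr_scale[OF l0] by (simp add: g)
qed

end

section \<open>Charts and horizontal frames\<close>

lemma
  assumes "is_chart c"
  shows chart_inv_map: "p \<in> chart_dom c \<Longrightarrow> chart_inv c (chart_map c p) = p"
    and chart_map_inv: "x \<in> chart_img c \<Longrightarrow> chart_map c (chart_inv c x) = x"
    and chart_inv_in_dom: "x \<in> chart_img c \<Longrightarrow> chart_inv c x \<in> chart_dom c"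
    and chart_map_in_img: "p \<in> chart_dom c \<Longrightarrow> chart_map c p \<in> chart_img c"
    and continuous_chart_map: "continuous_on (chart_dom c) (chart_map c)"
    and continuous_chart_inv: "continuous_on (chart_img c) (chart_inv c)"
    and open_chart_dom: "open (chart_dom c)"
    and open_chart_img: "open (chart_img c)"
  using assms by (auto simp: is_chart_def homeomorphism_def)

lemma chart_image_eq:
  assumes "is_chart c"
  shows "chart_map c ` (U \<inter> chart_dom c) = chart_img c \<inter> chart_inv c -` U"
proof (intro equalityI subsetI)
  fix x assume x: "x \<in> chart_img c \<inter> chart_inv c -` U"
  then have "x = chart_map c (chart_inv c x)" "chart_inv c x \<in> U \<inter> chart_dom c"
    using assms by (auto simp: chart_map_inv chart_inv_in_dom)
  then show "x \<in> chart_map c ` (U \<inter> chart_dom c)" by (rule image_eqI)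
qed (use assms in \<open>auto simp: chart_inv_map chart_map_in_img\<close>)

lemma open_chart_image:
  assumes "is_chart c" "open U"
  shows "open (chart_map c ` (U \<inter> chart_dom c))"
  unfolding chart_image_eq[OF assms(1)]
  by (rule continuous_open_preimage[OF continuous_chart_inv open_chart_img assms(2)]) (rule assms(1))+

lemma transition_has_derivative:
  assumes "Ck_compatible 2 c c'" "p \<in> chart_dom c \<inter> chart_dom c'"
  shows "(transition c c' has_derivative dtransition c c' p) (at (chart_map c p))"
    and "(transition c' c has_derivative dtransition c' c p) (at (chart_map c' p))"
  using assms C2_has_derivative unfolding Ck_compatible_def dtransition_def by blast+

text \<open>The two transition maps are inverse on the image of the overlap, which is open, so the
  chain rule applies. The inner claim is made for an arbitrary pair of charts to obtain both orders
  at once.\<close>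

lemma dtransition_inverse:
  assumes "is_chart c" "is_chart c'" "Ck_compatible 2 c c'" "p \<in> chart_dom c \<inter> chart_dom c'"
  shows "dtransition c c' p (dtransition c' c p v) = v" "dtransition c' c p (dtransition c c' p v) = v"
proof -
  have *: "dtransition c' c p (dtransition c c' p v) = v"
    if c: "is_chart c" "is_chart c'" and p: "p \<in> chart_dom c \<inter> chart_dom c'"
    and D: "(transition c c' has_derivative dtransition c c' p) (at (chart_map c p))"
    "(transition c' c has_derivative dtransition c' c p) (at (chart_map c' p))" for c c' :: "'a chart"
  proof -
    have "transition c c' (chart_map c p) = chart_map c' p"
      using p chart_inv_map[OF c(1)] by (simp add: transition_def)
    with has_derivative_compose[OF D(1), of "transition c' c"] D(2)
    have "((\<lambda>x. transition c' c (transition c c' x)) has_derivative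
        (\<lambda>v. dtransition c' c p (dtransition c c' p v))) (at (chart_map c p))" by simp
    then have "((\<lambda>x. x) has_derivative (\<lambda>v. dtransition c' c p (dtransition c c' p v))) (at (chart_map c p))"
    proof (rule has_derivative_transform_within_open)
      show "open (chart_map c ` (chart_dom c' \<inter> chart_dom c))"
        by (rule open_chart_image[OF c(1) open_chart_dom[OF c(2)]])
      show "chart_map c p \<in> chart_map c ` (chart_dom c' \<inter> chart_dom c)" using p by auto
      fix x assume "x \<in> chart_map c ` (chart_dom c' \<inter> chart_dom c)"
      then show "transition c' c (transition c c' x) = x"
        using chart_inv_map[OF c(1)] chart_inv_map[OF c(2)] by (auto simp: transition_def)
    qed
    from has_derivative_unique[OF this has_derivative_ident] show ?thesis by (rule fun_cong)
  qed
  show "dtransition c' c p (dtransition c c' p v) = v"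
    using assms by (intro * transition_has_derivative) auto
  show "dtransition c c' p (dtransition c' c p v) = v"
    using assms transition_has_derivative[OF assms(3,4)] by (intro *) auto
qed

section \<open>Orthonormal frames of the distribution\<close>

definition orthonormal_basis_of where
  "orthonormal_basis_of D B e1 e2 \<longleftrightarrow> e1 \<in> D \<and> e2 \<in> D \<and> B e1 e1 = (1::real) \<and> B e2 e2 = 1 \<and> B e1 e2 = 0 \<and>
     (\<forall>v\<in>D. v = B v e1 *\<^sub>R e1 + B v e2 *\<^sub>R (e2 :: real^3))"

lemma inner_product_onD:
  assumes "inner_product_on D B" "u \<in> D" "v \<in> D" "w \<in> D"
  shows "B v w = B w v" "B (a *\<^sub>R u + b *\<^sub>R v) w = a * B u w + b * B v w"
    "v \<noteq> 0 \<Longrightarrow> B v v > 0"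
  using assms unfolding inner_product_on_def by blast+

lemma inner_product_on_right:
  assumes "inner_product_on D B" "subspace D" "u \<in> D" "v \<in> D" "w \<in> D"
  shows "B w (a *\<^sub>R u + b *\<^sub>R v) = a * B w u + b * B w v"
proof -
  have "a *\<^sub>R u + b *\<^sub>R v \<in> D" using assms by (simp add: subspace_add subspace_scale)
  then have "B w (a *\<^sub>R u + b *\<^sub>R v) = B (a *\<^sub>R u + b *\<^sub>R v) w"
    using assms inner_product_onD(1) by blast
  also have "\<dots> = a * B u w + b * B v w"
    using assms by (intro inner_product_onD(2)) auto
  also have "\<dots> = a * B w u + b * B w v"
    using inner_product_onD(1)[OF assms(1) assms(3,3,5)] inner_product_onD(1)[OF assms(1) assms(4,4,5)] by simp
  finally show ?thesis .
qed

text \<open>The basis is given by explicit formulas in \<open>p\<close>, \<open>q\<close> and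
  \<open>d\<close>, not merely shown to exist, because its C^1 dependence on the base point is read
  off from them. Here \<open>d\<close> is the squared length of \<open>Y2\<close> minus its
  projection to \<open>Y1\<close>.\<close>

lemma gram_schmidt_pair:
  assumes ip: "inner_product_on D B" "subspace D" and Y: "Y1 \<in> D" "Y2 \<in> D"
    and ind: "\<And>a b. a *\<^sub>R Y1 + b *\<^sub>R Y2 = 0 \<Longrightarrow> a = 0 \<and> b = 0"
    and span: "\<And>v. v \<in> D \<Longrightarrow> \<exists>a b. v = a *\<^sub>R Y1 + b *\<^sub>R Y2"
  defines "p \<equiv> B Y1 Y1" and "q \<equiv> B Y1 Y2"
  defines "d \<equiv> B Y2 Y2 - q * q * inverse p"
  shows "p > 0" "d > 0"
    and "orthonormal_basis_of D B (inverse (sqrt p) *\<^sub>R Y1) (inverse (sqrt d) *\<^sub>R (Y2 - (q * inverse p) *\<^sub>R Y1))"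
proof -
  have Y1: "Y1 \<noteq> 0" using ind[of 1 0] by auto
  then show p: "p > 0" using ip Y by (auto simp: p_def intro: inner_product_onD(3))
  define Z where "Z = Y2 - (q * inverse p) *\<^sub>R Y1"
  have Z: "Z = (- (q * inverse p)) *\<^sub>R Y1 + 1 *\<^sub>R Y2" by (simp add: Z_def)
  have "Z \<noteq> 0" using ind[of "- (q * inverse p)" 1] Z by auto
  have ZD: "Z \<in> D" unfolding Z using ip(2) Y by (intro subspace_add subspace_scale)
  have sym: "B Y2 Y1 = q" using inner_product_onD(1)[OF ip(1) Y(1) Y] by (simp add: q_def)
  have ZY: "B Z Y1 = 0" unfolding Z using p by (subst inner_product_onD(2)[OF ip(1) Y Y(1)]) (simp add: sym p_def)
  have "B Z Y2 = d" unfolding Z by (subst inner_product_onD(2)[OF ip(1) Y Y(2)]) (simp add: d_def q_def algebra_simps)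
  then have BZ: "B Z Z = d" using inner_product_on_right[OF ip Y ZD, of "- (q * inverse p)" 1] ZY Z by simp
  then show d: "d > 0" using inner_product_onD(3)[OF ip(1) ZD ZD ZD \<open>Z \<noteq> 0\<close>] by simp
  let ?e1 = "inverse (sqrt p) *\<^sub>R Y1" and ?e2 = "inverse (sqrt d) *\<^sub>R Z"
  have eD: "?e1 \<in> D" "?e2 \<in> D" using ip(2) Y ZD by (simp_all add: subspace_scale)
  have scale: "B (a *\<^sub>R u) (b *\<^sub>R v) = a * b * B u v" if "u \<in> D" "v \<in> D" for a b u v
  proof -
    have "B (a *\<^sub>R u) (b *\<^sub>R v) = b * B (a *\<^sub>R u) v"
      using inner_product_on_right[OF ip that(2,2) subspace_scale[OF ip(2) that(1), of a], where a = b and b = 0] by simp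
    then show ?thesis using inner_product_onD(2)[OF ip(1) that(1,1,2), of a 0] by simp
  qed
  have YZ: "B Y1 Z = 0" using ZY inner_product_onD(1)[OF ip(1) Y(1) Y(1) ZD] by simp
  have o: "B ?e1 ?e1 = 1" "B ?e2 ?e2 = 1" "B ?e1 ?e2 = 0"
    using p d by (simp_all add: scale Y ZD BZ YZ flip: p_def inverse_mult_distrib)
  have "v = B v ?e1 *\<^sub>R ?e1 + B v ?e2 *\<^sub>R ?e2" if v: "v \<in> D" for v
  proof -
    obtain a b where "v = a *\<^sub>R Y1 + b *\<^sub>R Y2" using span[OF v] by blast
    then have "v = ((a + b * (q * inverse p)) * sqrt p) *\<^sub>R ?e1 + (b * sqrt d) *\<^sub>R ?e2"
      using p d by (simp add: Z_def algebra_simps)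
    then obtain s t where s: "v = s *\<^sub>R ?e1 + t *\<^sub>R ?e2" by blast
    have "B ?e2 ?e1 = 0" using o(3) inner_product_onD(1)[OF ip(1) eD(1) eD] by simp
    then have "B v ?e1 = s" "B v ?e2 = t"
      unfolding s using inner_product_onD(2)[OF ip(1) eD eD(1)] inner_product_onD(2)[OF ip(1) eD eD(2)] o by simp_all
    then show ?thesis using s by simp
  qed
  then show "orthonormal_basis_of D B ?e1 (inverse (sqrt d) *\<^sub>R (Y2 - (q * inverse p) *\<^sub>R Y1))"
    using eD o unfolding orthonormal_basis_of_def Z_def by blast
qed

lemma subspace_distr_at: "linear (sr_form M c x) \<Longrightarrow> subspace (distr_at M c x)"
  by (auto simp: distr_at_def subspace_def linear_0 linear_add linear_scale)

text \<open>The representative of a linear functional has the values of the functional on an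
  orthonormal basis as its coefficients.\<close>

lemma hgrad_hnorm_eq:
  assumes ip: "inner_product_on (distr_at M c x) (sr_metric M c x)" and sub: "subspace (distr_at M c x)"
    and onb: "orthonormal_basis_of (distr_at M c x) (sr_metric M c x) e1 e2"
    and f: "f differentiable (at x)"
  defines "a1 \<equiv> gradient f x \<bullet> e1" and "a2 \<equiv> gradient f x \<bullet> e2"
  shows "hgrad M c f x = a1 *\<^sub>R e1 + a2 *\<^sub>R e2"
    and "hnorm M c x (a1 *\<^sub>R e1 + a2 *\<^sub>R e2) = sqrt (a1\<^sup>2 + a2\<^sup>2)"
proof -
  let ?D = "distr_at M c x" and ?B = "sr_metric M c x"
  have e: "e1 \<in> ?D" "e2 \<in> ?D" "?B e1 e1 = 1" "?B e2 e2 = 1" "?B e1 e2 = 0"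
    "\<And>v. v \<in> ?D \<Longrightarrow> v = ?B v e1 *\<^sub>R e1 + ?B v e2 *\<^sub>R e2"
    using onb unfolding orthonormal_basis_of_def by blast+
  have e21: "?B e2 e1 = 0" using e(5) inner_product_onD(1)[OF ip e(1,1,2)] by simp
  let ?v = "a1 *\<^sub>R e1 + a2 *\<^sub>R e2"
  have vD: "?v \<in> ?D" using sub e by (intro subspace_add subspace_scale)
  have B: "?B (s *\<^sub>R e1 + t *\<^sub>R e2) e1 = s" "?B (s *\<^sub>R e1 + t *\<^sub>R e2) e2 = t" for s t
    using inner_product_onD(2)[OF ip e(1,2)] e e21 by simp_all
  have grad: "frechet_derivative f (at x) w = gradient f x \<bullet> w" for w
    using inner_gradient[OF f] by simp
  have "?B ?v w = frechet_derivative f (at x) w" if w: "w \<in> ?D" for w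
  proof -
    define s t where "s = ?B w e1" and "t = ?B w e2"
    have ww: "w = s *\<^sub>R e1 + t *\<^sub>R e2" using e(6)[OF w] by (simp add: s_def t_def)
    have "?B ?v w = s * ?B ?v e1 + t * ?B ?v e2"
      unfolding ww using inner_product_on_right[OF ip sub e(1,2) vD] .
    then show ?thesis unfolding grad B ww by (simp add: a1_def a2_def inner_simps)
  qed
  moreover have "v = ?v" if v: "v \<in> ?D" "\<forall>w\<in>?D. ?B v w = frechet_derivative f (at x) w" for v
    using e(6)[OF v(1)] v(2) e(1,2) by (simp add: grad a1_def a2_def)
  ultimately show "hgrad M c f x = ?v"
    unfolding hgrad_def using vD by (intro the_equality) blast+
  have "?B ?v ?v = a1 * ?B ?v e1 + a2 * ?B ?v e2"
    by (rule inner_product_on_right[OF ip sub e(1,2) vD])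
  then show "hnorm M c x ?v = sqrt (a1\<^sup>2 + a2\<^sup>2)"
    by (simp add: hnorm_def B power2_eq_square)
qed

lemma contact_sub_riemannianD:
  assumes "contact_sub_riemannian M" "c \<in> sr_atlas M"
  shows "is_chart c" "c' \<in> sr_atlas M \<Longrightarrow> Ck_compatible k c c'"
    "x \<in> chart_img c \<Longrightarrow> linear (sr_form M c x)"
    "x \<in> chart_img c \<Longrightarrow> subspace (distr_at M c x)"
    "x \<in> chart_img c \<Longrightarrow> inner_product_on (distr_at M c x) (sr_metric M c x)"
proof -
  have at: "smooth_atlas (sr_atlas M)" "smooth_one_form (sr_atlas M) (sr_form M)" "smooth_horizontal_metric M"
    using assms(1) by (simp_all add: contact_sub_riemannian_def contact_form_def)
  show "is_chart c" "c' \<in> sr_atlas M \<Longrightarrow> Ck_compatible k c c'"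
    using at(1) assms(2) by (simp_all add: smooth_atlas_def)
  show lin: "linear (sr_form M c x)" if "x \<in> chart_img c"
    using at(2) assms(2) that by (simp add: smooth_one_form_def)
  show "subspace (distr_at M c x)" if "x \<in> chart_img c"
    by (rule subspace_distr_at[OF lin[OF that]])
  show "inner_product_on (distr_at M c x) (sr_metric M c x)" if "x \<in> chart_img c"
    by (rule at(3)[unfolded smooth_horizontal_metric_def, THEN conjunct1, rule_format, OF assms(2) that])
qed

definition horizontal_frame ::
  "'m contact_sr \<Rightarrow> 'm chart \<Rightarrow> (real^3) set \<Rightarrow> (real^3 \<Rightarrow> real^3) \<Rightarrow> (real^3 \<Rightarrow> real^3) \<Rightarrow> bool" where
  "horizontal_frame M c T X1 X2 \<longleftrightarrow> open T \<and> T \<subseteq> chart_img c \<and>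
     Ck_section M c 1 T X1 \<and> Ck_section M c 1 T X2 \<and>
     (\<forall>x\<in>T. orthonormal_basis_of (distr_at M c x) (sr_metric M c x) (X1 x) (X2 x))"

text \<open>Some coordinate vector is not annihilated by \<omega>, and the other two complete it to
  a basis. The vectors do not depend on a base point, so the one called \<open>e\<close> stays
  transversal to the distribution nearby.\<close>

lemma basis_complementing_kernel:
  fixes \<omega> :: "real^3 \<Rightarrow> real"
  assumes "linear \<omega>" "\<omega> \<noteq> (\<lambda>v. 0)"
  shows "\<exists>e f1 f2. \<omega> e \<noteq> 0 \<and> (\<forall>v. \<exists>a b c. v = a *\<^sub>R e + b *\<^sub>R f1 + c *\<^sub>R f2) \<and>
    (\<forall>a b c. a *\<^sub>R e + b *\<^sub>R f1 + c *\<^sub>R f2 = 0 \<longrightarrow> a = 0 \<and> b = 0 \<and> c = 0)"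
proof -
  define is_basis where "is_basis = (\<lambda>e f1 f2 :: real^3. (\<forall>v. \<exists>a b c. v = a *\<^sub>R e + b *\<^sub>R f1 + c *\<^sub>R f2) \<and>
    (\<forall>a b c. a *\<^sub>R e + b *\<^sub>R f1 + c *\<^sub>R f2 = 0 \<longrightarrow> a = 0 \<and> b = 0 \<and> c = 0))"
  have "v = v$1 *\<^sub>R axis 1 1 + v$2 *\<^sub>R axis 2 1 + v$3 *\<^sub>R axis 3 1"
    "v = v$2 *\<^sub>R axis 2 1 + v$1 *\<^sub>R axis 1 1 + v$3 *\<^sub>R axis 3 1"
    "v = v$3 *\<^sub>R axis 3 1 + v$1 *\<^sub>R axis 1 1 + v$2 *\<^sub>R axis 2 1" for v :: "real^3"
    by (simp_all add: vec_eq_iff forall_3 axis_def)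
  moreover have "a = 0 \<and> b = 0 \<and> c = 0" if "a *\<^sub>R axis 1 1 + b *\<^sub>R axis 2 1 + c *\<^sub>R axis 3 1 = (0 :: real^3)" for a b c
    using that by (simp add: vec_eq_iff forall_3 axis_def)
  moreover have "a = 0 \<and> b = 0 \<and> c = 0" if "a *\<^sub>R axis 2 1 + b *\<^sub>R axis 1 1 + c *\<^sub>R axis 3 1 = (0 :: real^3)" for a b c
    using that by (simp add: vec_eq_iff forall_3 axis_def)
  moreover have "a = 0 \<and> b = 0 \<and> c = 0" if "a *\<^sub>R axis 3 1 + b *\<^sub>R axis 1 1 + c *\<^sub>R axis 2 1 = (0 :: real^3)" for a b c
    using that by (simp add: vec_eq_iff forall_3 axis_def)
  ultimately have "is_basis (axis 1 1) (axis 2 1) (axis 3 1)" "is_basis (axis 2 1) (axis 1 1) (axis 3 1)"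
    "is_basis (axis 3 1) (axis 1 1) (axis 2 1)"
    unfolding is_basis_def by blast+
  moreover have "\<omega> (axis 1 1) \<noteq> 0 \<or> \<omega> (axis 2 1) \<noteq> 0 \<or> \<omega> (axis 3 1) \<noteq> 0"
  proof (rule ccontr)
    assume "\<not> ?thesis"
    then have "\<omega> v = 0" for v using linear_vec3_sum[OF assms(1), of v] by simp
    with assms(2) show False by auto
  qed
  ultimately have "\<exists>e f1 f2. \<omega> e \<noteq> 0 \<and> is_basis e f1 f2" by blast
  then show ?thesis unfolding is_basis_def .
qed

lemma horizontal_frame_exists:
  assumes M: "contact_sub_riemannian M" and c: "c \<in> sr_atlas M" and x0: "x0 \<in> chart_img c"
  shows "\<exists>T X1 X2. horizontal_frame M c T X1 X2 \<and> x0 \<in> T"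
proof -
  let ?\<omega> = "sr_form M c" and ?g = "sr_metric M c" and ?D = "distr_at M c"
  note MD = contact_sub_riemannianD[OF M c]
  have smooth: "smooth_on (chart_img c) (\<lambda>x. ?\<omega> x v)" for v
    using M c by (simp add: contact_sub_riemannian_def contact_form_def smooth_one_form_def)
  have "wedge12 (?\<omega> x0) (ext_deriv ?\<omega> x0) \<noteq> (\<lambda>u v w. 0)"
    using M c x0 by (simp add: contact_sub_riemannian_def contact_form_def)
  then have "?\<omega> x0 \<noteq> (\<lambda>v. 0)" by (auto simp: wedge12_def[abs_def])
  from basis_complementing_kernel[OF MD(3)[OF x0] this] obtain e f1 f2
    where e: "?\<omega> x0 e \<noteq> 0" and span: "\<And>v. \<exists>a b c. v = a *\<^sub>R e + b *\<^sub>R f1 + c *\<^sub>R f2"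
    and ind: "\<And>a b c. a *\<^sub>R e + b *\<^sub>R f1 + c *\<^sub>R f2 = 0 \<Longrightarrow> a = 0 \<and> b = 0 \<and> c = 0"
    by blast
  define T where "T = chart_img c \<inter> (\<lambda>x. ?\<omega> x e) -` (- {0})"
  have "continuous_on (chart_img c) (\<lambda>x. ?\<omega> x e)"
    using smooth[of e] Ck_on_imp_continuous_on by (auto simp: smooth_on_def)
  then have T: "open T" "T \<subseteq> chart_img c" "x0 \<in> T"
    unfolding T_def using e x0 open_chart_img[OF MD(1)]
    by (auto intro!: continuous_open_preimage)
  have \<omega>T: "Ck_on k T (\<lambda>x. ?\<omega> x v)" for k v
    using smooth[of v] Ck_on_subset[OF _ T(2)] by (auto simp: smooth_on_def)
  \<comment> \<open>The projection of \<open>f\<close> to the kernel along \<open>e\<close>,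
    multiplied by \<omega>(e): this is linear in the coefficients of the form and therefore
    smooth.\<close>
  define Y where "Y = (\<lambda>f x. ?\<omega> x e *\<^sub>R f - ?\<omega> x f *\<^sub>R e)"
  have Yk: "Ck_on k T (Y f)" for k f
    unfolding Y_def
    by (intro Ck_on_diff[OF T(1)] Ck_on_linear_image[OF T(1) bounded_linear_scaleR_left] \<omega>T)
  have YD: "Y f x \<in> ?D x" if "x \<in> T" for f x
    using MD(3)[of x] that T(2) by (auto simp: Y_def distr_at_def linear_diff linear_scale)
  have Ysec: "smooth_section M c T (Y f)" for f
    using Yk YD by (simp add: smooth_section_def Ck_section_def)
  \<comment> \<open>Smoothness of the metric is postulated along smooth sections only, so the Gram
    coefficients must be formed from the fields \<open>Y\<close> before any normalization.\<close>
  have gY: "Ck_on 1 T (\<lambda>x. ?g x (Y f x) (Y h x))" for f h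
  proof -
    have "smooth_horizontal_metric M" using M by (simp add: contact_sub_riemannian_def)
    from this[unfolded smooth_horizontal_metric_def, THEN conjunct2, THEN conjunct1, rule_format, OF c]
    have "smooth_on T (\<lambda>x. ?g x (Y f x) (Y h x))" using T(1,2) Ysec by simp
    then show ?thesis unfolding smooth_on_def by (rule spec)
  qed
  define p q where "p = (\<lambda>x. ?g x (Y f1 x) (Y f1 x))" and "q = (\<lambda>x. ?g x (Y f1 x) (Y f2 x))"
  define d where "d = (\<lambda>x. ?g x (Y f2 x) (Y f2 x) - q x * q x * inverse (p x))"
  define X1 where "X1 = (\<lambda>x. inverse (sqrt (p x)) *\<^sub>R Y f1 x)"
  define X2 where "X2 = (\<lambda>x. inverse (sqrt (d x)) *\<^sub>R (Y f2 x - (q x * inverse (p x)) *\<^sub>R Y f1 x))"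
  have gs: "p x > 0 \<and> d x > 0 \<and> orthonormal_basis_of (?D x) (?g x) (X1 x) (X2 x)" if x: "x \<in> T" for x
  proof -
    have xi: "x \<in> chart_img c" and \<omega>e: "?\<omega> x e \<noteq> 0" using x by (auto simp: T_def)
    have 1: "a = 0 \<and> b = 0" if "a *\<^sub>R Y f1 x + b *\<^sub>R Y f2 x = 0" for a b
    proof -
      have "(- (a * ?\<omega> x f1 + b * ?\<omega> x f2)) *\<^sub>R e + (a * ?\<omega> x e) *\<^sub>R f1 + (b * ?\<omega> x e) *\<^sub>R f2 = 0"
        using that by (simp add: Y_def algebra_simps)
      from ind[OF this] \<omega>e show ?thesis by simp
    qed
    have 2: "\<exists>a b. v = a *\<^sub>R Y f1 x + b *\<^sub>R Y f2 x" if "v \<in> ?D x" for v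
    proof -
      obtain r s t where v: "v = r *\<^sub>R e + s *\<^sub>R f1 + t *\<^sub>R f2" using span by blast
      have "r * ?\<omega> x e + s * ?\<omega> x f1 + t * ?\<omega> x f2 = 0"
        using that MD(3)[OF xi] by (simp add: v distr_at_def linear_add linear_scale)
      then have r: "r = - (s / ?\<omega> x e * ?\<omega> x f1 + t / ?\<omega> x e * ?\<omega> x f2)"
        using \<omega>e by (simp add: field_simps)
      have "v = (s / ?\<omega> x e) *\<^sub>R Y f1 x + (t / ?\<omega> x e) *\<^sub>R Y f2 x"
        unfolding v r using \<omega>e by (simp add: Y_def algebra_simps)
      then show ?thesis by blast
    qed
    show ?thesis
      using gram_schmidt_pair[OF MD(5)[OF xi] MD(4)[OF xi] YD[OF x] YD[OF x] 1 2]
      by (simp add: X1_def X2_def p_def q_def d_def)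
  qed
  have pqd: "Ck_on 1 T p" "Ck_on 1 T q"
    unfolding p_def q_def by (rule gY)+
  have "Ck_on 1 T (\<lambda>x. inverse (p x))"
    using gs by (intro C1_inverse[OF T(1) pqd(1)]) force
  then have qp: "Ck_on 1 T (\<lambda>x. q x * inverse (p x))" and d: "Ck_on 1 T d"
    unfolding d_def by (intro C1_mult Ck_on_diff T(1) pqd gY; assumption)+
  have X: "Ck_on 1 T X1" "Ck_on 1 T X2"
    unfolding X1_def X2_def using gs
    by (intro C1_scaleR Ck_on_diff C1_inverse_sqrt T(1) pqd(1) d Yk qp; blast)+
  have "horizontal_frame M c T X1 X2"
    unfolding horizontal_frame_def Ck_section_def using T X gs
    by (auto simp: orthonormal_basis_of_def simp del: One_nat_def)
  with T(3) show ?thesis by blast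
qed

section \<open>Defining functions and slice parametrizations in a chart\<close>

lemma local_defining_function_in_chart:
  assumes M: "contact_sub_riemannian M" and c: "c \<in> sr_atlas M"
    and u: "local_defining_function (sr_atlas M) S q U u" and q: "q \<in> chart_dom c"
  defines "f \<equiv> u \<circ> chart_inv c" and "T \<equiv> chart_map c ` (U \<inter> chart_dom c)"
  shows "open T" "chart_map c q \<in> T" "Ck_on 2 T f" "gradient f (chart_map c q) \<noteq> 0"
    "\<And>z. z \<in> S \<inter> U \<inter> chart_dom c \<Longrightarrow> f (chart_map c z) = 0"
    "\<And>v. v \<in> tangent_space S c q \<Longrightarrow> gradient f (chart_map c q) \<bullet> v = 0"
proof -
  note ch = contact_sub_riemannianD(1)[OF M c]
  have U: "open U" "q \<in> S \<inter> U" "S \<inter> U = {q \<in> U. u q = 0}"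
    and df: "frechet_derivative f (at (chart_map c q)) \<noteq> (\<lambda>v. 0)"
    using u c q unfolding local_defining_function_def f_def by auto
  show T: "open T" unfolding T_def by (rule open_chart_image[OF ch U(1)])
  show qT: "chart_map c q \<in> T" using U(2) q by (auto simp: T_def)
  show f: "Ck_on 2 T f" using u c unfolding local_defining_function_def T_def f_def by blast
  have Df: "(f has_derivative (\<lambda>v. gradient f (chart_map c q) \<bullet> v)) (at (chart_map c q))"
    by (rule C2_gradient_has_derivative[OF f qT])
  from frechet_derivative_eqI[OF this] df
  show "gradient f (chart_map c q) \<noteq> 0" by auto
  show zero: "f (chart_map c z) = 0" if "z \<in> S \<inter> U \<inter> chart_dom c" for z
    using that U(3) by (auto simp: f_def chart_inv_map[OF ch])
  fix v assume "v \<in> tangent_space S c q"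
  then obtain \<gamma> \<epsilon> where \<gamma>: "\<epsilon> > 0" "\<gamma> 0 = q" "\<And>t. \<bar>t\<bar> < \<epsilon> \<Longrightarrow> \<gamma> t \<in> S \<inter> chart_dom c"
    "((\<lambda>t. chart_map c (\<gamma> t)) has_vector_derivative v) (at (0::real))"
    unfolding tangent_space_def by blast
  \<comment> \<open>The curves in \<open>tangent_space\<close> lie in \<open>S\<close> but perhaps
    not in \<open>U\<close>, and only their coordinates are known to be continuous at 0. So the
    coordinates are shown to stay in \<open>T\<close>, and the injective chart map brings the curve
    itself into \<open>U\<close>.\<close>
  have "isCont (\<lambda>t. chart_map c (\<gamma> t)) 0"
    using \<gamma>(4) has_vector_derivative_continuous by blast
  then have "((\<lambda>t. chart_map c (\<gamma> t)) \<longlongrightarrow> chart_map c q) (nhds 0)"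
    using \<gamma>(2) tendsto_at_iff_tendsto_nhds[of "\<lambda>t. chart_map c (\<gamma> t)" 0] by (simp add: isCont_def)
  then have "\<forall>\<^sub>F t in nhds 0. chart_map c (\<gamma> t) \<in> T"
    using T qT by (rule topological_tendstoD)
  moreover have "\<forall>\<^sub>F t in nhds 0. \<bar>t\<bar> < \<epsilon>"
    unfolding eventually_nhds_metric using \<gamma>(1) by (auto simp: dist_real_def)
  ultimately have "\<forall>\<^sub>F t in nhds 0. f (chart_map c (\<gamma> t)) = 0"
  proof eventually_elim
    case (elim t)
    then obtain z where "z \<in> U \<inter> chart_dom c" "chart_map c (\<gamma> t) = chart_map c z" by (auto simp: T_def)
    then have "\<gamma> t \<in> U" using \<gamma>(3)[OF elim(2)] chart_inv_map[OF ch] by (metis IntD1 IntD2)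
    with \<gamma>(3)[OF elim(2)] show ?case by (intro zero) auto
  qed
  then obtain N where N: "open N" "0 \<in> N" "\<And>t. t \<in> N \<Longrightarrow> f (chart_map c (\<gamma> t)) = 0"
    unfolding eventually_nhds by auto
  have "((\<lambda>t. f (chart_map c (\<gamma> t))) has_derivative (\<lambda>t. gradient f (chart_map c q) \<bullet> (t *\<^sub>R v))) (at 0)"
  proof -
    have "(f has_derivative (\<lambda>v. gradient f (chart_map c q) \<bullet> v)) (at (chart_map c (\<gamma> 0)))"
      using Df \<gamma>(2) by simp
    from has_derivative_compose[OF \<gamma>(4)[unfolded has_vector_derivative_def] this] show ?thesis .
  qed
  then have "((\<lambda>t. 0) has_derivative (\<lambda>t. gradient f (chart_map c q) \<bullet> (t *\<^sub>R v))) (at 0)"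
    using has_derivative_cong_open[OF N(1,2), of "\<lambda>t. f (chart_map c (\<gamma> t))" "\<lambda>t. 0"] N(3) by simp
  from fun_cong[OF has_derivative_unique[OF this has_derivative_const], of 1]
  show "gradient f (chart_map c q) \<bullet> v = 0" by simp
qed

text \<open>The first two slice coordinates parametrize the surface. All smaller concentric balls
  are included because their images, being open in \<open>S\<close>, are the measurable sets of the
  dyadic argument.\<close>

lemma slice_parametrization:
  assumes M: "contact_sub_riemannian M" and S: "C2_embedded_surface (sr_atlas M) S"
    and c: "c \<in> sr_atlas M" and p: "p \<in> S" "p \<in> chart_dom c" and Q: "open Q" "chart_map c p \<in> Q"
  shows "\<exists>\<psi> y0 \<delta>. \<delta> > 0 \<and> \<psi> y0 = p \<and>
    (\<forall>r. 0 < r \<longrightarrow> r \<le> \<delta> \<longrightarrow> local_parametrization (sr_atlas M) S (ball y0 r) \<psi>) \<and>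
    \<psi> ` ball y0 \<delta> \<subseteq> chart_dom c \<and> (chart_map c \<circ> \<psi>) ` ball y0 \<delta> \<subseteq> Q"
proof -
  obtain s where s: "is_chart s" "p \<in> chart_dom s" and cs: "\<And>c. c \<in> sr_atlas M \<Longrightarrow> Ck_compatible 2 c s"
    and slice: "chart_map s ` (S \<inter> chart_dom s) = {y \<in> chart_img s. y $ 3 = 0}"
    using S p(1) unfolding C2_embedded_surface_def by blast
  note ch = contact_sub_riemannianD(1)[OF M]
  define \<iota> :: "real^2 \<Rightarrow> real^3" where "\<iota> = (\<lambda>y. vector [y$1, y$2, 0])"
  define pr :: "real^3 \<Rightarrow> real^2" where "pr = (\<lambda>z. vector [z$1, z$2])"
  have lin: "linear \<iota>" "linear pr"
    by (auto intro!: linearI simp: \<iota>_def pr_def vec_eq_iff forall_3 forall_2)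
  then have bl: "bounded_linear \<iota>" "bounded_linear pr"
    by (simp_all add: linear_conv_bounded_linear)
  have pr\<iota>: "pr (\<iota> y) = y" for y by (simp add: \<iota>_def pr_def vec_eq_iff forall_2)
  have \<iota>pr: "z $ 3 = 0 \<Longrightarrow> \<iota> (pr z) = z" for z by (simp add: \<iota>_def pr_def vec_eq_iff forall_3)
  have \<iota>3: "\<iota> y $ 3 = 0" for y by (simp add: \<iota>_def)
  have slice_pt: "\<iota> (pr (chart_map s q)) = chart_map s q" if "q \<in> S" "q \<in> chart_dom s" for q
    using slice that by (intro \<iota>pr) blast
  define \<psi> where "\<psi> = chart_inv s \<circ> \<iota>"
  define y0 where "y0 = pr (chart_map s p)"
  \<comment> \<open>Slice coordinates of the points that lie in the chart \<open>c\<close> and have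
    coordinates in \<open>Q\<close> there; a ball that \<iota> sends into \<open>Z\<close> meets
    both inclusions at once.\<close>
  define Z where "Z = chart_map s ` ((chart_dom c \<inter> chart_map c -` Q) \<inter> chart_dom s)"
  have "open (chart_dom c \<inter> chart_map c -` Q)"
    by (rule continuous_open_preimage[OF continuous_chart_map open_chart_dom Q(1)]) (rule ch[OF c])+
  then have Z: "open Z" unfolding Z_def by (rule open_chart_image[OF s(1)])
  have "\<iota> y0 \<in> Z" using slice_pt[OF p(1) s(2)] p s Q by (auto simp: y0_def Z_def)
  moreover have "open (\<iota> -` Z)"
    using Z bl(1) by (intro open_vimage linear_continuous_on)
  ultimately obtain \<delta> where \<delta>: "\<delta> > 0" "ball y0 \<delta> \<subseteq> \<iota> -` Z"
    by (meson openE vimageI2)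
  have Z_sub: "Z \<subseteq> chart_img s" by (auto simp: Z_def chart_map_in_img[OF s(1)])
  have ZD: "chart_inv s z \<in> chart_dom c \<and> chart_map c (chart_inv s z) \<in> Q" if "z \<in> Z" for z
    using that by (auto simp: Z_def chart_inv_map[OF s(1)])
  have param: "local_parametrization (sr_atlas M) S W \<psi>" if W: "open W" "W \<subseteq> ball y0 \<delta>" for W
  proof -
    have img: "\<iota> y \<in> chart_img s" if "y \<in> W" for y using that W(2) \<delta>(2) Z_sub by auto
    have \<psi>: "\<psi> y \<in> S \<inter> chart_dom s" "pr (chart_map s (\<psi> y)) = y" "chart_map s (\<psi> y) = \<iota> y" if "y \<in> W" for y
    proof -
      have "\<iota> y \<in> chart_map s ` (S \<inter> chart_dom s)" unfolding slice using img[OF that] \<iota>3 by simp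
      then obtain z where z: "z \<in> S \<inter> chart_dom s" "\<iota> y = chart_map s z" by blast
      then have "\<psi> y = z" using chart_inv_map[OF s(1)] by (simp add: \<psi>_def)
      with z show "\<psi> y \<in> S \<inter> chart_dom s" "chart_map s (\<psi> y) = \<iota> y" by simp_all
      then show "pr (chart_map s (\<psi> y)) = y" by (simp add: pr\<iota>)
    qed
    have im: "\<psi> ` W = S \<inter> (chart_dom s \<inter> (\<lambda>q. pr (chart_map s q)) -` W)"
    proof (intro equalityI subsetI)
      fix q assume q: "q \<in> S \<inter> (chart_dom s \<inter> (\<lambda>q. pr (chart_map s q)) -` W)"
      then have "\<psi> (pr (chart_map s q)) = q"
        using slice_pt[of q] chart_inv_map[OF s(1)] by (simp add: \<psi>_def)
      then show "q \<in> \<psi> ` W" using q by (metis IntD2 imageI vimageD)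
    qed (use \<psi> in auto)
    have cont: "continuous_on (chart_dom s) (\<lambda>q. pr (chart_map s q))"
      by (rule bounded_linear.continuous_on[OF bl(2) continuous_chart_map[OF s(1)]])
    have op: "openin (top_of_set S) (\<psi> ` W)"
      unfolding im openin_open
      using continuous_open_preimage[OF cont open_chart_dom[OF s(1)] W(1)] by blast
    have inj: "inj_on \<psi> W" by (rule inj_on_inverseI[where g = "\<lambda>q. pr (chart_map s q)"]) (rule \<psi>(2))
    have homeo: "homeomorphism W (\<psi> ` W) \<psi> (inv_into W \<psi>)"
    proof (rule homeomorphismI)
      show "continuous_on W \<psi>"
        unfolding \<psi>_def using img
        by (intro continuous_on_compose linear_continuous_on[OF bl(1)] continuous_on_subset[OF continuous_chart_inv[OF s(1)]]) auto
      have "continuous_on (\<psi> ` W) (\<lambda>q. pr (chart_map s q))"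
        by (rule continuous_on_subset[OF cont]) (use \<psi>(1) in auto)
      then show "continuous_on (\<psi> ` W) (inv_into W \<psi>)"
        by (rule continuous_on_eq) (use inj \<psi>(2) in auto)
    qed (use inj in auto)
    have smooth: "Ck_on 2 {y \<in> W. \<psi> y \<in> chart_dom c'} (chart_map c' \<circ> \<psi>) \<and>
        (\<forall>y\<in>W. \<psi> y \<in> chart_dom c' \<longrightarrow> inj (frechet_derivative (chart_map c' \<circ> \<psi>) (at y)))"
      if c': "c' \<in> sr_atlas M" for c'
    proof (intro conjI ballI impI)
      let ?T = "chart_map s ` (chart_dom c' \<inter> chart_dom s)"
      have T: "open ?T" by (rule open_chart_image[OF s(1) open_chart_dom[OF ch[OF c']]])
      have eq: "{y \<in> W. \<psi> y \<in> chart_dom c'} = W \<inter> \<iota> -` ?T"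
      proof (intro equalityI subsetI)
        fix y assume "y \<in> {y \<in> W. \<psi> y \<in> chart_dom c'}"
        then have y: "y \<in> W" "\<psi> y \<in> chart_dom c' \<inter> chart_dom s" using \<psi>(1)[of y] by auto
        have "\<iota> y \<in> ?T" using \<psi>(3)[OF y(1)] y(2) by (intro image_eqI[of _ _ "\<psi> y"]) auto
        with y show "y \<in> W \<inter> \<iota> -` ?T" by simp
      qed (auto simp: \<psi>_def chart_inv_map[OF s(1)])
      have comp: "chart_map c' \<circ> \<psi> = (\<lambda>y. transition s c' (\<iota> y))"
        by (auto simp: \<psi>_def transition_def)
      show "Ck_on 2 {y \<in> W. \<psi> y \<in> chart_dom c'} (chart_map c' \<circ> \<psi>)"
        unfolding eq comp
      proof (rule Ck_on_linear_compose[OF T bl(1)])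
        show "open (W \<inter> \<iota> -` ?T)" using W(1) open_vimage[OF T linear_continuous_on[OF bl(1)]] by (rule open_Int)
        show "Ck_on 2 ?T (transition s c')" using cs[OF c'] by (simp add: Ck_compatible_def)
      qed auto
      fix y assume y: "y \<in> W" "\<psi> y \<in> chart_dom c'"
      have q: "\<psi> y \<in> chart_dom c' \<inter> chart_dom s" using \<psi>(1)[OF y(1)] y(2) by auto
      have "(transition s c' has_derivative dtransition s c' (\<psi> y)) (at (\<iota> y))"
        using transition_has_derivative(2)[OF cs[OF c'] q] \<psi>(3)[OF y(1)] by simp
      from has_derivative_compose[OF bounded_linear_imp_has_derivative[OF bl(1)] this]
      have "(chart_map c' \<circ> \<psi> has_derivative (\<lambda>h. dtransition s c' (\<psi> y) (\<iota> h))) (at y)"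
        unfolding comp .
      then have "frechet_derivative (chart_map c' \<circ> \<psi>) (at y) = (\<lambda>h. dtransition s c' (\<psi> y) (\<iota> h))"
        by (rule frechet_derivative_eqI)
      \<comment> \<open>The differential of the opposite transition, followed by \<open>pr\<close>,
        is a left inverse.\<close>
      moreover have "inj (\<lambda>h. dtransition s c' (\<psi> y) (\<iota> h))"
        by (rule inj_on_inverseI[where g = "\<lambda>v. pr (dtransition c' s (\<psi> y) v)"])
          (simp add: dtransition_inverse(1)[OF s(1) ch[OF c']] dtransition_inverse(2)[OF ch[OF c'] s(1) cs[OF c'] q]
             dtransition_inverse(1)[OF ch[OF c'] s(1) cs[OF c'] q] pr\<iota>)
      ultimately show "inj (frechet_derivative (chart_map c' \<circ> \<psi>) (at y))" by simp
    qed
    show ?thesis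
      unfolding local_parametrization_def using W(1) op homeo smooth by blast
  qed
  have "\<psi> y0 = p" using slice_pt[OF p(1) s(2)] chart_inv_map[OF s] by (simp add: \<psi>_def y0_def)
  moreover have "\<psi> ` ball y0 \<delta> \<subseteq> chart_dom c" "(chart_map c \<circ> \<psi>) ` ball y0 \<delta> \<subseteq> Q"
    using ZD \<delta>(2) by (auto simp: \<psi>_def)
  moreover have "\<forall>r. 0 < r \<longrightarrow> r \<le> \<delta> \<longrightarrow> local_parametrization (sr_atlas M) S (ball y0 r) \<psi>"
    by (intro allI impI param open_ball subset_ball)
  ultimately show ?thesis using \<delta>(1) by blast
qed

section \<open>Surfaces in an adapted chart\<close>

locale parametrized_surface =
  fixes M :: "'m::{t2_space,second_countable_topology} contact_sr"
    and \<mu> :: "'m chart \<Rightarrow> real^3 \<Rightarrow> real" and S :: "'m set" and c :: "'m chart"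
    and T :: "(real^3) set" and X1 X2 :: "real^3 \<Rightarrow> real^3"
    and W :: "(real^2) set" and \<psi> :: "real^2 \<Rightarrow> 'm"
  assumes M: "contact_sub_riemannian M" and \<mu>: "smooth_measure (sr_atlas M) \<mu>"
    and c: "c \<in> sr_atlas M" and frame: "horizontal_frame M c T X1 X2"
    and param: "local_parametrization (sr_atlas M) S W \<psi>" and \<psi>_dom: "\<psi> ` W \<subseteq> chart_dom c"
    and \<psi>_frame: "(chart_map c \<circ> \<psi>) ` W \<subseteq> T"
begin

lemma frame_facts:
  "open T" "T \<subseteq> chart_img c" "Ck_on 1 T X1" "Ck_on 1 T X2"
  "x \<in> T \<Longrightarrow> orthonormal_basis_of (distr_at M c x) (sr_metric M c x) (X1 x) (X2 x)"
  using frame by (simp_all add: horizontal_frame_def Ck_section_def)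

lemma param_facts:
  "open W" "openin (top_of_set S) (\<psi> ` W)" "homeomorphism W (\<psi> ` W) \<psi> (inv_into W \<psi>)"
  "Ck_on 2 W (chart_map c \<circ> \<psi>)" "y \<in> W \<Longrightarrow> inj (frechet_derivative (chart_map c \<circ> \<psi>) (at y))"
proof -
  have *: "open W \<and> openin (top_of_set S) (\<psi> ` W) \<and> homeomorphism W (\<psi> ` W) \<psi> (inv_into W \<psi>) \<and>
     Ck_on 2 {y\<in>W. \<psi> y \<in> chart_dom c} (chart_map c \<circ> \<psi>) \<and>
        (\<forall>y\<in>W. \<psi> y \<in> chart_dom c \<longrightarrow> inj (frechet_derivative (chart_map c \<circ> \<psi>) (at y)))"
    using param c unfolding local_parametrization_def by (elim conjE) (drule (1) bspec, blast)
  have "{y\<in>W. \<psi> y \<in> chart_dom c} = W" using \<psi>_dom by auto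
  with * show "open W" "openin (top_of_set S) (\<psi> ` W)" "homeomorphism W (\<psi> ` W) \<psi> (inv_into W \<psi>)"
    "Ck_on 2 W (chart_map c \<circ> \<psi>)" "y \<in> W \<Longrightarrow> inj (frechet_derivative (chart_map c \<circ> \<psi>) (at y))"
    using \<psi>_dom by auto
qed

lemma density_facts: "Ck_on 1 T (\<mu> c)" "x \<in> T \<Longrightarrow> \<mu> c x > 0"
proof -
  have *: "smooth_on (chart_img c) (\<mu> c)" "\<forall>x\<in>chart_img c. \<mu> c x > 0"
    using \<mu> c by (simp_all add: smooth_measure_def)
  show "Ck_on 1 T (\<mu> c)"
    by (rule Ck_on_subset[OF *(1)[unfolded smooth_on_def, rule_format] frame_facts(2)])
  from *(2) show "x \<in> T \<Longrightarrow> \<mu> c x > 0" using frame_facts(2) by auto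
qed

sublocale surface_patch T X1 X2 "\<mu> c" W "chart_map c \<circ> \<psi>"
  by unfold_locales (use frame_facts density_facts param_facts \<psi>_frame in auto)

lemma \<psi>_in: "y \<in> W \<Longrightarrow> \<psi> y \<in> S" "y \<in> W \<Longrightarrow> \<psi> y \<in> chart_dom c"
  using param_facts(2) \<psi>_dom openin_subset[OF param_facts(2)] by auto

lemma continuous_\<psi>: "continuous_on W \<psi>"
  using param_facts(3) by (simp add: homeomorphism_def)

lemma eventually_\<psi>_in:
  assumes "y \<in> W" "open U" "\<psi> y \<in> U"
  shows "\<forall>\<^sub>F z in nhds y. z \<in> W \<and> \<psi> z \<in> U"
proof -
  have "open (W \<inter> \<psi> -` U)"
    by (rule continuous_open_preimage[OF continuous_\<psi> param_facts(1) assms(2)])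
  then have "\<forall>\<^sub>F z in nhds y. z \<in> W \<inter> \<psi> -` U"
    using assms by (intro eventually_nhds_in_open) auto
  then show ?thesis by simp
qed

lemma frame_at:
  assumes "y \<in> W"
  shows "X1 (chart_map c (\<psi> y)) \<in> distr_at M c (chart_map c (\<psi> y))"
    and "X2 (chart_map c (\<psi> y)) \<in> distr_at M c (chart_map c (\<psi> y))"
    and "v \<in> distr_at M c (chart_map c (\<psi> y)) \<Longrightarrow>
      \<exists>s t. v = s *\<^sub>R X1 (chart_map c (\<psi> y)) + t *\<^sub>R X2 (chart_map c (\<psi> y))"
  using frame_facts(5)[of "chart_map c (\<psi> y)"] \<psi>_frame assms unfolding orthonormal_basis_of_def by force+

lemma orthogonal_normal_imp_tangent:
  assumes "y \<in> W" "v \<bullet> normal y = 0"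
  shows "\<exists>h. v = frechet_derivative (chart_map c \<circ> \<psi>) (at y) h"
proof -
  have "(normal y \<bullet> normal y) *\<^sub>R v = ((v \<times> \<Phi>2 y) \<bullet> normal y) *\<^sub>R \<Phi>1 y + ((\<Phi>1 y \<times> v) \<bullet> normal y) *\<^sub>R \<Phi>2 y"
    using cross_frame_expansion[of "\<Phi>1 y" "\<Phi>2 y" v] assms(2) by (simp add: normal_def)
  then have "(1 / (normal y \<bullet> normal y)) *\<^sub>R ((normal y \<bullet> normal y) *\<^sub>R v) =
      (1 / (normal y \<bullet> normal y)) *\<^sub>R (((v \<times> \<Phi>2 y) \<bullet> normal y) *\<^sub>R \<Phi>1 y + ((\<Phi>1 y \<times> v) \<bullet> normal y) *\<^sub>R \<Phi>2 y)"
    by (rule arg_cong)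
  then have "v = tangent_coord1 y v *\<^sub>R \<Phi>1 y + tangent_coord2 y v *\<^sub>R \<Phi>2 y"
    using normal_nonzero[OF assms(1)] by (simp add: scaleR_add_right tangent_coord1_def tangent_coord2_def)
  also have "\<dots> = frechet_derivative (chart_map c \<circ> \<psi>) (at y)
      (tangent_coord1 y v *\<^sub>R axis 1 1 + tangent_coord2 y v *\<^sub>R axis 2 1)"
    using linear_D\<Phi>[OF assms(1)] by (simp add: linear_add linear_scale \<Phi>1_def \<Phi>2_def)
  finally show ?thesis by blast
qed

text \<open>If the conormal annihilates the frame, horizontal vectors are of the form D\<Phi> h and
  hence velocities of t \<mapsto> \<psi> (y + t h). As \<open>char_set\<close> speaks of all charts,
  a vector given in \<open>c'\<close> is first carried to \<open>c\<close> and the velocity then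
  carried back.\<close>

lemma char_if_\<alpha>_zero:
  assumes y: "y \<in> W" and \<alpha>: "\<alpha>1 y = 0" "\<alpha>2 y = 0"
  shows "\<psi> y \<in> char_set M S"
  unfolding char_set_def
proof (intro CollectI conjI ballI impI subsetI)
  show "\<psi> y \<in> S" by (rule \<psi>_in(1)[OF y])
  fix c' v assume c': "c' \<in> sr_atlas M" "\<psi> y \<in> chart_dom c'" and v: "v \<in> distr_at M c' (chart_map c' (\<psi> y))"
  let ?q = "\<psi> y"
  note ch = contact_sub_riemannianD(1)[OF M]
  note comp = contact_sub_riemannianD(2)[OF M c c'(1), of 2]
  have q: "?q \<in> chart_dom c \<inter> chart_dom c'" using \<psi>_in(2)[OF y] c' by simp
  define w where "w = dtransition c' c ?q v"
  have "smooth_one_form (sr_atlas M) (sr_form M)"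
    using M by (simp add: contact_sub_riemannian_def contact_form_def)
  from this[unfolded smooth_one_form_def, THEN conjunct2, THEN conjunct2, rule_format, OF c'(1) c, of ?q v]
  have "w \<in> distr_at M c (chart_map c ?q)"
    using q v by (simp add: distr_at_def w_def)
  then obtain s t where "w = s *\<^sub>R X1 (chart_map c ?q) + t *\<^sub>R X2 (chart_map c ?q)"
    using frame_at(3)[OF y] by blast
  then have "w \<bullet> normal y = 0"
    using \<alpha> by (simp add: \<alpha>1_def \<alpha>2_def inner_simps inner_commute[of _ "normal y"])
  then obtain h where h: "w = frechet_derivative (chart_map c \<circ> \<psi>) (at y) h"
    using orthogonal_normal_imp_tangent[OF y] by blast
  have "\<forall>\<^sub>F z in nhds y. z \<in> W \<and> \<psi> z \<in> chart_dom c'"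
    by (rule eventually_\<psi>_in[OF y open_chart_dom[OF ch[OF c'(1)]] c'(2)])
  moreover have "((\<lambda>t::real. y + t *\<^sub>R h) \<longlongrightarrow> y) (nhds 0)"
    by (auto intro!: tendsto_eq_intros filterlim_ident)
  ultimately have "\<forall>\<^sub>F t in nhds (0::real). y + t *\<^sub>R h \<in> W \<and> \<psi> (y + t *\<^sub>R h) \<in> chart_dom c'"
    by (auto simp: filterlim_iff)
  then obtain \<epsilon> where \<epsilon>: "\<epsilon> > 0" "\<And>t::real. \<bar>t\<bar> < \<epsilon> \<Longrightarrow> y + t *\<^sub>R h \<in> W \<and> \<psi> (y + t *\<^sub>R h) \<in> chart_dom c'"
    unfolding eventually_nhds_metric by (auto simp: dist_real_def)
  define \<gamma> where "\<gamma> = (\<lambda>t::real. \<psi> (y + t *\<^sub>R h))"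
  have "((\<lambda>t::real. y + t *\<^sub>R h) has_derivative (\<lambda>t. t *\<^sub>R h)) (at 0)"
    by (auto intro!: derivative_eq_intros)
  moreover have "(chart_map c \<circ> \<psi> has_derivative frechet_derivative (chart_map c \<circ> \<psi>) (at y)) (at (y + 0 *\<^sub>R h))"
    using C2_has_derivative[OF \<Phi> y] by simp
  ultimately have "((\<lambda>t. (chart_map c \<circ> \<psi>) (y + t *\<^sub>R h)) has_derivative
      (\<lambda>t. frechet_derivative (chart_map c \<circ> \<psi>) (at y) (t *\<^sub>R h))) (at 0)"
    by (rule has_derivative_compose)
  moreover have "(transition c c' has_derivative dtransition c c' ?q) (at ((chart_map c \<circ> \<psi>) (y + 0 *\<^sub>R h)))"
    using transition_has_derivative(1)[OF comp q] by simp
  ultimately have D: "((\<lambda>t. transition c c' ((chart_map c \<circ> \<psi>) (y + t *\<^sub>R h))) has_derivative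
      (\<lambda>t. dtransition c c' ?q (frechet_derivative (chart_map c \<circ> \<psi>) (at y) (t *\<^sub>R h)))) (at 0)"
    by (rule has_derivative_compose)
  have "dtransition c c' ?q (frechet_derivative (chart_map c \<circ> \<psi>) (at y) (t *\<^sub>R h)) = t *\<^sub>R v" for t
  proof -
    have "linear (dtransition c c' ?q)"
      by (rule has_derivative_linear[OF transition_has_derivative(1)[OF comp q]])
    then show ?thesis
      using linear_D\<Phi>[OF y] dtransition_inverse(1)[OF ch[OF c] ch[OF c'(1)] comp q, of v]
      by (simp add: linear_scale flip: h) (simp add: w_def)
  qed
  with D have "((\<lambda>t. transition c c' ((chart_map c \<circ> \<psi>) (y + t *\<^sub>R h))) has_derivative (\<lambda>t. t *\<^sub>R v)) (at 0)"
    by simp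
  then have "((\<lambda>t. chart_map c' (\<gamma> t)) has_derivative (\<lambda>t. t *\<^sub>R v)) (at 0)"
  proof (rule has_derivative_transform_within_open[where s = "{- \<epsilon><..<\<epsilon>}"])
    fix t assume "t \<in> {- \<epsilon><..<\<epsilon>}"
    then have "y + t *\<^sub>R h \<in> W" using \<epsilon>(2)[of t] by auto
    from chart_inv_map[OF ch[OF c] \<psi>_in(2)[OF this]]
    show "transition c c' ((chart_map c \<circ> \<psi>) (y + t *\<^sub>R h)) = chart_map c' (\<gamma> t)"
      by (simp add: transition_def \<gamma>_def)
  qed (use \<epsilon> in auto)
  moreover have "\<gamma> t \<in> S \<inter> chart_dom c'" if "\<bar>t\<bar> < \<epsilon>" for t
    using \<epsilon>(2)[OF that] \<psi>_in(1) by (auto simp: \<gamma>_def)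
  ultimately show "v \<in> tangent_space S c' ?q"
    unfolding tangent_space_def has_vector_derivative_def using \<epsilon>(1)
    by (intro CollectI exI[of _ \<gamma>] exI[of _ \<epsilon>]) (auto simp: \<gamma>_def)
qed

lemma defining_function_facts:
  assumes y: "y \<in> W" and u: "local_defining_function (sr_atlas M) S (\<psi> y) U u"
  defines "f \<equiv> u \<circ> chart_inv c"
  shows "\<forall>\<^sub>F z in nhds y. f ((chart_map c \<circ> \<psi>) z) = 0"
    and "gradient f (chart_map c (\<psi> y)) \<noteq> 0"
    and "\<exists>l. l \<noteq> 0 \<and> gradient f (chart_map c (\<psi> y)) = l *\<^sub>R normal y"
proof -
  note F = local_defining_function_in_chart[OF M c u \<psi>_in(2)[OF y]]
  have "open U" "\<psi> y \<in> U" using u by (auto simp: local_defining_function_def)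
  from eventually_\<psi>_in[OF y this] show zero: "\<forall>\<^sub>F z in nhds y. f ((chart_map c \<circ> \<psi>) z) = 0"
  proof eventually_elim
    case (elim z)
    then show ?case using F(5)[of "\<psi> z"] \<psi>_in by (simp add: f_def)
  qed
  show g: "gradient f (chart_map c (\<psi> y)) \<noteq> 0" using F(4) by (simp add: f_def)
  define l where "l = (gradient f (chart_map c (\<psi> y)) \<bullet> normal y) / (normal y \<bullet> normal y)"
  have "gradient f (chart_map c (\<psi> y)) = l *\<^sub>R normal y"
    using gradient_eq_normal_multiple[OF y F(1) _ F(3)] F(2) zero by (simp add: l_def f_def)
  moreover from this have "l \<noteq> 0" using g by auto
  ultimately show "\<exists>l. l \<noteq> 0 \<and> gradient f (chart_map c (\<psi> y)) = l *\<^sub>R normal y"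
    by blast
qed

text \<open>\<open>tangent_space\<close> admits arbitrary curves in \<open>S\<close>, without
  reference to \<psi>. A defining function controls them: its differential kills every velocity and
  is a nonzero multiple of the conormal.\<close>

lemma \<alpha>_zero_if_char:
  assumes y: "y \<in> W" and char: "\<psi> y \<in> char_set M S" and u: "local_defining_function (sr_atlas M) S (\<psi> y) U u"
  shows "\<alpha>1 y = 0" "\<alpha>2 y = 0"
proof -
  let ?g = "gradient (u \<circ> chart_inv c) (chart_map c (\<psi> y))"
  obtain l where l: "l \<noteq> 0" "?g = l *\<^sub>R normal y"
    using defining_function_facts(3)[OF y u] by blast
  have "distr_at M c (chart_map c (\<psi> y)) \<subseteq> tangent_space S c (\<psi> y)"
    using char c \<psi>_in(2)[OF y] by (simp add: char_set_def)
  then have "?g \<bullet> v = 0" if "v \<in> distr_at M c (chart_map c (\<psi> y))" for v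
    using local_defining_function_in_chart(6)[OF M c u \<psi>_in(2)[OF y]] that by blast
  from this[OF frame_at(1)[OF y]] this[OF frame_at(2)[OF y]] show "\<alpha>1 y = 0" "\<alpha>2 y = 0"
    using l by (simp_all add: \<alpha>1_def \<alpha>2_def)
qed

lemma hgrad_in_frame:
  assumes "x \<in> T" "f differentiable (at x)"
  shows "hgrad M c f x = (gradient f x \<bullet> X1 x) *\<^sub>R X1 x + (gradient f x \<bullet> X2 x) *\<^sub>R X2 x"
    and "hnorm M c x (hgrad M c f x) = sqrt ((gradient f x \<bullet> X1 x)\<^sup>2 + (gradient f x \<bullet> X2 x)\<^sup>2)"
proof -
  have "x \<in> chart_img c" using frame_facts(2) assms(1) by auto
  note * = hgrad_hnorm_eq[OF contact_sub_riemannianD(5)[OF M c this] contact_sub_riemannianD(4)[OF M c this] frame_facts(5)[OF assms(1)] assms(2)]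
  show "hgrad M c f x = (gradient f x \<bullet> X1 x) *\<^sub>R X1 x + (gradient f x \<bullet> X2 x) *\<^sub>R X2 x" by (rule *(1))
  then show "hnorm M c x (hgrad M c f x) = sqrt ((gradient f x \<bullet> X1 x)\<^sup>2 + (gradient f x \<bullet> X2 x)\<^sup>2)"
    using *(2) by simp
qed

text \<open>The defining function obtained here depends on the point; \<open>curvature\<close> does
  not involve it, so pointwise choices yield one formula on the whole patch.\<close>

lemma abs_mean_curvature:
  assumes H: "horizontal_mean_curvature M \<mu> S H" and y: "y \<in> W" and nonchar: "\<psi> y \<notin> char_set M S"
  shows "\<bar>H (\<psi> y)\<bar> = \<bar>curvature y\<bar>" "(\<alpha>1 y)\<^sup>2 + (\<alpha>2 y)\<^sup>2 \<noteq> 0"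
proof -
  show \<alpha>: "(\<alpha>1 y)\<^sup>2 + (\<alpha>2 y)\<^sup>2 \<noteq> 0"
    using char_if_\<alpha>_zero[OF y] nonchar by (auto simp: sum_power2_eq_zero_iff)
  obtain U u where u: "local_defining_function (sr_atlas M) S (\<psi> y) U u"
    and Hy: "H (\<psi> y) = - divergence (\<mu> c)
                 (\<lambda>x. hgrad M c (u \<circ> chart_inv c) x /\<^sub>R hnorm M c x (hgrad M c (u \<circ> chart_inv c) x))
                 (chart_map c (\<psi> y))"
    using H[unfolded horizontal_mean_curvature_def, rule_format, of "\<psi> y"] \<psi>_in[OF y] nonchar c by auto
  note F = local_defining_function_in_chart[OF M c u \<psi>_in(2)[OF y]]
  let ?f = "u \<circ> chart_inv c" and ?T' = "chart_map c ` (U \<inter> chart_dom c) \<inter> T"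
  have T': "open ?T'" "(chart_map c \<circ> \<psi>) y \<in> ?T'" "Ck_on 2 ?T' ?f"
    using F(1,2) frame_facts(1) \<psi>_frame y Ck_on_subset[OF F(3)] by auto
  have "\<bar>divergence (\<mu> c) (\<lambda>x. hgrad M c ?f x /\<^sub>R hnorm M c x (hgrad M c ?f x)) ((chart_map c \<circ> \<psi>) y)\<bar> = \<bar>curvature y\<bar>"
  proof (rule abs_divergence_eq_curvature[OF y T' defining_function_facts(1)[OF y u] _ \<alpha>])
    show "gradient ?f ((chart_map c \<circ> \<psi>) y) \<noteq> 0" using F(4) by simp
    fix x assume x: "x \<in> ?T'"
    then have "?f differentiable (at x)"
      using C2_has_derivative[OF T'(3)] by (auto simp: differentiable_def)
    then show "hgrad M c ?f x /\<^sub>R hnorm M c x (hgrad M c ?f x) =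
      ((gradient ?f x \<bullet> X1 x) *\<^sub>R X1 x + (gradient ?f x \<bullet> X2 x) *\<^sub>R X2 x)
      /\<^sub>R sqrt ((gradient ?f x \<bullet> X1 x)\<^sup>2 + (gradient ?f x \<bullet> X2 x)\<^sup>2)"
      using hgrad_in_frame x by simp
  qed
  then show "\<bar>H (\<psi> y)\<bar> = \<bar>curvature y\<bar>" using Hy by simp
qed

end

section \<open>Lower bounds for the horizontal part of the conormal\<close>

lemma eventually_abs_bounded:
  fixes f :: "'a::t2_space \<Rightarrow> real"
  assumes "continuous_on W f" "open W" "y0 \<in> W"
  shows "\<exists>C>0. \<forall>\<^sub>F y in nhds y0. \<bar>f y\<bar> \<le> C"
proof (intro exI conjI)
  have "isCont (\<lambda>y. \<bar>f y\<bar>) y0"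
    using assms by (simp add: continuous_on_eq_continuous_at)
  then have "((\<lambda>y. \<bar>f y\<bar>) \<longlongrightarrow> \<bar>f y0\<bar>) (nhds y0)"
    using tendsto_at_iff_tendsto_nhds[of "\<lambda>y. \<bar>f y\<bar>" y0] by (simp add: isCont_def)
  then have "\<forall>\<^sub>F y in nhds y0. \<bar>f y\<bar> < \<bar>f y0\<bar> + 1"
    by (rule order_tendstoD(2)) simp
  then show "\<forall>\<^sub>F y in nhds y0. \<bar>f y\<bar> \<le> \<bar>f y0\<bar> + 1"
    by eventually_elim simp
qed simp

context parametrized_surface
begin

definition char_norm where "char_norm y = sqrt ((\<alpha>1 y)\<^sup>2 + (\<alpha>2 y)\<^sup>2)"

lemma continuous_on_char_norm: "continuous_on W char_norm"
  unfolding char_norm_def[abs_def] by (intro continuous_intros continuous_on_\<alpha>)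

text \<open>By continuity \<open>char_norm\<close> exceeds half its value at \<open>y0\<close>, and
  the factor |y - y0| < 1 only weakens this. The weak form is chosen to agree with the bound at
  characteristic points.\<close>

lemma char_norm_bounded_below_noncharacteristic:
  assumes y0: "y0 \<in> W" and nz: "char_norm y0 \<noteq> 0"
  shows "\<exists>k>0. \<forall>\<^sub>F y in nhds y0. k * norm (y - y0) \<le> char_norm y"
proof (intro exI conjI)
  let ?k = "char_norm y0 / 2"
  have pos: "char_norm y0 > 0" using nz by (simp add: char_norm_def less_le)
  then show "?k > 0" by simp
  have "(char_norm \<longlongrightarrow> char_norm y0) (nhds y0)"
    using continuous_on_char_norm param_facts(1) y0 tendsto_at_iff_tendsto_nhds[of char_norm y0]
    by (simp add: continuous_on_eq_continuous_at isCont_def)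
  then have "\<forall>\<^sub>F y in nhds y0. ?k < char_norm y"
    by (rule order_tendstoD(1)) (use pos in simp)
  moreover have "\<forall>\<^sub>F y in nhds y0. norm (y - y0) < 1"
    unfolding eventually_nhds_metric by (intro exI[of _ 1]) (simp add: dist_norm)
  ultimately show "\<forall>\<^sub>F y in nhds y0. ?k * norm (y - y0) \<le> char_norm y"
  proof eventually_elim
    case (elim y)
    have "?k * norm (y - y0) \<le> ?k * 1" using elim(2) pos by (intro mult_left_mono) auto
    then show ?case using elim(1) by simp
  qed
qed

text \<open>Where both a_i vanish, the Leibniz rule leaves N (hgrad) v = (A1 v) X1 + (A2 v) X2, free
  of the connection. Passing from the frame \<open>e\<close> to \<open>X1\<close>, \<open>X2\<close>
  multiplies the determinant by the square of the determinant of the change of basis.\<close>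

lemma hessian_det_nonzero_imp_frame_det_nonzero:
  assumes x0: "x0 \<in> T'" and T': "open T'" "T' \<subseteq> T" and f: "Ck_on 2 T' f"
    and crit: "gradient f x0 \<bullet> X1 x0 = 0" "gradient f x0 \<bullet> X2 x0 = 0"
    and N: "horizontal_connection M c N" and e: "orthonormal_frame_at M c x0 e"
    and det: "det (\<chi> i j. horizontal_hessian M c N f x0 (e i) (e j)) \<noteq> 0"
  defines "A1 \<equiv> frechet_derivative (\<lambda>x. gradient f x \<bullet> X1 x) (at x0)"
    and "A2 \<equiv> frechet_derivative (\<lambda>x. gradient f x \<bullet> X2 x) (at x0)"
  shows "A1 (X1 x0) * A2 (X2 x0) - A1 (X2 x0) * A2 (X1 x0) \<noteq> 0"
proof -
  let ?D = "distr_at M c x0" and ?g = "sr_metric M c x0"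
  define a1 a2 where "a1 = (\<lambda>x. gradient f x \<bullet> X1 x)" and "a2 = (\<lambda>x. gradient f x \<bullet> X2 x)"
  have xT: "x0 \<in> T" "x0 \<in> chart_img c" using x0 T' frame_facts(2) by auto
  note ip = contact_sub_riemannianD(5)[OF M c xT(2)] and sub = contact_sub_riemannianD(4)[OF M c xT(2)]
  have X: "Ck_on 1 T' X1" "Ck_on 1 T' X2"
    using frame_facts(3,4) T'(2) by (auto intro: Ck_on_subset simp del: One_nat_def)
  have a: "Ck_on 1 T' a1" "Ck_on 1 T' a2"
    unfolding a1_def a2_def by (intro C1_inner T'(1) C1_gradient[OF T'(1) f] X)+
  have XD: "X1 x \<in> distr_at M c x" "X2 x \<in> distr_at M c x" if "x \<in> T'" for x
    using frame_facts(5)[of x] that T'(2) by (auto simp: orthonormal_basis_of_def)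
  have subD: "subspace (distr_at M c x)" if "x \<in> T'" for x
    using contact_sub_riemannianD(4)[OF M c, of x] that T'(2) frame_facts(2) by auto
  have secX: "Ck_section M c 1 T' X1" "Ck_section M c 1 T' X2"
    using X XD by (simp_all add: Ck_section_def)
  have secaX: "Ck_section M c 1 T' (\<lambda>x. a1 x *\<^sub>R X1 x)" "Ck_section M c 1 T' (\<lambda>x. a2 x *\<^sub>R X2 x)"
    unfolding Ck_section_def using XD subD by (auto intro!: C1_scaleR T'(1) a X subspace_scale simp del: One_nat_def)
  have secV: "Ck_section M c 1 T' (\<lambda>x. a1 x *\<^sub>R X1 x + a2 x *\<^sub>R X2 x)"
    unfolding Ck_section_def using XD subD
    by (auto intro!: C1_add C1_scaleR T'(1) a X subspace_scale subspace_add simp del: One_nat_def)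
  have "open T' \<and> T' \<subseteq> chart_img c" using T' frame_facts(2) by auto
  from N[unfolded horizontal_connection_def, rule_format, OF this, THEN conjunct1]
  have conn: "\<forall>V. Ck_section M c 1 T' V \<longrightarrow>
        (\<forall>x\<in>T'. linear (N V x) \<and> range (N V x) \<subseteq> distr_at M c x) \<and>
        (\<forall>W. Ck_section M c 1 T' W \<longrightarrow>
           (\<forall>x\<in>T'. \<forall>v. N (\<lambda>y. V y + W y) x v = N V x v + N W x v)) \<and>
        (\<forall>f. Ck_on 1 T' f \<longrightarrow>
           (\<forall>x\<in>T'. \<forall>v. N (\<lambda>y. f y *\<^sub>R V y) x v =
              frechet_derivative f (at x) v *\<^sub>R V x + f x *\<^sub>R N V x v)) \<and>
        (\<forall>W. (\<forall>y\<in>T'. W y = V y) \<longrightarrow> (\<forall>x\<in>T'. N W x = N V x))" by blast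
  note add = conn[rule_format, THEN conjunct2, THEN conjunct1, rule_format]
    and leibniz = conn[rule_format, THEN conjunct2, THEN conjunct2, THEN conjunct1, rule_format]
    and loc = conn[rule_format, THEN conjunct2, THEN conjunct2, THEN conjunct2, rule_format]
  have "hgrad M c f x = a1 x *\<^sub>R X1 x + a2 x *\<^sub>R X2 x" if "x \<in> T'" for x
    unfolding a1_def a2_def
    using that T'(2) C2_has_derivative[OF f that] by (intro hgrad_in_frame(1)) (auto simp: differentiable_def)
  \<comment> \<open>The frame formula for \<open>hgrad\<close> holds on \<open>T'\<close> only; the
    locality clause of the connection permits the replacement.\<close>
  from loc[OF secV this x0]
  have eq: "N (hgrad M c f) x0 = N (\<lambda>x. a1 x *\<^sub>R X1 x + a2 x *\<^sub>R X2 x) x0" .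
  have NV: "N (hgrad M c f) x0 v = A1 v *\<^sub>R X1 x0 + A2 v *\<^sub>R X2 x0" for v
    unfolding eq
    unfolding add[OF secaX x0] leibniz[OF secX(1) a(1) x0] leibniz[OF secX(2) a(2) x0]
    using crit by (simp add: a1_def a2_def A1_def A2_def)
  have linA: "linear A1" "linear A2"
    using has_derivative_linear[OF C1_has_derivative[OF a(1) x0]] has_derivative_linear[OF C1_has_derivative[OF a(2) x0]]
    by (simp_all add: A1_def A2_def a1_def a2_def)
  have eD: "e i \<in> ?D" for i using e by (simp add: orthonormal_frame_at_def)
  have ei: "e i = ?g (e i) (X1 x0) *\<^sub>R X1 x0 + ?g (e i) (X2 x0) *\<^sub>R X2 x0" for i
    using frame_facts(5)[OF xT(1)] eD by (simp add: orthonormal_basis_of_def)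
  define C1 C2 where "C1 = (\<lambda>i. ?g (e i) (X1 x0))" and "C2 = (\<lambda>i. ?g (e i) (X2 x0))"
  have A: "A1 (e i) = C1 i * A1 (X1 x0) + C2 i * A1 (X2 x0)" "A2 (e i) = C1 i * A2 (X1 x0) + C2 i * A2 (X2 x0)" for i
    using arg_cong[OF ei[of i], of A1] arg_cong[OF ei[of i], of A2] linA
    by (simp_all add: linear_add linear_scale C1_def C2_def)
  have hess: "horizontal_hessian M c N f x0 (e i) (e j) = A1 (e i) * C1 j + A2 (e i) * C2 j" for i j
    unfolding horizontal_hessian_def NV
    using inner_product_onD(2)[OF ip XD(1)[OF x0] XD(2)[OF x0] eD[of j], of "A1 (e i)" "A2 (e i)"]
      inner_product_onD(1)[OF ip eD eD XD(1)[OF x0]] inner_product_onD(1)[OF ip eD eD XD(2)[OF x0]]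
    by (simp add: C1_def C2_def)
  have "det (\<chi> i j. horizontal_hessian M c N f x0 (e i) (e j)) =
    (A1 (X1 x0) * A2 (X2 x0) - A1 (X2 x0) * A2 (X1 x0)) * (C1 1 * C2 2 - C1 2 * C2 1)\<^sup>2"
    by (simp add: det_2 hess A) algebra
  with det show ?thesis by auto
qed

text \<open>At a characteristic point \<open>X1\<close> and \<open>X2\<close> are tangent, so they
  are images of some h1, h2 under D\<Phi>, and the derivative of b = (X1 u, X2 u) o \<Phi> takes the
  nonsingular Hessian matrix as its values there. Hence b grows linearly away from
  \<open>y0\<close>, and b = l (\<alpha>1, \<alpha>2) with l bounded passes this growth on to
  \<open>char_norm\<close>.\<close>

lemma char_norm_bounded_below_nondegenerate:
  assumes y0: "y0 \<in> W" and char: "\<psi> y0 \<in> char_set M S"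
    and u: "local_defining_function (sr_atlas M) S (\<psi> y0) U u"
    and N: "horizontal_connection M c N" and e: "orthonormal_frame_at M c (chart_map c (\<psi> y0)) e"
    and det: "det (\<chi> i j. horizontal_hessian M c N (u \<circ> chart_inv c) (chart_map c (\<psi> y0)) (e i) (e j)) \<noteq> 0"
  shows "\<exists>k>0. \<forall>\<^sub>F y in nhds y0. k * norm (y - y0) \<le> char_norm y"
proof -
  let ?f = "u \<circ> chart_inv c" and ?\<Phi> = "chart_map c \<circ> \<psi>"
  note F = local_defining_function_in_chart[OF M c u \<psi>_in(2)[OF y0]]
  define x0 where "x0 = ?\<Phi> y0"
  define T' where "T' = chart_map c ` (U \<inter> chart_dom c) \<inter> T"
  have T': "open T'" "T' \<subseteq> T" "x0 \<in> T'" and f: "Ck_on 2 T' ?f"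
    using F(1,2) frame_facts(1) \<psi>_frame y0 Ck_on_subset[OF F(3)] by (auto simp: T'_def x0_def)
  obtain l0 where l0: "l0 \<noteq> 0" "gradient ?f x0 = l0 *\<^sub>R normal y0"
    using defining_function_facts(3)[OF y0 u] by (auto simp: x0_def)
  have \<alpha>0: "\<alpha>1 y0 = 0" "\<alpha>2 y0 = 0" by (rule \<alpha>_zero_if_char[OF y0 char u])+
  define a1 a2 where "a1 = (\<lambda>x. gradient ?f x \<bullet> X1 x)" and "a2 = (\<lambda>x. gradient ?f x \<bullet> X2 x)"
  have crit: "a1 x0 = 0" "a2 x0 = 0"
    using \<alpha>0 l0 by (simp_all add: a1_def a2_def x0_def \<alpha>1_def \<alpha>2_def)
  have X: "Ck_on 1 T' X1" "Ck_on 1 T' X2"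
    using frame_facts(3,4) T'(2) by (auto intro: Ck_on_subset simp del: One_nat_def)
  have a: "Ck_on 1 T' a1" "Ck_on 1 T' a2"
    unfolding a1_def a2_def by (intro C1_inner T'(1) C1_gradient[OF T'(1) f] X)+
  define A1 A2 where "A1 = frechet_derivative a1 (at x0)" and "A2 = frechet_derivative a2 (at x0)"
  have D: "(a1 has_derivative A1) (at (?\<Phi> y0))" "(a2 has_derivative A2) (at (?\<Phi> y0))"
    using C1_has_derivative[OF a(1) T'(3)] C1_has_derivative[OF a(2) T'(3)] by (simp_all add: A1_def A2_def x0_def)
  have dA: "A1 (X1 x0) * A2 (X2 x0) - A1 (X2 x0) * A2 (X1 x0) \<noteq> 0"
    unfolding A1_def A2_def a1_def a2_def
    by (rule hessian_det_nonzero_imp_frame_det_nonzero[OF T'(3,1,2) f _ _ N])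
      (use crit e det in \<open>simp_all add: a1_def a2_def x0_def\<close>)
  define b where "b = (\<lambda>y. a1 (?\<Phi> y) *\<^sub>R axis 1 1 + a2 (?\<Phi> y) *\<^sub>R axis 2 1 :: real^2)"
  define D\<Phi> where "D\<Phi> = frechet_derivative ?\<Phi> (at y0)"
  define B where "B = (\<lambda>h. A1 (D\<Phi> h) *\<^sub>R axis 1 1 + A2 (D\<Phi> h) *\<^sub>R axis 2 1 :: real^2)"
  have b: "(b has_derivative B) (at y0)"
    unfolding b_def B_def D\<Phi>_def
    by (intro has_derivative_add has_derivative_scaleR_left
        has_derivative_compose[OF C2_has_derivative[OF \<Phi> y0] D(1)] has_derivative_compose[OF C2_has_derivative[OF \<Phi> y0] D(2)])
  have lin: "linear B" using b by (rule has_derivative_linear)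
  obtain h1 h2 where h: "X1 x0 = D\<Phi> h1" "X2 x0 = D\<Phi> h2"
    using orthogonal_normal_imp_tangent[OF y0, of "X1 x0"] orthogonal_normal_imp_tangent[OF y0, of "X2 x0"] \<alpha>0
    by (auto simp: \<alpha>1_def \<alpha>2_def x0_def inner_commute D\<Phi>_def)
  have "surj B"
  proof (rule surjI)
    fix z :: "real^2"
    let ?d = "A1 (X1 x0) * A2 (X2 x0) - A1 (X2 x0) * A2 (X1 x0)"
    \<comment> \<open>The preimage of z in terms of h1 and h2, by Cramer's rule.\<close>
    let ?s = "(z$1 * A2 (X2 x0) - z$2 * A1 (X2 x0)) / ?d" and ?t = "(z$2 * A1 (X1 x0) - z$1 * A2 (X1 x0)) / ?d"
    have "?s * A1 (X1 x0) + ?t * A1 (X2 x0) = z$1 * ?d / ?d" "?s * A2 (X1 x0) + ?t * A2 (X2 x0) = z$2 * ?d / ?d"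
      unfolding times_divide_eq_left add_divide_distrib[symmetric] by (simp_all add: algebra_simps)
    then have st: "?s * A1 (X1 x0) + ?t * A1 (X2 x0) = z$1" "?s * A2 (X1 x0) + ?t * A2 (X2 x0) = z$2"
      using dA by simp_all
    have "B (?s *\<^sub>R h1 + ?t *\<^sub>R h2) = (?s * A1 (X1 x0) + ?t * A1 (X2 x0)) *\<^sub>R axis 1 1 + (?s * A2 (X1 x0) + ?t * A2 (X2 x0)) *\<^sub>R axis 2 1"
      unfolding linear_add[OF lin] linear_scale[OF lin] unfolding B_def h[symmetric] by (simp add: algebra_simps)
    also have "\<dots> = z" unfolding st by (simp add: vec_eq_iff forall_2 axis_def)
    finally show "B (?s *\<^sub>R h1 + ?t *\<^sub>R h2) = z" .
  qed
  then have "inj B" using lin by (simp add: linear_surjective_imp_injective)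
  moreover have "b y0 = 0" using crit by (simp add: b_def x0_def)
  ultimately obtain k where k: "k > 0" "\<forall>\<^sub>F y in nhds y0. k * norm (y - y0) \<le> norm (b y)"
    using bounded_below_if_inj_derivative[OF b] by blast
  define l where "l = (\<lambda>y. (gradient ?f (?\<Phi> y) \<bullet> normal y) / (normal y \<bullet> normal y))"
  define W' where "W' = W \<inter> ?\<Phi> -` T'"
  have W': "open W'" "y0 \<in> W'" "W' \<subseteq> W"
    unfolding W'_def using y0 T' by (auto simp: x0_def intro!: continuous_open_preimage Ck_on_imp_continuous_on[OF \<Phi>] param_facts(1))
  have "continuous_on W' l"
    unfolding l_def
  proof (intro continuous_on_divide continuous_on_inner)
    show "continuous_on W' (\<lambda>y. gradient ?f (?\<Phi> y))"
      by (rule continuous_on_compose2[OF Ck_on_imp_continuous_on[OF C1_gradient[OF T'(1) f]] continuous_on_subset[OF Ck_on_imp_continuous_on[OF \<Phi>] W'(3)]])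
        (auto simp: W'_def)
    show "continuous_on W' normal" "continuous_on W' normal" "continuous_on W' normal"
      using continuous_on_subset[OF continuous_on_basic(3) W'(3)] by auto
  qed (use normal_nonzero W'(3) in auto)
  then obtain L where L: "L > 0" "\<forall>\<^sub>F y in nhds y0. \<bar>l y\<bar> \<le> L"
    using eventually_abs_bounded[OF _ W'(1,2)] by blast
  \<comment> \<open>The one function \<open>u\<close> belonging to \<open>y0\<close> is used at all
    nearby points, and the gradient there is computed from its vanishing around each of
    them.\<close>
  have ev0: "\<forall>\<^sub>F y in nhds y0. \<forall>\<^sub>F z in nhds y. ?f (?\<Phi> z) = 0"
    using defining_function_facts(1)[OF y0 u] by (simp add: eventually_eventually)
  have "\<forall>\<^sub>F y in nhds y0. y \<in> W'" using W' by (intro eventually_nhds_in_open)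
  with k(2) L(2) ev0 have "\<forall>\<^sub>F y in nhds y0. (k / L) * norm (y - y0) \<le> char_norm y"
  proof eventually_elim
    case (elim y)
    have y: "y \<in> W" "?\<Phi> y \<in> T'" using elim(4) by (auto simp: W'_def)
    have g: "gradient ?f (?\<Phi> y) = l y *\<^sub>R normal y"
      unfolding l_def by (rule gradient_eq_normal_multiple[OF y(1) T'(1) y(2) f elim(3)])
    have ab: "a1 (?\<Phi> y) = l y * \<alpha>1 y" "a2 (?\<Phi> y) = l y * \<alpha>2 y"
      by (simp_all only: a1_def a2_def g \<alpha>1_def \<alpha>2_def inner_scaleR_left)
    have "norm (b y) = sqrt ((l y * \<alpha>1 y)\<^sup>2 + (l y * \<alpha>2 y)\<^sup>2)"
      by (simp only: b_def ab) (simp add: norm_vec_def L2_set_def sum_2 axis_def)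
    also have "\<dots> = \<bar>l y\<bar> * char_norm y"
      by (simp add: char_norm_def power_mult_distrib real_sqrt_mult flip: distrib_left)
    also have "\<dots> \<le> L * char_norm y"
      using elim(2) by (intro mult_right_mono) (auto simp: char_norm_def)
    finally have "k * norm (y - y0) \<le> L * char_norm y" using elim(1) by simp
    then show ?case using L(1) by (simp add: field_simps)
  qed
  then show ?thesis using k(1) L(1) by (intro exI[of _ "k / L"]) auto
qed

text \<open>The constant is A/k + B: a bound \<open>A\<close> for the second-order coefficients is
  divided by r >= k |y - y0|, and a bound \<open>B\<close> for the remaining ones is at most B / |y
  - y0| as |y - y0| < 1.\<close>

lemma curvature_le_inverse_dist:
  assumes y0: "y0 \<in> W" and k: "k > 0" "\<forall>\<^sub>F y in nhds y0. k * norm (y - y0) \<le> char_norm y"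
  shows "\<exists>C>0. \<forall>\<^sub>F y in nhds y0. y \<noteq> y0 \<longrightarrow> \<bar>curvature y\<bar> \<le> C / norm (y - y0)"
proof -
  let ?P = "\<lambda>y. \<bar>normal y \<bullet> P11 y\<bar> + \<bar>normal y \<bullet> P12 y\<bar> + \<bar>normal y \<bullet> P22 y\<bar>" and ?R = "\<lambda>y. \<bar>R1 y\<bar> + \<bar>R2 y\<bar>"
  have cont: "continuous_on W ?P" "continuous_on W ?R"
    by (intro continuous_intros continuous_on_P continuous_on_R continuous_on_basic)+
  obtain A where A: "A > 0" "\<forall>\<^sub>F y in nhds y0. \<bar>?P y\<bar> \<le> A"
    using eventually_abs_bounded[OF cont(1) param_facts(1) y0] by blast
  obtain B where B: "B > 0" "\<forall>\<^sub>F y in nhds y0. \<bar>?R y\<bar> \<le> B"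
    using eventually_abs_bounded[OF cont(2) param_facts(1) y0] by blast
  have "\<forall>\<^sub>F y in nhds y0. norm (y - y0) < 1"
    unfolding eventually_nhds_metric by (intro exI[of _ 1]) (simp add: dist_norm)
  with A(2) B(2) k(2) have "\<forall>\<^sub>F y in nhds y0. y \<noteq> y0 \<longrightarrow> \<bar>curvature y\<bar> \<le> (A / k + B) / norm (y - y0)"
  proof eventually_elim
    case (elim y)
    show ?case
    proof
      assume "y \<noteq> y0"
      note elim = elim this
      define n where "n = norm (y - y0)"
      have n: "n > 0" "n < 1" using elim by (auto simp: n_def)
      have r: "k * n \<le> char_norm y" "0 < k * n" using elim k n by (auto simp: n_def)
      then have "(\<alpha>1 y)\<^sup>2 + (\<alpha>2 y)\<^sup>2 \<noteq> 0" by (auto simp: char_norm_def)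
      then have "\<bar>curvature y\<bar> \<le> ?P y / char_norm y + ?R y"
        unfolding curvature_def char_norm_def by (rule abs_curvature_expr_le)
      also have "\<dots> \<le> A / (k * n) + B / n"
      proof (rule add_mono)
        show "?P y / char_norm y \<le> A / (k * n)" using elim r by (intro frac_le) auto
        have "?R y \<le> B" using elim by simp
        also have "B \<le> B / n" using n B(1) by (simp add: field_simps)
        finally show "?R y \<le> B / n" .
      qed
      finally show "\<bar>curvature y\<bar> \<le> (A / k + B) / norm (y - y0)"
        unfolding n_def by (simp add: add_divide_distrib)
    qed
  qed
  then show ?thesis using A(1) B(1) k(1) by (intro exI[of _ "A / k + B"]) (auto intro: add_pos_pos)
qed

end

section \<open>Integrability\<close>

lemma inner_product_on_UNIV_linear:
  assumes "inner_product_on UNIV B"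
  shows "linear (\<lambda>v. B v w)" "linear (B w)"
proof -
  show l: "linear (\<lambda>v. B v w)" for w
  proof (rule linearI)
    show "B (u + v) w = B u w + B v w" for u v
      using inner_product_onD(2)[OF assms, of u v w 1 1] by simp
    show "B (a *\<^sub>R v) w = a *\<^sub>R B v w" for a v
      using inner_product_onD(2)[OF assms, of v v w a 0] by simp
  qed
  have "B w = (\<lambda>v. B v w)" using inner_product_onD(1)[OF assms] by blast
  with l[of w] show "linear (B w)" by simp
qed

lemma inner_product_on_UNIV_expand:
  assumes "inner_product_on UNIV B"
  shows "B v w = (\<Sum>i\<in>UNIV. \<Sum>j\<in>UNIV. v $ i * w $ j * B (axis i 1) (axis j 1))"
proof -
  have "B v w = v$1 * B (axis 1 1) w + v$2 * B (axis 2 1) w + v$3 * B (axis 3 1) w"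
    using linear_vec3_sum[OF inner_product_on_UNIV_linear(1)[OF assms], of v w] by simp
  moreover have "B u w = w$1 * B u (axis 1 1) + w$2 * B u (axis 2 1) + w$3 * B u (axis 3 1)" for u
    using linear_vec3_sum[OF inner_product_on_UNIV_linear(2)[OF assms], of u w] by simp
  ultimately show ?thesis by (simp add: sum_3 algebra_simps)
qed

text \<open>At \<open>x0\<close> the minimum over the unit sphere gives a constant m. Near
  \<open>x0\<close> the metric coefficients move so little that half of m remains, uniformly in the
  vector.\<close>

lemma riemannian_metric_bounded_below:
  assumes G: "riemannian_metric A G" and c: "c \<in> A" "is_chart c" and x0: "x0 \<in> chart_img c"
  shows "\<exists>m>0. \<forall>\<^sub>F x in nhds x0. \<forall>v. m * (norm v)\<^sup>2 \<le> G c x v v"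
proof -
  have ip: "inner_product_on UNIV (G c x)" if "x \<in> chart_img c" for x
    using G[unfolded riemannian_metric_def, THEN conjunct1] c that by blast
  have smooth: "smooth_on (chart_img c) (\<lambda>x. G c x v w)" for v w
    using G[unfolded riemannian_metric_def, THEN conjunct2, THEN conjunct1] c by blast
  have op: "open (chart_img c)" by (rule open_chart_img[OF c(2)])
  let ?B = "G c x0"
  have cont: "continuous_on (sphere 0 1) (\<lambda>v. ?B v v)"
  proof -
    have "?B v v = (\<Sum>i\<in>UNIV. \<Sum>j\<in>UNIV. v $ i * v $ j * ?B (axis i 1) (axis j 1))" for v
      by (rule inner_product_on_UNIV_expand[OF ip[OF x0]])
    then show ?thesis by (simp only:) (intro continuous_intros)
  qed
  have "\<exists>v\<in>sphere 0 1. \<forall>w\<in>sphere 0 1. ?B v v \<le> ?B w w"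
    by (rule continuous_attains_inf[OF _ _ cont]) simp_all
  then obtain v0 where v0: "v0 \<in> sphere 0 1" "\<And>v. v \<in> sphere 0 1 \<Longrightarrow> ?B v0 v0 \<le> ?B v v" by blast
  define m where "m = ?B v0 v0"
  have "v0 \<noteq> 0" using v0(1) by auto
  then have m: "m > 0" unfolding m_def using inner_product_onD(3)[OF ip[OF x0]] by blast
  have low: "m * (norm v)\<^sup>2 \<le> ?B v v" for v
  proof (cases "v = 0")
    case True
    then show ?thesis using linear_0[OF inner_product_on_UNIV_linear(1)[OF ip[OF x0], of v]] by simp
  next
    case False
    let ?w = "v /\<^sub>R norm v"
    have w: "?w \<in> sphere 0 1" using False by simp
    have v: "v = norm v *\<^sub>R ?w" using False by simp
    have "?B v v = (norm v)\<^sup>2 * ?B ?w ?w"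
      using linear_scale[OF inner_product_on_UNIV_linear(1)[OF ip[OF x0], of v], of "norm v" ?w]
        linear_scale[OF inner_product_on_UNIV_linear(2)[OF ip[OF x0], of ?w], of "norm v" ?w] v
      by (simp add: power2_eq_square)
    then show ?thesis
      using mult_left_mono[OF v0(2)[OF w], of "(norm v)\<^sup>2"] by (simp add: m_def mult.commute)
  qed
  \<comment> \<open>Nine coefficients with an error below m/18 each add up to at most m/2.\<close>
  have "\<forall>\<^sub>F x in nhds x0. \<bar>G c x (axis i 1) (axis j 1) - ?B (axis i 1) (axis j 1)\<bar> < m / 18" for i j
  proof -
    have "isCont (\<lambda>x. G c x (axis i 1) (axis j 1)) x0"
    proof -
      have "continuous_on (chart_img c) (\<lambda>x. G c x (axis i 1) (axis j 1))"
        by (rule Ck_on_imp_continuous_on[OF smooth[unfolded smooth_on_def, rule_format]])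
      then show ?thesis using op x0 by (simp add: continuous_on_eq_continuous_at)
    qed
    then have "((\<lambda>x. G c x (axis i 1) (axis j 1)) \<longlongrightarrow> ?B (axis i 1) (axis j 1)) (nhds x0)"
      using tendsto_at_iff_tendsto_nhds[of "\<lambda>x. G c x (axis i 1) (axis j 1)" x0] by (simp add: isCont_def)
    from tendstoD[OF this, of "m / 18"] m show ?thesis by (simp add: dist_real_def)
  qed
  then have "\<forall>\<^sub>F x in nhds x0. \<forall>i j. \<bar>G c x (axis i 1) (axis j 1) - ?B (axis i 1) (axis j 1)\<bar> < m / 18"
    by (intro eventually_all_finite) auto
  moreover have "\<forall>\<^sub>F x in nhds x0. x \<in> chart_img c" using op x0 by (rule eventually_nhds_in_open)
  ultimately have "\<forall>\<^sub>F x in nhds x0. \<forall>v. (m / 2) * (norm v)\<^sup>2 \<le> G c x v v"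
  proof eventually_elim
    case (elim x)
    show ?case
    proof
      fix v
      have "G c x v v - ?B v v =
          (\<Sum>i\<in>UNIV. \<Sum>j\<in>UNIV. v $ i * v $ j * (G c x (axis i 1) (axis j 1) - ?B (axis i 1) (axis j 1)))"
        unfolding inner_product_on_UNIV_expand[OF ip[OF x0], of v v] inner_product_on_UNIV_expand[OF ip[OF elim(2)], of v v]
        by (simp add: sum_subtractf right_diff_distrib)
      also have "\<bar>\<dots>\<bar> \<le> (\<Sum>i\<in>(UNIV::3 set). \<Sum>j\<in>(UNIV::3 set). norm v * norm v * (m / 18))"
      proof (intro order_trans[OF sum_abs] sum_mono)
        fix i j
        show "\<bar>v $ i * v $ j * (G c x (axis i 1) (axis j 1) - ?B (axis i 1) (axis j 1))\<bar> \<le> norm v * norm v * (m / 18)"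
          unfolding abs_mult using elim(1) component_le_norm_cart[of v]
          by (intro mult_mono) (auto intro: less_imp_le)
      qed
      also have "\<dots> = (m / 2) * (norm v)\<^sup>2" by (simp add: power2_eq_square)
      finally show "(m / 2) * (norm v)\<^sup>2 \<le> G c x v v" using low[of v] abs_ge_minus_self[of "G c x v v - ?B v v"] by (simp add: field_simps)
    qed
  qed
  then show ?thesis using m by (intro exI[of _ "m / 2"]) simp
qed

text \<open>The inner product identifies vectors with covectors, so some vector represents
  \<open>g\<close>; normalized, it is orthogonal to everything that \<open>g\<close> kills. With the
  tangent space for \<open>K\<close> this shows that the choice in \<open>unit_normal\<close> has a
  witness.\<close>

lemma unit_vector_orthogonal_to_plane:
  fixes B :: "real^3 \<Rightarrow> real^3 \<Rightarrow> real"
  assumes B: "inner_product_on UNIV B" and g: "g \<noteq> 0" and K: "\<And>v. v \<in> K \<Longrightarrow> g \<bullet> v = 0"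
  shows "\<exists>n. B n n = 1 \<and> (\<forall>v\<in>K. B n v = 0)"
proof -
  define L where "L = (\<lambda>v. \<chi> i. B v (axis i 1))"
  have LB: "L v \<bullet> w = B v w" for v w
    using linear_vec3_sum[OF inner_product_on_UNIV_linear(2)[OF B], of v w]
    by (simp add: L_def inner_vec_def sum_3 algebra_simps)
  have lin: "linear L"
    by (rule linearI) (simp_all add: L_def vec_eq_iff linear_add[OF inner_product_on_UNIV_linear(1)[OF B]]
      linear_scale[OF inner_product_on_UNIV_linear(1)[OF B]])
  have "v = 0" if "L v = 0" for v
  proof (rule ccontr)
    assume "v \<noteq> 0"
    then have "B v v > 0" using inner_product_onD(3)[OF B] by blast
    with LB[of v v] that show False by simp
  qed
  then have "inj L" using lin by (simp add: linear_injective_0)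
  then have "surj L" using lin by (simp add: linear_injective_imp_surjective)
  then obtain n where n: "L n = g" by (metis surjD)
  have "n \<noteq> 0" using n g linear_0[OF lin] by auto
  then have pos: "B n n > 0" using inner_product_onD(3)[OF B] by blast
  let ?s = "inverse (sqrt (B n n))"
  have sc: "B (?s *\<^sub>R n) v = ?s * B n v" for v
    using linear_scale[OF inner_product_on_UNIV_linear(1)[OF B], of ?s n v] by simp
  have "B n (?s *\<^sub>R n) = ?s * B n n"
    using linear_scale[OF inner_product_on_UNIV_linear(2)[OF B], of n ?s n] by simp
  then have "B (?s *\<^sub>R n) (?s *\<^sub>R n) = ?s * ?s * B n n" by (simp add: sc)
  also have "\<dots> = 1" using pos by (simp flip: inverse_mult_distrib)
  finally show ?thesis
    using K LB[of n] n by (intro exI[of _ "?s *\<^sub>R n"]) (auto simp: sc)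
qed

context parametrized_surface
begin

text \<open>The determinant det (n, \<Phi>1, \<Phi>2) is the Euclidean product of n with the
  conormal. A vector of unit length for \<open>G\<close> has Euclidean length at most 1 / sqrt m,
  and the other factors are continuous.\<close>

lemma induced_density_bounded:
  assumes G: "riemannian_metric (sr_atlas M) G" and y0: "y0 \<in> W"
    and ldf: "\<And>q. q \<in> S \<Longrightarrow> \<exists>U u. local_defining_function (sr_atlas M) S q U u"
  shows "\<exists>D>0. \<forall>\<^sub>F y in nhds y0. induced_density \<mu> G S c (\<psi> y) (\<Phi>1 y) (\<Phi>2 y) \<le> D"
proof -
  let ?\<Phi> = "chart_map c \<circ> \<psi>"
  note ch = contact_sub_riemannianD(1)[OF M c]
  have "?\<Phi> y0 \<in> chart_img c" using \<psi>_in(2)[OF y0] chart_map_in_img[OF ch] by simp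
  from riemannian_metric_bounded_below[OF G c ch this] obtain m
    where m: "m > 0" "\<forall>\<^sub>F x in nhds (?\<Phi> y0). \<forall>v. m * (norm v)\<^sup>2 \<le> G c x v v" by blast
  have "isCont ?\<Phi> y0"
    using continuous_on_eq_continuous_at[OF param_facts(1), of ?\<Phi>] Ck_on_imp_continuous_on[OF \<Phi>] y0 by blast
  then have "filterlim ?\<Phi> (nhds (?\<Phi> y0)) (nhds y0)"
    unfolding isCont_def by (rule tendsto_at_iff_tendsto_nhds[THEN iffD1])
  with m(2) have low: "\<forall>\<^sub>F y in nhds y0. \<forall>v. m * (norm v)\<^sup>2 \<le> G c (?\<Phi> y) v v"
    unfolding filterlim_iff by blast
  have "continuous_on W (\<lambda>y. \<mu> c (?\<Phi> y) * norm (normal y))"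
    by (intro continuous_intros continuous_on_basic)
  from eventually_abs_bounded[OF this param_facts(1) y0] obtain A
    where A: "A > 0" "\<forall>\<^sub>F y in nhds y0. \<bar>\<mu> c (?\<Phi> y) * norm (normal y)\<bar> \<le> A" by blast
  have "\<forall>\<^sub>F y in nhds y0. y \<in> W" using param_facts(1) y0 by (rule eventually_nhds_in_open)
  with low A(2) have "\<forall>\<^sub>F y in nhds y0. induced_density \<mu> G S c (\<psi> y) (\<Phi>1 y) (\<Phi>2 y) \<le> A * inverse (sqrt m)"
  proof eventually_elim
    case (elim y)
    let ?n = "unit_normal G S c (\<psi> y)" and ?x = "chart_map c (\<psi> y)"
    obtain U u where u: "local_defining_function (sr_atlas M) S (\<psi> y) U u"
      using ldf[OF \<psi>_in(1)[OF elim(3)]] by blast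
    note F = local_defining_function_in_chart[OF M c u \<psi>_in(2)[OF elim(3)]]
    have "inner_product_on UNIV (G c ?x)"
      using G[unfolded riemannian_metric_def, THEN conjunct1] c chart_map_in_img[OF ch \<psi>_in(2)[OF elim(3)]] by blast
    from unit_vector_orthogonal_to_plane[OF this F(4,6)]
    have "\<exists>n. G c ?x n n = 1 \<and> (\<forall>v\<in>tangent_space S c (\<psi> y). G c ?x n v = 0)" .
    from someI_ex[OF this] have "G c ?x ?n ?n = 1" unfolding unit_normal_def by (rule conjunct1)
    with elim(1)[rule_format, of ?n] have "m * (norm ?n)\<^sup>2 \<le> 1" by simp
    then have "(sqrt m * norm ?n)\<^sup>2 \<le> 1\<^sup>2" using m(1) by (simp add: power_mult_distrib)
    then have "sqrt m * norm ?n \<le> 1" by (rule power2_le_imp_le) simp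
    then have n: "norm ?n \<le> inverse (sqrt m)" using m(1) by (simp add: field_simps)
    have "induced_density \<mu> G S c (\<psi> y) (\<Phi>1 y) (\<Phi>2 y) = \<bar>\<mu> c ?x * (?n \<bullet> normal y)\<bar>"
      unfolding induced_density_def vol_form_def normal_def dot_cross_det ..
    also have "\<dots> \<le> \<bar>\<mu> c ?x\<bar> * (norm ?n * norm (normal y))"
      unfolding abs_mult by (intro mult_left_mono Cauchy_Schwarz_ineq2) simp
    also have "\<dots> = \<bar>\<mu> c (?\<Phi> y) * norm (normal y)\<bar> * norm ?n" by (simp add: abs_mult)
    also have "\<dots> \<le> A * inverse (sqrt m)"
      using elim(2) n A(1) by (intro mult_mono) auto
    finally show ?case .
  qed
  then show ?thesis using A(1) m(1) by (intro exI[of _ "A * inverse (sqrt m)"]) simp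
qed

end

text \<open>Integrability of 1/|y - y0| in dimension two, from upper bounds for the measure of balls
  alone. The function is dominated by a series of multiples of indicators of the balls with radii
  \<delta> / 2^n; halving the radius doubles the bound and quarters the measure, which leaves a
  geometric series.\<close>

lemma set_integrable_if_le_inverse_dist:
  fixes f :: "'a \<Rightarrow> real" and \<psi> :: "real^2 \<Rightarrow> 'a"
  assumes meas: "(\<lambda>q. indicator (\<psi> ` ball y0 \<delta>) q *\<^sub>R \<bar>f q\<bar>) \<in> borel_measurable \<sigma>"
    and \<delta>: "\<delta> > 0" and C: "C \<ge> 0" and K: "K \<ge> 0"
    and balls: "\<And>r. 0 < r \<Longrightarrow> r \<le> \<delta> \<Longrightarrow> \<psi> ` ball y0 r \<in> sets \<sigma>"
      "\<And>r. 0 < r \<Longrightarrow> r \<le> \<delta> \<Longrightarrow> emeasure \<sigma> (\<psi> ` ball y0 r) \<le> ennreal (K * r\<^sup>2)"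
    and le: "\<And>y. y \<in> ball y0 \<delta> \<Longrightarrow> y \<noteq> y0 \<Longrightarrow> \<bar>f (\<psi> y)\<bar> \<le> C / norm (y - y0)"
  shows "set_integrable \<sigma> (\<psi> ` ball y0 \<delta>) (\<lambda>q. \<bar>f q\<bar>)"
proof -
  define r where "r = (\<lambda>n::nat. \<delta> / 2 ^ n)"
  have r: "0 < r n" "r n \<le> \<delta>" for n
    using \<delta> by (simp_all add: r_def field_simps)
  define E where "E = (\<lambda>n. \<psi> ` ball y0 (r n))"
  have E: "E n \<in> sets \<sigma>" "emeasure \<sigma> (E n) \<le> ennreal (K * (r n)\<^sup>2)" for n
    unfolding E_def using balls r by blast+
  \<comment> \<open>The centre lies in every \<open>E n\<close>, and the bound \<open>le\<close>
    says nothing about it; the measures K r^2 tend to 0 and make it negligible.\<close>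
  have null: "(\<Inter>n. E n) \<in> null_sets \<sigma>"
  proof (rule null_setsI)
    show "(\<Inter>n. E n) \<in> sets \<sigma>" using E(1) by blast
    have "(\<lambda>n. K * (\<delta> * (1 / 2) ^ n)\<^sup>2) \<longlonglongrightarrow> K * (\<delta> * 0)\<^sup>2"
      by (intro tendsto_intros LIMSEQ_power_zero) simp
    moreover have "(\<lambda>n. K * (\<delta> * (1 / 2) ^ n)\<^sup>2) = (\<lambda>n. K * (r n)\<^sup>2)"
      by (simp add: r_def power_one_over)
    ultimately have "(\<lambda>n. K * (r n)\<^sup>2) \<longlonglongrightarrow> 0" by simp
    from tendsto_ennrealI[OF this] have lim: "(\<lambda>n. ennreal (K * (r n)\<^sup>2)) \<longlonglongrightarrow> 0" by simp
    have "emeasure \<sigma> (\<Inter>n. E n) \<le> ennreal (K * (r n)\<^sup>2)" for n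
      using emeasure_mono[of "\<Inter>n. E n" "E n" \<sigma>] E[of n] by (blast intro: order_trans)
    then have "emeasure \<sigma> (\<Inter>n. E n) \<le> 0"
      by (intro LIMSEQ_le_const[OF lim]) auto
    then show "emeasure \<sigma> (\<Inter>n. E n) = 0" by simp
  qed
  \<comment> \<open>The bound on the shell between the radii \<open>r (Suc n)\<close> and
    \<open>r n\<close>, where the inner radius is the relevant one.\<close>
  define b where "b = (\<lambda>n::nat. C / r (Suc n))"
  have b: "b n \<ge> 0" for n using C r(1)[of "Suc n"] by (simp add: b_def)
  let ?F = "\<lambda>q. indicator (\<psi> ` ball y0 \<delta>) q *\<^sub>R \<bar>f q\<bar>"
  have bound: "ennreal (norm (?F q)) \<le> (\<Sum>n. ennreal (b n) * indicator (E n) q)" if q: "q \<notin> (\<Inter>n. E n)" for q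
  proof (cases "q \<in> \<psi> ` ball y0 \<delta>")
    case True
    then obtain y where y: "y \<in> ball y0 \<delta>" "q = \<psi> y" by blast
    obtain n0 where "q \<notin> E n0" using q by blast
    then have "y \<notin> ball y0 (r n0)" using y by (auto simp: E_def)
    then have n0: "r n0 \<le> norm (y - y0)" by (simp add: dist_norm norm_minus_commute)
    \<comment> \<open>The first radius that does not exceed the distance. It is not the one of index
      0, because r 0 = \<delta>, so the shell has index N - 1.\<close>
    define N where "N = (LEAST n. r n \<le> norm (y - y0))"
    have N: "r N \<le> norm (y - y0)" "\<And>k. k < N \<Longrightarrow> norm (y - y0) < r k"
      unfolding N_def using LeastI[of "\<lambda>n. r n \<le> norm (y - y0)", OF n0] not_less_Least
      by (auto simp: not_le[symmetric])
    have "N \<noteq> 0" using N(1) y(1) by (intro notI) (simp add: r_def dist_norm norm_minus_commute)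
    then obtain n where n: "N = Suc n" by (cases N) auto
    have "norm (y - y0) < r n" using N(2) n by simp
    then have qE: "q \<in> E n" unfolding E_def y(2) by (intro imageI) (simp add: dist_norm norm_minus_commute)
    have "y \<noteq> y0" using N(1) r(1)[of N] by auto
    then have "\<bar>f q\<bar> \<le> C / norm (y - y0)" using le y by simp
    also have "\<dots> \<le> b n" unfolding b_def using N(1) n C r(1) by (intro divide_left_mono) (auto intro: less_le_trans mult_pos_pos)
    finally have "ennreal (norm (?F q)) \<le> ennreal (b n) * indicator (E n) q"
      using True qE by (simp add: ennreal_leI)
    also have "\<dots> \<le> (\<Sum>n. ennreal (b n) * indicator (E n) q)"
      using sum_le_suminf[of "\<lambda>n. ennreal (b n) * indicator (E n) q" "{n}"] qE by simp
    finally show ?thesis .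
  qed simp
  have "(\<integral>\<^sup>+q. ennreal (norm (?F q)) \<partial>\<sigma>) \<le> (\<integral>\<^sup>+q. (\<Sum>n. ennreal (b n) * indicator (E n) q) \<partial>\<sigma>)"
    by (rule nn_integral_mono_AE[OF AE_I'[OF null]]) (use bound in blast)
  also have "\<dots> = (\<Sum>n. \<integral>\<^sup>+q. ennreal (b n) * indicator (E n) q \<partial>\<sigma>)"
    using E(1) by (intro nn_integral_suminf) auto
  also have "\<dots> = (\<Sum>n. ennreal (b n) * emeasure \<sigma> (E n))"
    using E(1) by (simp add: nn_integral_cmult_indicator)
  also have "\<dots> \<le> (\<Sum>n. ennreal (2 * C * K * \<delta> * (1 / 2) ^ n))"
  proof (intro suminf_le)
    fix n
    have "ennreal (b n) * emeasure \<sigma> (E n) \<le> ennreal (b n) * ennreal (K * (r n)\<^sup>2)"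
      by (intro mult_left_mono E) simp
    also have "\<dots> = ennreal (b n * (K * (r n)\<^sup>2))" using b by (simp add: ennreal_mult')
    also have "b n * (K * (r n)\<^sup>2) = 2 * C * K * \<delta> * (1 / 2) ^ n"
      using \<delta> by (simp add: b_def r_def power2_eq_square power_one_over field_simps)
    finally show "ennreal (b n) * emeasure \<sigma> (E n) \<le> ennreal (2 * C * K * \<delta> * (1 / 2) ^ n)" .
  qed simp_all
  also have "\<dots> = ennreal (\<Sum>n. 2 * C * K * \<delta> * (1 / 2) ^ n)"
    using C K \<delta> by (intro suminf_ennreal2 summable_mult summable_geometric) auto
  also have "\<dots> < \<infinity>" by simp
  finally show ?thesis
    unfolding set_integrable_def using meas by (intro integrableI_bounded)
qed

text \<open>Both cases are read off from the hypotheses: \<open>nondegenerate\<close> supplies a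
  defining function at a characteristic point, and the description of the curvature supplies one
  elsewhere.\<close>

lemma local_defining_function_exists:
  assumes "\<And>p. p \<in> char_set M S \<Longrightarrow> p isolated_in char_set M S \<and> nondegenerate M S p"
    and "horizontal_mean_curvature M \<mu> S H" and "q \<in> S"
  shows "\<exists>U u. local_defining_function (sr_atlas M) S q U u"
  using assms unfolding nondegenerate_def horizontal_mean_curvature_def by blast

text \<open>The value at the exceptional point may be arbitrary, since points are closed: it is
  added back as a multiple of the indicator of a measurable singleton.\<close>

lemma borel_measurable_if_continuous_off_point:
  fixes f :: "'a::t2_space \<Rightarrow> real"
  assumes V: "openin (top_of_set S) V" and cont: "continuous_on (V - {p}) f" and p: "p \<in> V"
  shows "(\<lambda>q. indicator V q *\<^sub>R f q) \<in> borel_measurable (restrict_space borel S)"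
proof -
  obtain Q where Q: "open Q" "V = S \<inter> Q" using V unfolding openin_open by blast
  have sub: "V - {p} \<subseteq> S" "{p} \<subseteq> S" using Q p by auto
  have sets: "(V - {p}) \<inter> space (restrict_space borel S) \<in> sets (restrict_space borel S)"
    "{p} \<in> sets (restrict_space borel S)"
  proof -
    have "(V - {p}) \<inter> space (restrict_space borel S) = S \<inter> (Q - {p})"
      using Q(2) by (auto simp: space_restrict_space)
    moreover have "Q - {p} \<in> sets borel" using Q(1) by (intro borel_open open_Diff) simp_all
    ultimately show "(V - {p}) \<inter> space (restrict_space borel S) \<in> sets (restrict_space borel S)"
      unfolding sets_restrict_space by (rule image_eqI)
    have "{p} = S \<inter> {p}" using sub by auto
    then show "{p} \<in> sets (restrict_space borel S)"
      unfolding sets_restrict_space by (rule image_eqI) simp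
  qed
  have "sets (restrict_space (restrict_space borel S) (V - {p})) = sets (restrict_space borel (V - {p}))"
    using sub(1) by (simp only: sets_restrict_restrict_space Int_absorb1)
  from measurable_cong_sets[OF this refl] borel_measurable_continuous_on_restrict[OF cont]
  have "f \<in> borel_measurable (restrict_space (restrict_space borel S) (V - {p}))" by blast
  then have "(\<lambda>q. indicator (V - {p}) q *\<^sub>R f q) \<in> borel_measurable (restrict_space borel S)"
    using borel_measurable_restrict_space_iff[OF sets(1), of f] by blast
  then have "(\<lambda>q. indicator (V - {p}) q *\<^sub>R f q + f p * indicator {p} q) \<in> borel_measurable (restrict_space borel S)"
    using sets(2) by measurable
  also have "(\<lambda>q. indicator (V - {p}) q *\<^sub>R f q + f p * indicator {p} q) = (\<lambda>q. indicator V q *\<^sub>R f q)"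
    using p by (auto simp: indicator_def)
  finally show ?thesis .
qed

context parametrized_surface
begin

lemma emeasure_small_ball_le:
  assumes \<sigma>: "riemannian_induced_measure (sr_atlas M) \<mu> G S \<sigma>" and B: "ball y0 r \<subseteq> W" "0 < r"
    and sets: "\<psi> ` ball y0 r \<in> sets \<sigma>"
    and D: "D > 0" "\<And>y. y \<in> ball y0 r \<Longrightarrow> induced_density \<mu> G S c (\<psi> y) (\<Phi>1 y) (\<Phi>2 y) \<le> D"
  shows "emeasure \<sigma> (\<psi> ` ball y0 r) \<le> ennreal (D * unit_ball_vol 2 * r\<^sup>2)"
proof -
  have eq: "emeasure \<sigma> E = (\<integral>\<^sup>+ y. indicator {y\<in>W. \<psi> y \<in> E} y *
      ennreal (induced_density \<mu> G S c (\<psi> y) (\<Phi>1 y) (\<Phi>2 y)) \<partial>lborel)" if "E \<in> sets \<sigma>" "E \<subseteq> \<psi> ` W" for E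
    using \<sigma>[unfolded riemannian_induced_measure_def, THEN conjunct2, THEN conjunct2, rule_format, OF c conjI[OF param \<psi>_dom] that]
    by (simp add: \<Phi>1_def \<Phi>2_def)
  have inj: "inj_on \<psi> W"
    using param_facts(3) by (metis homeomorphism_apply1 inj_on_inverseI)
  have "emeasure \<sigma> (\<psi> ` ball y0 r) \<le> (\<integral>\<^sup>+ y. ennreal D * indicator (ball y0 r) y \<partial>lborel)"
    unfolding eq[OF sets image_mono[OF B(1)]]
  proof (rule nn_integral_mono)
    fix y
    \<comment> \<open>The measure is expressed over the whole patch \<open>W\<close>; injectivity of
      \<psi> there cuts the domain of integration down to the small ball.\<close>
    have "y \<in> ball y0 r" if "y \<in> W" "\<psi> y \<in> \<psi> ` ball y0 r"
      using that inj B(1) by (metis inj_on_image_mem_iff)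
    then show "indicator {y \<in> W. \<psi> y \<in> \<psi> ` ball y0 r} y * ennreal (induced_density \<mu> G S c (\<psi> y) (\<Phi>1 y) (\<Phi>2 y))
        \<le> ennreal D * indicator (ball y0 r) y"
      using D(2)[of y] by (auto simp: indicator_def intro: ennreal_leI)
  qed
  also have "\<dots> = ennreal D * ennreal (unit_ball_vol 2 * r\<^sup>2)"
    using B(2) by (simp add: nn_integral_cmult_indicator emeasure_ball)
  also have "\<dots> = ennreal (D * unit_ball_vol 2 * r\<^sup>2)"
    using D(1) by (simp add: ennreal_mult' mult.assoc)
  finally show ?thesis .
qed

end

text \<open>\<open>nondegenerate\<close> asserts the existence of a chart together with a connection
  and a frame in it. Working in this very chart avoids comparing Hessians between charts.\<close>

lemma adapted_chart:
  fixes M :: "'m::{t2_space,second_countable_topology} contact_sr"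
  assumes M: "contact_sub_riemannian M" and p: "p \<in> S" and nd: "p \<in> char_set M S \<Longrightarrow> nondegenerate M S p"
  shows "\<exists>c\<in>sr_atlas M. p \<in> chart_dom c \<and> (p \<in> char_set M S \<longrightarrow> (\<exists>U u N e.
     local_defining_function (sr_atlas M) S p U u \<and> horizontal_connection M c N \<and>
     orthonormal_frame_at M c (chart_map c p) e \<and>
     det (\<chi> i j. horizontal_hessian M c N (u \<circ> chart_inv c) (chart_map c p) (e i) (e j)) \<noteq> 0))"
proof (cases "p \<in> char_set M S")
  case True
  from nd[OF this] show ?thesis unfolding nondegenerate_def by blast
next
  case False
  have "(\<Union>c\<in>sr_atlas M. chart_dom c) = UNIV"
    using M by (simp add: contact_sub_riemannian_def smooth_atlas_def)
  with False show ?thesis by blast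
qed

theorem theorem1p1:
  fixes M :: "'m::{t2_space,second_countable_topology} contact_sr"
    and \<mu> :: "'m chart \<Rightarrow> real^3 \<Rightarrow> real"
    and S :: "'m set"
    and H :: "'m \<Rightarrow> real"
    and G :: "'m chart \<Rightarrow> real^3 \<Rightarrow> real^3 \<Rightarrow> real^3 \<Rightarrow> real"
    and \<sigma> :: "'m measure"
  assumes "contact_sub_riemannian M"
    and "smooth_measure (sr_atlas M) \<mu>"
    and "C2_embedded_surface (sr_atlas M) S"
    and "\<And>p. p \<in> char_set M S \<Longrightarrow> p isolated_in char_set M S \<and> nondegenerate M S p"
    and "horizontal_mean_curvature M \<mu> S H"
    and "riemannian_extension M G"
    and "riemannian_induced_measure (sr_atlas M) \<mu> G S \<sigma>"
  shows "locally_integrable_on_surface S \<sigma> H"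
  unfolding locally_integrable_on_surface_def
proof
  fix p assume p: "p \<in> S"
  have ldf: "\<exists>U u. local_defining_function (sr_atlas M) S q U u" if "q \<in> S" for q
    by (rule local_defining_function_exists[OF _ assms(5) that]) (rule assms(4))
  have nd: "p \<in> char_set M S \<Longrightarrow> nondegenerate M S p" using assms(4) by blast
  obtain c where c: "c \<in> sr_atlas M" "p \<in> chart_dom c" and nondeg: "p \<in> char_set M S \<longrightarrow> (\<exists>U u N e.
     local_defining_function (sr_atlas M) S p U u \<and> horizontal_connection M c N \<and>
     orthonormal_frame_at M c (chart_map c p) e \<and>
     det (\<chi> i j. horizontal_hessian M c N (u \<circ> chart_inv c) (chart_map c p) (e i) (e j)) \<noteq> 0)"
    using adapted_chart[OF assms(1) p nd] by blast
  have "chart_map c p \<in> chart_img c"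
    by (rule chart_map_in_img[OF contact_sub_riemannianD(1)[OF assms(1) c(1)] c(2)])
  from horizontal_frame_exists[OF assms(1) c(1) this] obtain T X1 X2
    where frame: "horizontal_frame M c T X1 X2" "chart_map c p \<in> T" by blast
  from frame(1) have "open T" by (simp add: horizontal_frame_def)
  from slice_parametrization[OF assms(1,3) c(1) p c(2) this frame(2)] obtain \<psi> y0 \<delta>
    where \<delta>: "\<delta> > 0" and \<psi>0: "\<psi> y0 = p"
      and ball_param: "\<And>r. 0 < r \<Longrightarrow> r \<le> \<delta> \<Longrightarrow> local_parametrization (sr_atlas M) S (ball y0 r) \<psi>"
      and into: "\<psi> ` ball y0 \<delta> \<subseteq> chart_dom c" "(chart_map c \<circ> \<psi>) ` ball y0 \<delta> \<subseteq> T" by blast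
  interpret parametrized_surface M \<mu> S c T X1 X2 "ball y0 \<delta>" \<psi>
    by unfold_locales (use assms(1,2) c(1) frame(1) ball_param \<delta> into in auto)
  have y0: "y0 \<in> ball y0 \<delta>" using \<delta> by simp
  have "\<exists>k>0. \<forall>\<^sub>F y in nhds y0. k * norm (y - y0) \<le> char_norm y"
  proof (cases "p \<in> char_set M S")
    case True
    with nondeg show ?thesis
      using char_norm_bounded_below_nondegenerate[OF y0] unfolding \<psi>0 by blast
  next
    case False
    then have "char_norm y0 \<noteq> 0"
      using char_if_\<alpha>_zero[OF y0] by (auto simp: \<psi>0 char_norm_def sum_power2_eq_zero_iff)
    then show ?thesis by (rule char_norm_bounded_below_noncharacteristic[OF y0])
  qed
  then obtain k where k: "k > 0" "\<forall>\<^sub>F y in nhds y0. k * norm (y - y0) \<le> char_norm y" by blast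
  obtain C where C: "C > 0" "\<forall>\<^sub>F y in nhds y0. y \<noteq> y0 \<longrightarrow> \<bar>curvature y\<bar> \<le> C / norm (y - y0)"
    using curvature_le_inverse_dist[OF y0 k] by blast
  have "riemannian_metric (sr_atlas M) G" using assms(6) by (simp add: riemannian_extension_def)
  from induced_density_bounded[OF this y0 ldf] obtain D
    where D: "D > 0" "\<forall>\<^sub>F y in nhds y0. induced_density \<mu> G S c (\<psi> y) (\<Phi>1 y) (\<Phi>2 y) \<le> D" by blast
  have "\<forall>\<^sub>F y in nhds y0. k * norm (y - y0) \<le> char_norm y \<and> (y \<noteq> y0 \<longrightarrow> \<bar>curvature y\<bar> \<le> C / norm (y - y0))
      \<and> induced_density \<mu> G S c (\<psi> y) (\<Phi>1 y) (\<Phi>2 y) \<le> D"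
    using k(2) C(2) D(2) by eventually_elim blast
  then obtain r0 where r0: "r0 > 0" "\<And>y. dist y y0 < r0 \<Longrightarrow>
      k * norm (y - y0) \<le> char_norm y \<and> (y \<noteq> y0 \<longrightarrow> \<bar>curvature y\<bar> \<le> C / norm (y - y0))
      \<and> induced_density \<mu> G S c (\<psi> y) (\<Phi>1 y) (\<Phi>2 y) \<le> D"
    unfolding eventually_nhds_metric by blast
  \<comment> \<open>The patch, and with it the formula for \<sigma>, stays on the ball of radius
    \<delta>; the estimates are used on this possibly smaller ball.\<close>
  define r where "r = min r0 \<delta>"
  have r: "r > 0" "r \<le> \<delta>" "ball y0 r \<subseteq> ball y0 \<delta>" using r0(1) \<delta> by (auto simp: r_def)
  have near: "k * norm (y - y0) \<le> char_norm y" "y \<noteq> y0 \<Longrightarrow> \<bar>curvature y\<bar> \<le> C / norm (y - y0)"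
      "induced_density \<mu> G S c (\<psi> y) (\<Phi>1 y) (\<Phi>2 y) \<le> D" if "y \<in> ball y0 r" for y
    using r0(2)[of y] that by (auto simp: r_def dist_commute)
  \<comment> \<open>In the punctured ball the lower bound makes \<open>char_norm\<close> positive,
    so no other characteristic point lies there and the curvature formula applies
    throughout.\<close>
  have off: "\<bar>H (\<psi> y)\<bar> = \<bar>curvature y\<bar>" "(\<alpha>1 y)\<^sup>2 + (\<alpha>2 y)\<^sup>2 \<noteq> 0" if y: "y \<in> ball y0 r" "y \<noteq> y0" for y
  proof -
    have yW: "y \<in> ball y0 \<delta>" using y r(3) by blast
    have "0 < k * norm (y - y0)" using y(2) k(1) by simp
    then have \<alpha>: "char_norm y \<noteq> 0" using near(1)[OF y(1)] by linarith
    have "\<psi> y \<notin> char_set M S"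
    proof
      assume char: "\<psi> y \<in> char_set M S"
      obtain U u where "local_defining_function (sr_atlas M) S (\<psi> y) U u" using ldf[OF \<psi>_in(1)[OF yW]] by blast
      from \<alpha>_zero_if_char[OF yW char this] \<alpha> show False by (simp add: char_norm_def)
    qed
    from abs_mean_curvature[OF assms(5) yW this]
    show "\<bar>H (\<psi> y)\<bar> = \<bar>curvature y\<bar>" "(\<alpha>1 y)\<^sup>2 + (\<alpha>2 y)\<^sup>2 \<noteq> 0" .
  qed
  have op: "openin (top_of_set S) (\<psi> ` ball y0 s)" if "0 < s" "s \<le> \<delta>" for s
    using ball_param[OF that] by (simp add: local_parametrization_def)
  have sets_eq: "sets \<sigma> = sets (restrict_space borel S)"
    using assms(7) by (simp add: riemannian_induced_measure_def)
  have sets: "\<psi> ` ball y0 s \<in> sets \<sigma>" if s: "0 < s" "s \<le> \<delta>" for s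
  proof -
    obtain Q where "open Q" "\<psi> ` ball y0 s = S \<inter> Q"
      using op[OF s] unfolding openin_open by blast
    then show ?thesis
      unfolding sets_eq sets_restrict_space by (intro image_eqI[of _ _ Q] borel_open)
  qed
  let ?V = "\<psi> ` ball y0 r" and ?inv = "inv_into (ball y0 \<delta>) \<psi>"
  have inv: "?inv (\<psi> y) = y" if "y \<in> ball y0 \<delta>" for y
    using homeomorphism_apply1[OF param_facts(3) that] .
  \<comment> \<open>Measurability of the absolute value of \<open>H\<close>: off \<open>p\<close> it
    is the continuous function \<open>curvature\<close> composed with the inverse of the
    parametrization, whatever signs \<open>H\<close> takes.\<close>
  have "continuous_on (?V - {p}) (\<lambda>q. \<bar>H q\<bar>)"
  proof -
    have maps: "?inv q \<in> ball y0 r \<and> ?inv q \<noteq> y0 \<and> q = \<psi> (?inv q)" if "q \<in> ?V - {p}" for q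
      using that inv r(3) \<psi>0 by auto
    have "continuous_on (?V - {p}) ?inv"
      by (rule continuous_on_subset[of "\<psi> ` ball y0 \<delta>"]) (use param_facts(3) r(3) in \<open>auto simp: homeomorphism_def\<close>)
    moreover have "?inv ` (?V - {p}) \<subseteq> {y \<in> ball y0 \<delta>. (\<alpha>1 y)\<^sup>2 + (\<alpha>2 y)\<^sup>2 \<noteq> 0}"
      using maps off(2) r(3) by blast
    ultimately have "continuous_on (?V - {p}) (\<lambda>q. curvature (?inv q))"
      by (rule continuous_on_compose2[OF continuous_on_curvature])
    then have "continuous_on (?V - {p}) (\<lambda>q. \<bar>curvature (?inv q)\<bar>)" by (rule continuous_on_rabs)
    then show ?thesis
      by (rule continuous_on_eq) (use maps off(1) in metis)
  qed
  moreover have pV: "p \<in> ?V" using \<psi>0 r(1) by force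
  ultimately have "(\<lambda>q. indicator ?V q *\<^sub>R \<bar>H q\<bar>) \<in> borel_measurable \<sigma>"
    using borel_measurable_if_continuous_off_point[OF op[OF r(1,2)]] measurable_cong_sets[OF sets_eq refl] by blast
  then have "set_integrable \<sigma> ?V (\<lambda>q. \<bar>H q\<bar>)"
  proof (rule set_integrable_if_le_inverse_dist[where C = C and K = "D * unit_ball_vol 2"])
    show "0 \<le> D * unit_ball_vol 2" using D(1) by (simp add: unit_ball_vol_nonneg)
    fix s :: real assume s: "0 < s" "s \<le> r"
    then have sub: "ball y0 s \<subseteq> ball y0 r" by auto
    show "\<psi> ` ball y0 s \<in> sets \<sigma>" using sets s r(2) by simp
    then show "emeasure \<sigma> (\<psi> ` ball y0 s) \<le> ennreal (D * unit_ball_vol 2 * s\<^sup>2)"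
      using sub r(3) s near(3) D(1) by (intro emeasure_small_ball_le[OF assms(7)]) auto
  next
    fix y assume "y \<in> ball y0 r" "y \<noteq> y0"
    then show "\<bar>H (\<psi> y)\<bar> \<le> C / norm (y - y0)" using off(1) near(2) by simp
  qed (use r C in auto)
  with op[OF r(1,2)] pV show "\<exists>V. openin (top_of_set S) V \<and> p \<in> V \<and> set_integrable \<sigma> V (\<lambda>q. \<bar>H q\<bar>)"
    by blast
qed

end
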